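(* Let $(X,\|\cdot\|,\leq)$ together with $\tau$ be a bi-$\mathrm{AM}$-space (with respect to a fixed generating family of seminorms $\mathscr{P}$ of $\tau$) with $\tau$ compatible with the Banach lattice structure, and let $(T(t))_{t\geq0}$ be a positive $\tau$-bi-continuous semigroup on $X$ with generator $(A,\mathrm{D}(A))$. Let $\gamma=\gamma(\tau,\|\cdot\|)$ be the mixed topology and assume that $(X,\gamma)$ is complete and $(T(t))_{t\geq0}$ is $\gamma$-locally equicontinuous. Let $X_{-1}$ be the first extrapolation space of $(T(t))_{t\geq 0}$, with norm $\|\cdot\|_{-1}$, topology $\tau_{-1}$ and extrapolated generator $A_{-1}:X\to X_{-1}$. Let $B\in\mathscr{L}(X,X_{-1})$ be such that $B:(X,\tau)\to(X_{-1},\tau_{-1})$ is continuous. Suppose that $B$ is positive and that there exists a real $\lambda>\mathrm{s}(A)$ such that $R(\lambda,A_{-1})B$ is local and $K:=\|R(\lambda,A_{-1})B\|<1$. Then the operator $(A_{-1}+B)_{|X}$, with domain $\{x\in X: A_{-1}x+Bx\in X\}$, is the generator of a positive $\tau$-bi-continuous semigroup $(S(t))_{t\geq0}$ on $X$.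
   Context: All vector spaces are real; spectra and resolvent sets are taken in the complexification. $\mathscr{L}(X,Y)$ denotes the norm-bounded linear operators. $R(\lambda,A)=(\lambda-A)^{-1}$ for $\lambda\in\rho(A)$, and $\mathrm{s}(A)=\sup\{\mathrm{Re}\,\lambda:\lambda\in\sigma(A)\}$. **Assumption on $(X,\|\cdot\|,\tau)$.** $(X,\|\cdot\|)$ is a Banach space and $\tau$ is a locally convex Hausdorff topology on $X$, coarser than the norm topology, such that every $\|\cdot\|$-bounded $\tau$-Cauchy sequence is $\tau$-convergent and $\|x\|=\sup\{|\varphi(x)|:\varphi\in(X,\tau)',\ \|\varphi\|\leq1\}$ for all $x\in X$. $\mathscr{P}$ is a fixed family of seminorms generating $\tau$. **Bi-continuous semigroup.** A family $(T(t))_{t\geq0}$ of bounded linear operators on $X$ is a $\tau$-bi-continuous semigroup if: (1) $T(t+s)=T(t)T(s)$, $T(0)=I$; (2) $t\mapsto T(t)x$ is $\tau$-continuous on $[0,\infty)$ for every $x\in X$; (3) there are $M\geq1$, $\omega\in\mathbb{R}$ with $\|T(t)\|\leq M e^{\omega t}$ for all $t\ge0$; (4) if $(x_n)$ is norm-bounded and $\tau$-convergent to $0$, then $T(s)x_n\to0$ in $\tau$ uniformly for $s\in[0,t_0]$, for each $t_0\geq0$. Its generator is $Ax=\tau\text{-}\lim_{t\to0}\frac{T(t)x-x}{t}$, with $\mathrm{D}(A)$ the set of $x\in X$ for which this $\tau$-limit exists and $\sup_{t\in(0,1]}\frac{\|T(t)x-x\|}{t}<\infty$. **Order.** A Banach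 lattice $(X,\|\cdot\|,\leq)$ has positive cone $X_+=\{x\in X: x\geq0\}$. The topology $\tau$ is compatible (with the Banach lattice structure) if $p(x)\leq p(y)$ for all $p\in\mathscr{P}$ and $x,y\in X$ with $|x|\leq|y|$. $X$ is a bi-$\mathrm{AM}$-space if it is a Banach lattice, $\tau$ is a locally convex Hausdorff topology on $X$ coarser than the norm topology such that every $\|\cdot\|$-bounded $\tau$-Cauchy sequence is $\tau$-convergent and $\|x\|=\sup\{|\varphi(x)|:\varphi\in(X,\tau)',\ \|\varphi\|\leq1\}$ for all $x\in X$, and $\|x\vee y\|=\max\{\|x\|,\|y\|\}$ and $p(x\vee y)=\max\{p(x),p(y)\}$ for all $x,y\in X_+$, $p\in\mathscr{P}$. A semigroup is positive if each $T(t)$ maps $X_+$ into $X_+$. **Mixed topology.** $\gamma=\gamma(\tau,\|\cdot\|)$ is the locally convex topology on $X$ generated by the family $\widetilde{\mathscr{P}}$ of seminorms $\widetilde p_{(a_n,p_n)}(x)=\sup_{n\in\mathbb{N}}a_np_n(x)$, where $(a_n)\in c_0$, $a_n\geq0$, and $p_n\in\mathscr{P}$, the $p_n$ being normalized (rescaled by positive constants if necessary) so that $p_n\leq\|\cdot\|$. The semigroup is $\gamma$-locally equicontinuous if for some (equivalently all) $t_0>0$: for every $p\in\widetilde{\mathscr{P}}$ there are $q\in\widetilde{\mathscr{P}}$ and $M\geq0$ with $p(T(t)x)\leq Mq(x)$ for all $x\in X$, $t\in[0,t_0]$. **Extrapolation space.** Fix a real $\lambda_0\in\rho(A)$ (after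 rescaling one may take $\lambda_0=0$; different choices give equivalent spaces). Let $\underline{X}_0=\overline{\mathrm{D}(A)}^{\|\cdot\|}$; the restriction of $(T(t))$ to $\underline{X}_0$ is a $C_0$-semigroup whose generator $\underline{A}_0$ is the part of $A$ in $\underline{X}_0$. Let $\underline{X}_{-1}$ be the completion of $\underline{X}_0$ in the norm $\|(\lambda_0-\underline{A}_0)^{-1}x\|$; the $C_0$-semigroup extends to a $C_0$-semigroup on $\underline{X}_{-1}$ with generator $\underline{A}_{-1}$, $\mathrm{D}(\underline{A}_{-1})=\underline{X}_0$. Repeating the construction gives $\underline{X}_{-2}$ and $\underline{A}_{-2}$ with $\mathrm{D}(\underline{A}_{-2})=\underline{X}_{-1}$. One has continuous inclusions $\underline{X}_0\hookrightarrow X\hookrightarrow\underline{X}_{-1}$, where $x\in X$ is identified with $(\lambda_0-\underline{A}_{-1})R(\lambda_0,A)x$. The first extrapolation space is $X_{-1}:=(\lambda_0-\underline{A}_{-2})(X)\subseteq\underline{X}_{-2}$ with norm $\|x\|_{-1}=\|(\lambda_0-\underline{A}_{-2})^{-1}x\|$ and locally convex topology $\tau_{-1}$ generated by $p_{-1}(x)=p((\lambda_0-\underline{A}_{-2})^{-1}x)$, $p\in\mathscr{P}$. Then $X\subseteq X_{-1}$, $(T(t))$ extends to a $\tau_{-1}$-bi-continuous semigroup $(T_{-1}(t))_{t\geq0}$ on $X_{-1}$ with generator $A_{-1}$, $\mathrm{D}(A_{-1})=X$, and for $\lambda\in\rho(A)$ the resolvent $R(\lambda,A_{-1})$ maps $X_{-1}$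 onto $X$. **Positivity in $X_{-1}$.** $X_{-1,+}$ is the closure of $X_+$ in $X_{-1}$ with respect to the mixed topology $\gamma_{-1}=\gamma(\tau_{-1},\|\cdot\|_{-1})$, i.e., the locally convex topology on $X_{-1}$ generated by the seminorms $x\mapsto\sup_{n\in\mathbb{N}}a_n\,p_n((\lambda_0-\underline{A}_{-2})^{-1}x)$, where $(a_n)\in c_0$, $a_n\geq0$, and $p_n\in\mathscr{P}$, the $p_n$ being normalized (rescaled by positive constants if necessary) so that $p_n\leq\|\cdot\|$ on $X$. $B:X\to X_{-1}$ is positive if $B(X_+)\subseteq X_{-1,+}$. **Local operator.** A norm-bounded operator $T$ on $X$ is local if for all $p\in\mathscr{P}$ and $\varepsilon>0$ there exist $K>0$ and $q\in\mathscr{P}$ such that $p(Tx)\leq Kq(x)+\varepsilon\|x\|$ for all $x\in X$. *)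

theory Defs
  imports "HOL-Analysis.Analysis" "HOL-Library.Lattice_Algebras"
begin

section \<open>Banach lattices\<close>

class banach_lattice = banach + ordered_real_vector + lattice_ab_group_add_abs +
  assumes norm_le_of_abs_le: "\<bar>x\<bar> \<le> \<bar>y\<bar> \<Longrightarrow> norm x \<le> norm y"


section \<open>Locally convex topologies\<close>

definition seminorm :: "('v::real_vector \<Rightarrow> real) \<Rightarrow> bool" where
  "seminorm p \<longleftrightarrow>
     (\<forall>x y. p (x + y) \<le> p x + p y) \<and> (\<forall>c x. p (c *\<^sub>R x) = \<bar>c\<bar> * p x)"

text \<open>
  The topology generated on the linear subspace \<open>V\<close> by the seminorms \<open>Q\<close>. Inserting \<open>V\<close> into the
  subbase makes \<open>V\<close> the underlying set even if \<open>Q\<close> is empty.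
\<close>

definition lc_topology :: "'v set \<Rightarrow> ('v::real_vector \<Rightarrow> real) set \<Rightarrow> 'v topology" where
  "lc_topology V Q =
     topology_generated_by (insert V {{y \<in> V. q (y - x) < e} | q x e. q \<in> Q \<and> x \<in> V \<and> 0 < e})"

definition lc_Cauchy_seq :: "('v::real_vector \<Rightarrow> real) set \<Rightarrow> (nat \<Rightarrow> 'v) \<Rightarrow> bool" where
  "lc_Cauchy_seq Q x \<longleftrightarrow> (\<forall>q\<in>Q. \<forall>e>0. \<exists>N. \<forall>m\<ge>N. \<forall>n\<ge>N. q (x m - x n) < e)"

definition lc_Cauchy_filter :: "('v::real_vector \<Rightarrow> real) set \<Rightarrow> 'v filter \<Rightarrow> bool" where
  "lc_Cauchy_filter Q F \<longleftrightarrow>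
     (\<forall>q\<in>Q. \<forall>e>0. \<exists>S. (\<forall>\<^sub>F x in F. x \<in> S) \<and> (\<forall>x\<in>S. \<forall>y\<in>S. q (x - y) < e))"

definition lc_complete :: "('v::real_vector \<Rightarrow> real) set \<Rightarrow> bool" where
  "lc_complete Q \<longleftrightarrow>
     (\<forall>F. F \<noteq> bot \<and> lc_Cauchy_filter Q F \<longrightarrow>
        (\<exists>x. limitin (lc_topology UNIV Q) (\<lambda>y. y) x F))"

definition dual_unit_ball :: "('v::real_normed_vector \<Rightarrow> real) set \<Rightarrow> ('v \<Rightarrow> real) set" where
  "dual_unit_ball P =
     {\<phi>. bounded_linear \<phi> \<and> continuous_map (lc_topology UNIV P) euclideanreal \<phi> \<and> onorm \<phi> \<le> 1}"

definition bi_space :: "('v::banach \<Rightarrow> real) set \<Rightarrow> bool" where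
  "bi_space P \<longleftrightarrow>
     (\<forall>p\<in>P. seminorm p) \<and>
     Hausdorff_space (lc_topology UNIV P) \<and>
     (\<forall>U. openin (lc_topology UNIV P) U \<longrightarrow> open U) \<and>
     (\<forall>x. bounded (range x) \<and> lc_Cauchy_seq P x \<longrightarrow>
        (\<exists>l. limitin (lc_topology UNIV P) x l sequentially)) \<and>
     (\<forall>x. norm x = (SUP \<phi>\<in>dual_unit_ball P. \<bar>\<phi> x\<bar>))"

definition bi_AM_space :: "('v::banach_lattice \<Rightarrow> real) set \<Rightarrow> bool" where
  "bi_AM_space P \<longleftrightarrow>
     bi_space P \<and>
     (\<forall>x y :: 'v. 0 \<le> x \<and> 0 \<le> y \<longrightarrow> norm (sup x y) = max (norm x) (norm y)) \<and>
     (\<forall>p\<in>P. \<forall>x y. 0 \<le> x \<and> 0 \<le> y \<longrightarrow> p (sup x y) = max (p x) (p y))"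

definition compatible :: "('v::banach_lattice \<Rightarrow> real) set \<Rightarrow> bool" where
  "compatible P \<longleftrightarrow> (\<forall>p\<in>P. \<forall>x y. \<bar>x\<bar> \<le> \<bar>y\<bar> \<longrightarrow> p x \<le> p y)"

definition normalized_seminorms :: "('v::real_normed_vector \<Rightarrow> real) set \<Rightarrow> ('v \<Rightarrow> real) set" where
  "normalized_seminorms P =
     {\<lambda>x. c * p x | c p. p \<in> P \<and> 0 < c \<and> (\<forall>x. c * p x \<le> norm x)}"

definition mixed_seminorms :: "('v::real_normed_vector \<Rightarrow> real) set \<Rightarrow> ('v \<Rightarrow> real) set" where
  "mixed_seminorms P =
     {\<lambda>x. SUP n. a n * p n x | (a :: nat \<Rightarrow> real) p.
        a \<longlonglongrightarrow> 0 \<and> (\<forall>n. 0 \<le> a n) \<and> (\<forall>n. p n \<in> normalized_seminorms P)}"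

definition local_op :: "('v::real_normed_vector \<Rightarrow> real) set \<Rightarrow> ('v \<Rightarrow> 'v) \<Rightarrow> bool" where
  "local_op P N \<longleftrightarrow>
     bounded_linear N \<and>
     (\<forall>p\<in>P. \<forall>\<epsilon>>0. \<exists>K>0. \<exists>q\<in>P. \<forall>x. p (N x) \<le> K * q x + \<epsilon> * norm x)"


section \<open>Unbounded operators, spectrum and resolvent\<close>

text \<open>
  An operator with a domain is represented by its graph: \<open>(x, y) \<in> A\<close> means that \<open>x\<close> lies in the
  domain \<open>Domain A\<close> and is mapped to \<open>y\<close>.
\<close>

type_synonym 'v operator = "('v \<times> 'v) set"

definition op_val :: "'v operator \<Rightarrow> 'v \<Rightarrow> 'v" where
  "op_val A x = (THE y. (x, y) \<in> A)"

definition op_part :: "'v operator \<Rightarrow> 'v set \<Rightarrow> 'v operator" where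
  "op_part A V = {(x, y) \<in> A. x \<in> V \<and> y \<in> V}"

text \<open>
  The value at \<open>x\<close> of the resolvent at a real point: the \<open>y\<close> in the domain with
  \<open>lam *\<^sub>R y - A y = x\<close>, that is, \<open>A y = lam *\<^sub>R y - x\<close>.
\<close>

definition resolvent :: "real \<Rightarrow> 'v::real_vector operator \<Rightarrow> 'v \<Rightarrow> 'v" where
  "resolvent lam A x = (THE y. (y, lam *\<^sub>R y - x) \<in> A)"

text \<open>
  The complexification of a real space is the space of pairs \<open>(x, y)\<close>, read as \<open>x + \<i> y\<close>; its
  product norm is equivalent to each of the usual complexification norms. Since the inverse of a
  complex-linear map is complex-linear, real linearity of \<open>R\<close> below suffices.
\<close>

definition cplx_scale :: "complex \<Rightarrow> 'v::real_vector \<times> 'v \<Rightarrow> 'v \<times> 'v" where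
  "cplx_scale z w =
     (Re z *\<^sub>R fst w - Im z *\<^sub>R snd w, Im z *\<^sub>R fst w + Re z *\<^sub>R snd w)"

definition op_complexification :: "'v operator \<Rightarrow> ('v \<times> 'v) operator" where
  "op_complexification A = {((x, y), (u, v)) | x y u v. (x, u) \<in> A \<and> (y, v) \<in> A}"

definition resolvent_set :: "'v::real_normed_vector operator \<Rightarrow> complex set" where
  "resolvent_set A =
     {z. \<exists>R. bounded_linear R \<and>
           {(cplx_scale z x - y, x) | x y. (x, y) \<in> op_complexification A} = {(w, R w) | w. True}}"

definition spectral_bound :: "'v::real_normed_vector operator \<Rightarrow> ereal" where
  "spectral_bound A = (SUP z\<in>- resolvent_set A. ereal (Re z))"


section \<open>Semigroups\<close>

definition linear_on_subspace :: "'v set \<Rightarrow> ('v::real_vector \<Rightarrow> 'w::real_vector) \<Rightarrow> bool" where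
  "linear_on_subspace V f \<longleftrightarrow>
     (\<forall>x\<in>V. \<forall>y\<in>V. f (x + y) = f x + f y) \<and> (\<forall>c. \<forall>x\<in>V. f (c *\<^sub>R x) = c *\<^sub>R f x)"

text \<open>
  Bi-continuous semigroups on a linear subspace \<open>V\<close> of an ambient vector space, with respect to
  the norm \<open>nrm\<close> on \<open>V\<close> and the topology generated by the seminorms \<open>Q\<close> on \<open>V\<close>. The subspace is
  needed because the first extrapolation space is a subspace of another space with its own norm.
  Only the values at \<open>t \<ge> 0\<close> and \<open>x \<in> V\<close> matter.
\<close>

definition bi_continuous_semigroup ::
  "'v::real_vector set \<Rightarrow> ('v \<Rightarrow> real) \<Rightarrow> ('v \<Rightarrow> real) set \<Rightarrow> (real \<Rightarrow> 'v \<Rightarrow> 'v) \<Rightarrow> bool" where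
  "bi_continuous_semigroup V nrm Q T \<longleftrightarrow>
     (\<forall>t\<ge>0. T t ` V \<subseteq> V \<and> linear_on_subspace V (T t) \<and>
        (\<exists>C. \<forall>x\<in>V. nrm (T t x) \<le> C * nrm x)) \<and>
     (\<forall>t\<ge>0. \<forall>s\<ge>0. \<forall>x\<in>V. T (t + s) x = T t (T s x)) \<and> (\<forall>x\<in>V. T 0 x = x) \<and>
     (\<forall>x\<in>V. continuous_map (top_of_set {0..}) (lc_topology V Q) (\<lambda>t. T t x)) \<and>
     (\<exists>M\<ge>1. \<exists>\<omega>. \<forall>t\<ge>0. \<forall>x\<in>V. nrm (T t x) \<le> M * exp (\<omega> * t) * nrm x) \<and>
     (\<forall>x :: nat \<Rightarrow> 'v.
        range x \<subseteq> V \<and> (\<exists>C. \<forall>n. nrm (x n) \<le> C) \<and> limitin (lc_topology V Q) x 0 sequentially \<longrightarrow>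
        (\<forall>t0\<ge>0. \<forall>q\<in>Q. uniform_limit {0..t0} (\<lambda>n s. q (T s (x n))) (\<lambda>s. 0) sequentially))"

definition bi_generator ::
  "'v::real_vector set \<Rightarrow> ('v \<Rightarrow> real) \<Rightarrow> ('v \<Rightarrow> real) set \<Rightarrow> (real \<Rightarrow> 'v \<Rightarrow> 'v) \<Rightarrow> 'v operator" where
  "bi_generator V nrm Q T =
     {(x, y). x \<in> V \<and>
        limitin (lc_topology V Q) (\<lambda>t. (T t x - x) /\<^sub>R t) y (at_right 0) \<and>
        (\<exists>C. \<forall>t\<in>{0<..1}. nrm (T t x - x) / t \<le> C)}"

definition positive_semigroup :: "(real \<Rightarrow> 'v::banach_lattice \<Rightarrow> 'v) \<Rightarrow> bool" where
  "positive_semigroup T \<longleftrightarrow> (\<forall>t\<ge>0. \<forall>x\<ge>0. 0 \<le> T t x)"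

definition locally_equicontinuous ::
  "('v::real_vector \<Rightarrow> real) set \<Rightarrow> (real \<Rightarrow> 'v \<Rightarrow> 'v) \<Rightarrow> bool" where
  "locally_equicontinuous Q T \<longleftrightarrow>
     (\<exists>t0>0. \<forall>p\<in>Q. \<exists>q\<in>Q. \<exists>M\<ge>0. \<forall>x. \<forall>t\<in>{0..t0}. p (T t x) \<le> M * q x)"

definition C0_semigroup :: "(real \<Rightarrow> 'v::banach \<Rightarrow> 'v) \<Rightarrow> bool" where
  "C0_semigroup T \<longleftrightarrow>
     (\<forall>t\<ge>0. bounded_linear (T t)) \<and>
     (\<forall>t\<ge>0. \<forall>s\<ge>0. \<forall>x. T (t + s) x = T t (T s x)) \<and> (\<forall>x. T 0 x = x) \<and>
     (\<forall>x. continuous_on {0..} (\<lambda>t. T t x))"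

definition C0_generator :: "(real \<Rightarrow> 'v::banach \<Rightarrow> 'v) \<Rightarrow> 'v operator" where
  "C0_generator T = {(x, y). ((\<lambda>t. (T t x - x) /\<^sub>R t) \<longlongrightarrow> y) (at_right 0)}"


section \<open>Extrapolation spaces\<close>

definition is_completion ::
  "'v::real_vector set \<Rightarrow> ('v \<Rightarrow> real) \<Rightarrow> ('v \<Rightarrow> 'w::banach) \<Rightarrow> bool" where
  "is_completion V nrm j \<longleftrightarrow>
     linear_on_subspace V j \<and> (\<forall>x\<in>V. norm (j x) = nrm x) \<and> closure (j ` V) = UNIV"

text \<open>
  The extrapolated norms depend on the semigroup, so the completions cannot be type constructors
  applied to \<open>'a\<close>. Instead, \<open>'b\<close> and \<open>'c\<close> are arbitrary Banach spaces realising the first and the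
  second completion of the space of strong continuity, and the following data say how:
  \<open>base\<close> is the point of the resolvent set used in the construction, \<open>incl1\<close> and \<open>incl2\<close> are the
  embeddings into the completions, \<open>sg1\<close> and \<open>sg2\<close> are the extended \<open>C\<^sub>0\<close>-semigroups on the
  completions, and \<open>sgX\<close> is the extended bi-continuous semigroup on the first extrapolation space,
  which is a linear subspace of \<open>'c\<close>. The predicate \<open>is_extrapolation\<close> below characterises these data.
\<close>

record ('a, 'b, 'c) extrapolation =
  base :: real
  incl1 :: "'a \<Rightarrow> 'b"
  sg1 :: "real \<Rightarrow> 'b \<Rightarrow> 'b"
  incl2 :: "'b \<Rightarrow> 'c"
  sg2 :: "real \<Rightarrow> 'c \<Rightarrow> 'c"
  sgX :: "real \<Rightarrow> 'c \<Rightarrow> 'c"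

abbreviation gen :: "('a::banach \<Rightarrow> real) set \<Rightarrow> (real \<Rightarrow> 'a \<Rightarrow> 'a) \<Rightarrow> 'a operator" where
  "gen P T \<equiv> bi_generator UNIV norm P T"

definition space0 :: "('a::banach \<Rightarrow> real) set \<Rightarrow> (real \<Rightarrow> 'a \<Rightarrow> 'a) \<Rightarrow> 'a set" where
  "space0 P T = closure (Domain (gen P T))"

definition gen0 :: "('a::banach \<Rightarrow> real) set \<Rightarrow> (real \<Rightarrow> 'a \<Rightarrow> 'a) \<Rightarrow> 'a operator" where
  "gen0 P T = op_part (gen P T) (space0 P T)"

text \<open>
  The identification of the whole space \<open>'a\<close> with a subspace of the first completion \<open>'b\<close>, and
  through it with a subspace of \<open>'c\<close>: \<open>x\<close> corresponds to the value of \<open>base - C0_generator sg1\<close> at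
  the resolvent of \<open>x\<close>.
\<close>

definition emb1 ::
  "('a::banach \<Rightarrow> real) set \<Rightarrow> (real \<Rightarrow> 'a \<Rightarrow> 'a) \<Rightarrow>
   ('a, 'b::banach, 'c::banach) extrapolation \<Rightarrow> 'a \<Rightarrow> 'b" where
  "emb1 P T E x =
     (let r = incl1 E (resolvent (base E) (gen P T) x)
      in base E *\<^sub>R r - op_val (C0_generator (sg1 E)) r)"

definition emb ::
  "('a::banach \<Rightarrow> real) set \<Rightarrow> (real \<Rightarrow> 'a \<Rightarrow> 'a) \<Rightarrow>
   ('a, 'b::banach, 'c::banach) extrapolation \<Rightarrow> 'a \<Rightarrow> 'c" where
  "emb P T E x = incl2 E (emb1 P T E x)"

definition ext_space ::
  "('a::banach \<Rightarrow> real) set \<Rightarrow> (real \<Rightarrow> 'a \<Rightarrow> 'a) \<Rightarrow>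
   ('a, 'b::banach, 'c::banach) extrapolation \<Rightarrow> 'c set" where
  "ext_space P T E =
     range (\<lambda>x. base E *\<^sub>R emb P T E x - op_val (C0_generator (sg2 E)) (emb P T E x))"

text \<open>
  For \<open>z\<close> in the extrapolation space, the resolvent of the generator on \<open>'c\<close> at \<open>base\<close> applied to
  \<open>z\<close>, as an element of \<open>'a\<close>.
\<close>

definition ext_pull ::
  "('a::banach \<Rightarrow> real) set \<Rightarrow> (real \<Rightarrow> 'a \<Rightarrow> 'a) \<Rightarrow>
   ('a, 'b::banach, 'c::banach) extrapolation \<Rightarrow> 'c \<Rightarrow> 'a" where
  "ext_pull P T E z = inv (emb P T E) (resolvent (base E) (C0_generator (sg2 E)) z)"

definition ext_norm ::
  "('a::banach \<Rightarrow> real) set \<Rightarrow> (real \<Rightarrow> 'a \<Rightarrow> 'a) \<Rightarrow>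
   ('a, 'b::banach, 'c::banach) extrapolation \<Rightarrow> 'c \<Rightarrow> real" where
  "ext_norm P T E z = norm (ext_pull P T E z)"

definition ext_seminorms ::
  "('a::banach \<Rightarrow> real) set \<Rightarrow> (real \<Rightarrow> 'a \<Rightarrow> 'a) \<Rightarrow>
   ('a, 'b::banach, 'c::banach) extrapolation \<Rightarrow> ('c \<Rightarrow> real) set" where
  "ext_seminorms P T E = {\<lambda>z. p (ext_pull P T E z) | p. p \<in> P}"

definition ext_mixed_seminorms ::
  "('a::banach \<Rightarrow> real) set \<Rightarrow> (real \<Rightarrow> 'a \<Rightarrow> 'a) \<Rightarrow>
   ('a, 'b::banach, 'c::banach) extrapolation \<Rightarrow> ('c \<Rightarrow> real) set" where
  "ext_mixed_seminorms P T E = {\<lambda>z. p (ext_pull P T E z) | p. p \<in> mixed_seminorms P}"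

definition ext_gen ::
  "('a::banach \<Rightarrow> real) set \<Rightarrow> (real \<Rightarrow> 'a \<Rightarrow> 'a) \<Rightarrow>
   ('a, 'b::banach, 'c::banach) extrapolation \<Rightarrow> 'c operator" where
  "ext_gen P T E =
     bi_generator (ext_space P T E) (ext_norm P T E) (ext_seminorms P T E) (sgX E)"

definition is_extrapolation ::
  "('a::banach \<Rightarrow> real) set \<Rightarrow> (real \<Rightarrow> 'a \<Rightarrow> 'a) \<Rightarrow>
   ('a, 'b::banach, 'c::banach) extrapolation \<Rightarrow> bool" where
  "is_extrapolation P T E \<longleftrightarrow>
     complex_of_real (base E) \<in> resolvent_set (gen P T) \<and>
     is_completion (space0 P T) (\<lambda>x. norm (resolvent (base E) (gen0 P T) x)) (incl1 E) \<and>
     C0_semigroup (sg1 E) \<and>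
     (\<forall>t\<ge>0. \<forall>x\<in>space0 P T. sg1 E t (incl1 E x) = incl1 E (T t x)) \<and>
     is_completion UNIV (\<lambda>y. norm (resolvent (base E) (C0_generator (sg1 E)) y)) (incl2 E) \<and>
     C0_semigroup (sg2 E) \<and>
     (\<forall>t\<ge>0. \<forall>y. sg2 E t (incl2 E y) = incl2 E (sg1 E t y)) \<and>
     bi_continuous_semigroup (ext_space P T E) (ext_norm P T E) (ext_seminorms P T E) (sgX E) \<and>
     (\<forall>t\<ge>0. \<forall>x. sgX E t (emb P T E x) = emb P T E (T t x))"

definition ext_cone ::
  "('a::banach_lattice \<Rightarrow> real) set \<Rightarrow> (real \<Rightarrow> 'a \<Rightarrow> 'a) \<Rightarrow>
   ('a, 'b::banach, 'c::banach) extrapolation \<Rightarrow> 'c set" where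
  "ext_cone P T E =
     lc_topology (ext_space P T E) (ext_mixed_seminorms P T E) closure_of (emb P T E ` {0..})"

definition ext_bounded_linear ::
  "('a::banach \<Rightarrow> real) set \<Rightarrow> (real \<Rightarrow> 'a \<Rightarrow> 'a) \<Rightarrow>
   ('a, 'b::banach, 'c::banach) extrapolation \<Rightarrow> ('a \<Rightarrow> 'c) \<Rightarrow> bool" where
  "ext_bounded_linear P T E B \<longleftrightarrow>
     linear B \<and> range B \<subseteq> ext_space P T E \<and> (\<exists>C. \<forall>x. ext_norm P T E (B x) \<le> C * norm x)"

text \<open>
  The resolvent of the extrapolated generator takes values in the image of \<open>'a\<close> under \<open>emb P T E\<close>,
  so its composition with \<open>B\<close> is read as an operator on \<open>'a\<close>.
\<close>

definition resolvent_comp ::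
  "('a::banach \<Rightarrow> real) set \<Rightarrow> (real \<Rightarrow> 'a \<Rightarrow> 'a) \<Rightarrow>
   ('a, 'b::banach, 'c::banach) extrapolation \<Rightarrow> real \<Rightarrow> ('a \<Rightarrow> 'c) \<Rightarrow> 'a \<Rightarrow> 'a" where
  "resolvent_comp P T E lam B x = inv (emb P T E) (resolvent lam (ext_gen P T E) (B x))"

definition perturbed_part ::
  "('a::banach \<Rightarrow> real) set \<Rightarrow> (real \<Rightarrow> 'a \<Rightarrow> 'a) \<Rightarrow>
   ('a, 'b::banach, 'c::banach) extrapolation \<Rightarrow> ('a \<Rightarrow> 'c) \<Rightarrow> 'a operator" where
  "perturbed_part P T E B =
     {(x, y). \<exists>z. (emb P T E x, z) \<in> ext_gen P T E \<and> z + B x = emb P T E y}"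

end

theory Submission
  imports Defs
begin

text \<open>
  Write \<open>N\<close> for the composition of \<open>B\<close> with the resolvent of the extrapolated generator at \<open>lam\<close>, and
  \<open>U t = exp (- lam * t) T t\<close>, with generator \<open>A\<close>. Since \<open>B\<close> is minus the extrapolation of \<open>A\<close> applied
  to \<open>N\<close>, the perturbed operator minus \<open>lam\<close> is \<open>A (I - N)\<close>, an operator on \<open>'a\<close> alone
  (\<open>perturbed_part_iff\<close>). Positivity of \<open>B\<close> becomes \<open>U t (N x) \<le> N x\<close> for \<open>x \<ge> 0\<close>, because the difference
  is the integral of the extrapolated \<open>U s (B x)\<close> over \<open>[0, t]\<close> (\<open>excessive_small\<close>). As \<open>lam\<close> exceeds the
  spectral bound, the resolvent of the generator of \<open>T\<close> at \<open>lam\<close> is positive (\<open>resolvent_pos\<close>), and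
  this gives \<open>N x \<ge> 0\<close> as well (\<open>excessive_nonneg\<close>).

  The semigroup is built by freezing the argument of \<open>B\<close> during time steps of length \<open>h\<close>. One step is
  the positive operator \<open>F h x = U h x + (N x - U h (N x))\<close>. If the frozen arguments \<open>v\<close> satisfy
  \<open>\<bar>v\<bar> \<le> W\<close>, the contributions of \<open>B\<close> during \<open>k\<close> steps telescope to at most
  \<open>N W - U (k h) (N W) \<le> N W\<close>, a bound that is independent of \<open>k\<close> (\<open>discrete_volterra\<close>). Apply it with
  \<open>W\<close> the supremum of the absolute values along a discrete orbit, and let \<open>V\<close> be the same supremum for
  the unperturbed orbit: then \<open>W \<le> V + N W\<close>, hence \<open>W \<le> (I - N)\<^sup>-\<^sup>1 V\<close> as \<open>N\<close> is positive with
  norm less than one (\<open>scheme_dominates\<close>). Here the AM property is essential: the norm and the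
  seminorms of a finite supremum are the largest ones of its members. So the scheme is bounded
  independently of \<open>h\<close> (\<open>F_pow_bound\<close>). As \<open>N\<close> is local and \<open>(I - N)\<^sup>-\<^sup>1\<close> is a Neumann series,
  \<open>(I - N)\<^sup>-\<^sup>1\<close> preserves the norm bounded sequences that are null for \<open>P\<close>, so the scheme is also
  equicontinuous along these, again independently of \<open>h\<close> (\<open>F_equi\<close>).

  On the domain of \<open>A (I - N)\<close>, halving the step changes the result by \<open>O(h)\<close> (\<open>F_refine\<close>), so the scheme
  converges in norm along \<open>h = 2\<^sup>-\<^sup>n\<close>. Every vector is the limit of a norm bounded sequence from that
  domain (\<open>G_bidense\<close>), so by equicontinuity the scheme converges everywhere. Its limit \<open>S\<close> is a
  positive bi-continuous semigroup. A telescoping sum shows that the generator of \<open>S\<close> extends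
  \<open>A (I - N)\<close> (\<open>G_subset_gen_S\<close>). They are equal since \<open>A (I - N)\<close> is onto and the generator of \<open>S\<close> is
  injective: a vector in its kernel is fixed by \<open>S\<close>, and passing to the limit in the scheme shows that
  \<open>U t\<close> fixes \<open>x - N x\<close> (\<open>S_fixed\<close>).

  The extrapolation space itself is handled by isometries of the two completions onto the closure of
  the domain of the generator of \<open>T\<close>. They show that the extrapolation space is a copy of \<open>'a\<close>, and that
  its generator is a copy of the one of \<open>T\<close> (\<open>ext_space_iso\<close>, \<open>ext_gen_iff\<close>).
\<close>

section \<open>Order in Banach lattices\<close>

lemma norm_abs_banach_lattice [simp]: "norm \<bar>x::'a::banach_lattice\<bar> = norm x"
  by (intro antisym norm_le_of_abs_le) simp_all

lemma norm_mono_banach_lattice: "0 \<le> x \<Longrightarrow> x \<le> y \<Longrightarrow> norm x \<le> norm (y::'a::banach_lattice)"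
  by (rule norm_le_of_abs_le) simp

text \<open>
  This makes the positive cone closed for every topology whose seminorms respect the order: the
  negative part of a limit of positive vectors is dominated by the distance to them.
\<close>

lemma abs_nprt_le_abs_diff:
  fixes x y :: "'a::lattice_ab_group_add_abs"
  assumes "0 \<le> y"
  shows "\<bar>nprt x\<bar> \<le> \<bar>x - y\<bar>"
proof -
  have "- \<bar>x - y\<bar> \<le> x - y" by (metis abs_ge_minus_self minus_le_iff)
  also have "\<dots> \<le> x" using assms by simp
  finally have "- \<bar>x - y\<bar> \<le> nprt x" unfolding nprt_def by simp
  thus ?thesis by (simp add: abs_of_nonpos minus_le_iff)
qed

lemma nprt_eq_0_imp_nonneg: "nprt x = 0 \<Longrightarrow> 0 \<le> (x::'a::lattice_ab_group_add_abs)"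
  by (simp add: zero_le_iff_zero_nprt)

lemma nonneg_of_norm_approx:
  fixes x :: "'a::banach_lattice"
  assumes "\<And>e. 0 < e \<Longrightarrow> \<exists>y\<ge>0. norm (x - y) < e"
  shows "0 \<le> x"
proof -
  have "norm (nprt x) < e" if "0 < e" for e
    using assms[OF that] norm_le_of_abs_le[OF abs_nprt_le_abs_diff[of _ x]] by force
  hence "norm (nprt x) \<le> 0" by (meson less_irrefl not_le)
  thus ?thesis using nprt_eq_0_imp_nonneg by auto
qed

lemma abs_positive_linear_le:
  fixes L :: "'a::banach_lattice \<Rightarrow> 'a"
  assumes "linear L" "\<And>x. 0 \<le> x \<Longrightarrow> 0 \<le> L x" "\<bar>x\<bar> \<le> y"
  shows "\<bar>L x\<bar> \<le> L y"
proof (rule abs_leI)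
  have "x \<le> y" "- x \<le> y" using assms(3) by (auto simp: abs_le_iff)
  hence "0 \<le> L (y - x)" "0 \<le> L (y - (- x))" using assms(2) by (metis diff_ge_0_iff_ge)+
  hence "0 \<le> L y - L x" "0 \<le> L y - (- L x)"
    by (simp_all only: linear_diff[OF assms(1)] linear_neg[OF assms(1)])
  thus "L x \<le> L y" "- L x \<le> L y" by (simp_all only: diff_ge_0_iff_ge)
qed

section \<open>Topologies given by seminorms\<close>

lemma topspace_lc_topology [simp]: "topspace (lc_topology V Q) = V"
  unfolding lc_topology_def topology_generated_by_topspace by auto

lemma openin_lc_ball:
  "q \<in> Q \<Longrightarrow> x \<in> V \<Longrightarrow> 0 < e \<Longrightarrow> openin (lc_topology V Q) {y \<in> V. q (y - x) < e}"
  unfolding lc_topology_def by (rule topology_generated_by_Basis) blast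

text \<open>
  The seminorms on the extrapolation space are seminorms only on a subspace \<open>V\<close>, so the triangle
  inequality is assumed there, in the form in which balls use it.
\<close>

lemma limitin_lc_topology:
  assumes tri: "\<And>q a b c. q \<in> Q \<Longrightarrow> a \<in> V \<Longrightarrow> b \<in> V \<Longrightarrow> c \<in> V \<Longrightarrow> q (a - c) \<le> q (a - b) + q (b - c)"
    and nonneg: "\<And>q a b. q \<in> Q \<Longrightarrow> a \<in> V \<Longrightarrow> b \<in> V \<Longrightarrow> 0 \<le> q (a - b)"
    and zero: "\<And>q. q \<in> Q \<Longrightarrow> q 0 = 0"
  shows "limitin (lc_topology V Q) f l F \<longleftrightarrow>
    l \<in> V \<and> (\<forall>\<^sub>F z in F. f z \<in> V) \<and> (\<forall>q\<in>Q. ((\<lambda>z. q (f z - l)) \<longlongrightarrow> 0) F)"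
    (is "?A \<longleftrightarrow> ?B")
proof
  assume A: ?A
  hence l: "l \<in> V" by (simp add: limitin_def)
  have ev: "\<forall>\<^sub>F z in F. f z \<in> U" if "openin (lc_topology V Q) U" "l \<in> U" for U
    using A that unfolding limitin_def by blast
  have V: "\<forall>\<^sub>F z in F. f z \<in> V"
    using ev[of V] l by (metis openin_topspace topspace_lc_topology)
  moreover have "((\<lambda>z. q (f z - l)) \<longlongrightarrow> 0) F" if q: "q \<in> Q" for q
  proof (rule tendstoI)
    fix e :: real assume e: "0 < e"
    have "\<forall>\<^sub>F z in F. f z \<in> {y \<in> V. q (y - l) < e}"
      by (rule ev[OF openin_lc_ball[OF q l e]]) (use l zero[OF q] e in auto)
    thus "\<forall>\<^sub>F z in F. dist (q (f z - l)) 0 < e"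
      by eventually_elim (use nonneg[OF q _ l] in auto)
  qed
  ultimately show ?B using l by blast
next
  assume B: ?B
  have "openin (lc_topology V Q) U \<Longrightarrow> l \<in> U \<Longrightarrow> \<forall>\<^sub>F z in F. f z \<in> U" for U
    unfolding lc_topology_def openin_topology_generated_by_iff
  proof (induction rule: generate_topology_on.induct)
    case (Int a b)
    thus ?case by (auto intro: eventually_conj)
  next
    case (UN K)
    then obtain k where "k \<in> K" "l \<in> k" by auto
    thus ?case using UN.IH[of k] by (force elim: eventually_mono)
  next
    case (Basis s)
    show ?case
    proof (cases "s = V")
      case False
      then obtain q x e where s: "s = {y \<in> V. q (y - x) < e}" "q \<in> Q" "x \<in> V" "0 < e"
        using Basis by auto
      have "0 < e - q (l - x)" using Basis s by auto
      hence "\<forall>\<^sub>F z in F. dist (q (f z - l)) 0 < e - q (l - x)" using B s(2) by (blast dest: tendstoD)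
      moreover have "\<forall>\<^sub>F z in F. f z \<in> V" using B by blast
      ultimately show ?thesis
      proof eventually_elim
        case (elim z)
        have "q (f z - x) \<le> q (f z - l) + q (l - x)" using tri s elim B by blast
        thus ?case using elim s by auto
      qed
    qed (use B in blast)
  qed auto
  thus ?A using B by (simp add: limitin_def)
qed

lemma seminorm_0: "seminorm p \<Longrightarrow> p 0 = 0"
  unfolding seminorm_def by (metis abs_zero mult_zero_left scaleR_zero_left)

lemma seminorm_triangle: "seminorm p \<Longrightarrow> p (x + y) \<le> p x + p y"
  by (simp add: seminorm_def)

lemma seminorm_scaleR: "seminorm p \<Longrightarrow> p (c *\<^sub>R x) = \<bar>c\<bar> * p x"
  by (simp add: seminorm_def)

lemma seminorm_minus: "seminorm p \<Longrightarrow> p (- x) = p x"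
  using seminorm_scaleR[of p "-1" x] by simp

lemma seminorm_minus_commute: "seminorm p \<Longrightarrow> p (x - y) = p (y - x)"
  using seminorm_minus[of p "x - y"] by simp

lemma seminorm_nonneg: "seminorm p \<Longrightarrow> 0 \<le> p x"
  using seminorm_triangle[of p x "- x"] by (simp add: seminorm_0 seminorm_minus)

lemma seminorm_diff_triangle: "seminorm p \<Longrightarrow> p (x - z) \<le> p (x - y) + p (y - z)"
  using seminorm_triangle[of p "x - y" "y - z"] by simp

lemma seminorm_diff_le: "seminorm p \<Longrightarrow> p (x - y) \<le> p x + p y"
  using seminorm_triangle[of p x "- y"] by (simp add: seminorm_minus)

lemma seminorm_sum_le: "seminorm p \<Longrightarrow> p (\<Sum>i\<in>I. f i) \<le> (\<Sum>i\<in>I. p (f i))"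
proof (induction I rule: infinite_finite_induct)
  case (insert i I)
  thus ?case using seminorm_triangle[of p "f i" "\<Sum>i\<in>I. f i"] by simp
qed (simp_all add: seminorm_0)

lemma limitin_seminorms:
  assumes "\<And>p. p \<in> P \<Longrightarrow> seminorm p"
  shows "limitin (lc_topology UNIV P) f l F \<longleftrightarrow> (\<forall>p\<in>P. ((\<lambda>z. p (f z - l)) \<longlongrightarrow> 0) F)"
  by (subst limitin_lc_topology) (auto simp: assms seminorm_nonneg seminorm_0 seminorm_diff_triangle)

lemma continuous_map_seminorms:
  assumes "\<And>p. p \<in> P \<Longrightarrow> seminorm p"
  shows "continuous_map (top_of_set S) (lc_topology UNIV P) f \<longleftrightarrow>
    (\<forall>t\<in>S. \<forall>p\<in>P. ((\<lambda>s. p (f s - f t)) \<longlongrightarrow> 0) (at t within S))"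
proof -
  have "atin (top_of_set S) t = at t within S" if "t \<in> S" for t
    unfolding atin_subtopology_within[OF that] filter_eq_iff eventually_atin_within eventually_at_topological
    by (auto simp flip: open_openin)
  thus ?thesis by (simp add: continuous_map_atin limitin_seminorms[OF assms])
qed

section \<open>Bounded null sequences\<close>

text \<open>
  Only sequences are tested: the null sequences of the mixed topology are the norm bounded
  \<open>P\<close>-null sequences.
\<close>

definition bnull :: "('v::real_normed_vector \<Rightarrow> real) set \<Rightarrow> (nat \<Rightarrow> 'v) \<Rightarrow> bool" where
  "bnull P x \<longleftrightarrow> Bseq x \<and> (\<forall>p\<in>P. (\<lambda>n. p (x n)) \<longlonglongrightarrow> 0)"

text \<open>
  What sequences see of a norm and a coarser topology with norming dual: the latter makes the norm
  lower semicontinuous.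
\<close>

locale bi_seq =
  fixes P :: "('a::banach \<Rightarrow> real) set"
  assumes sn: "p \<in> P \<Longrightarrow> seminorm p"
    and sep: "(\<And>p. p \<in> P \<Longrightarrow> p x = 0) \<Longrightarrow> x = 0"
    and seminorm_le_norm: "p \<in> P \<Longrightarrow> \<exists>c>0. \<forall>x. p x \<le> c * norm x"
    and Cauchy_conv: "Bseq u \<Longrightarrow> lc_Cauchy_seq P u \<Longrightarrow> \<exists>l. bnull P (\<lambda>n. u n - l)"
    and norm_lsc: "(\<And>p. p \<in> P \<Longrightarrow> (\<lambda>n. p (u n - l)) \<longlonglongrightarrow> 0) \<Longrightarrow> (\<And>n. norm (u n) \<le> C) \<Longrightarrow> norm l \<le> C"

lemma bi_space_imp_bi_seq:
  assumes "bi_space P"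
  shows "bi_seq P"
proof
  show sn: "seminorm p" if "p \<in> P" for p using assms that unfolding bi_space_def by blast
  show "x = 0" if "\<And>p. p \<in> P \<Longrightarrow> p x = 0" for x
  proof -
    have "(\<lambda>n::nat. p (0 - l)) \<longlonglongrightarrow> 0" if "p \<in> P" "l \<in> {0, x}" for p l
      using that \<open>\<And>p. p \<in> P \<Longrightarrow> p x = 0\<close>[OF that(1)] seminorm_0[OF sn[OF that(1)]]
      by (auto simp: seminorm_minus[OF sn[OF that(1)]])
    hence lim: "limitin (lc_topology UNIV P) (\<lambda>n. 0) x sequentially" "limitin (lc_topology UNIV P) (\<lambda>n. 0) 0 sequentially"
      using limitin_seminorms[of P "\<lambda>n. 0", OF sn] by blast+
    have "Hausdorff_space (lc_topology UNIV P)" using assms unfolding bi_space_def by blast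
    with limitin_Hausdorff_unique[OF lim] show ?thesis by simp
  qed
  show "\<exists>c>0. \<forall>x. p x \<le> c * norm x" if p: "p \<in> P" for p
  proof -
    have "openin (lc_topology UNIV P) {y \<in> UNIV. p (y - 0) < 1}"
      by (rule openin_lc_ball) (use p in auto)
    hence "open {y. p y < 1}" using assms unfolding bi_space_def by auto
    moreover have "0 \<in> {y. p y < 1}" using seminorm_0[OF sn[OF p]] by simp
    ultimately obtain d where d: "0 < d" "\<And>y. norm y < d \<Longrightarrow> p y < 1"
      by (force simp: open_dist dist_norm)
    have "p x \<le> 2 / d * norm x" for x
    proof (cases "x = 0")
      case False
      have "norm ((d / (2 * norm x)) *\<^sub>R x) < d" using False d by simp
      hence "p ((d / (2 * norm x)) *\<^sub>R x) < 1" by (rule d)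
      thus ?thesis using False d(1) by (simp add: seminorm_scaleR[OF sn[OF p]] field_simps)
    qed (simp add: seminorm_0[OF sn[OF p]])
    thus ?thesis using d(1) by (intro exI[of _ "2/d"]) auto
  qed
  show "\<exists>l. bnull P (\<lambda>n. u n - l)" if u: "Bseq u" "lc_Cauchy_seq P u" for u
  proof -
    obtain l where "limitin (lc_topology UNIV P) u l sequentially"
      using assms u unfolding bi_space_def Bseq_eq_bounded by blast
    moreover have "Bseq (\<lambda>n. u n - l)"
      using u(1) Bseq_add[of u "- l"] by simp
    ultimately show ?thesis by (auto simp: bnull_def limitin_seminorms sn)
  qed
  show "norm l \<le> C" if lim: "\<And>p. p \<in> P \<Longrightarrow> (\<lambda>n. p (u n - l)) \<longlonglongrightarrow> 0" and C: "\<And>n. norm (u n) \<le> C" for u l C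
  proof -
    have "limitin (lc_topology UNIV P) u l sequentially" using lim by (simp add: limitin_seminorms sn)
    hence *: "\<bar>\<phi> l\<bar> \<le> C" if "\<phi> \<in> dual_unit_ball P" for \<phi>
    proof -
      have \<phi>: "bounded_linear \<phi>" "continuous_map (lc_topology UNIV P) euclideanreal \<phi>" "onorm \<phi> \<le> 1"
        using that by (auto simp: dual_unit_ball_def)
      have "limitin euclideanreal (\<phi> \<circ> u) (\<phi> l) sequentially"
        by (rule continuous_map_limit[OF \<phi>(2)]) fact
      hence "(\<lambda>n. \<bar>\<phi> (u n)\<bar>) \<longlonglongrightarrow> \<bar>\<phi> l\<bar>" by (simp add: o_def tendsto_rabs)
      moreover have "\<bar>\<phi> (u n)\<bar> \<le> C" for n
      proof -
        have "\<bar>\<phi> (u n)\<bar> \<le> onorm \<phi> * norm (u n)" using onorm[OF \<phi>(1)] by (metis real_norm_def)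
        also have "\<dots> \<le> 1 * norm (u n)" by (rule mult_right_mono) (use \<phi> in auto)
        finally show ?thesis using C[of n] by simp
      qed
      ultimately show ?thesis by (intro LIMSEQ_le_const2) auto
    qed
    \<comment> \<open>The supremum over the dual ball needs a nonempty index set.\<close>
    have "(\<lambda>x. 0) \<in> dual_unit_ball P" by (auto simp: dual_unit_ball_def onorm_zero)
    moreover have "norm l = (SUP \<phi>\<in>dual_unit_ball P. \<bar>\<phi> l\<bar>)" using assms unfolding bi_space_def by blast
    ultimately show ?thesis using * by (auto intro!: cSUP_least)
  qed
qed

context bi_seq
begin

lemma p0 [simp]: "p \<in> P \<Longrightarrow> p 0 = 0" by (simp add: sn seminorm_0)
lemma p_nonneg: "p \<in> P \<Longrightarrow> 0 \<le> p x" by (simp add: sn seminorm_nonneg)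
lemma p_tri: "p \<in> P \<Longrightarrow> p (x + y) \<le> p x + p y" by (simp add: sn seminorm_triangle)
lemma p_diff: "p \<in> P \<Longrightarrow> p (x - z) \<le> p (x - y) + p (y - z)" by (simp add: sn seminorm_diff_triangle)
lemma p_scale: "p \<in> P \<Longrightarrow> p (c *\<^sub>R x) = \<bar>c\<bar> * p x" by (simp add: sn seminorm_scaleR)
lemma p_commute: "p \<in> P \<Longrightarrow> p (x - y) = p (y - x)" by (simp add: sn seminorm_minus_commute)

lemma p_tendsto_0I:
  assumes "p \<in> P" "\<And>z. p (f z) \<le> g z" "(g \<longlongrightarrow> 0) F"
  shows "((\<lambda>z. p (f z)) \<longlongrightarrow> 0) F"
  by (rule tendsto_sandwich[OF _ _ tendsto_const assms(3)]) (use assms p_nonneg in auto)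

lemma p_tendsto_0_eps:
  assumes "p \<in> P"
  shows "((\<lambda>z. p (f z)) \<longlongrightarrow> 0) F \<longleftrightarrow> (\<forall>e>0. \<forall>\<^sub>F z in F. p (f z) < e)"
  by (simp add: tendsto_iff abs_of_nonneg[OF p_nonneg[OF assms]])

lemma tends_norm:
  assumes "p \<in> P" "((\<lambda>z. norm (f z)) \<longlongrightarrow> 0) F"
  shows "((\<lambda>z. p (f z)) \<longlongrightarrow> 0) F"
proof -
  obtain c where c: "\<forall>x. p x \<le> c * norm x" using seminorm_le_norm[OF assms(1)] by blast
  show ?thesis
    by (rule p_tendsto_0I[OF assms(1) _ tendsto_mult_right_zero[OF assms(2), of c]]) (use c in blast)
qed

lemma tends_unique:
  assumes "\<And>p. p \<in> P \<Longrightarrow> ((\<lambda>z. p (f z - l)) \<longlongrightarrow> 0) F" "\<And>p. p \<in> P \<Longrightarrow> ((\<lambda>z. p (f z - l')) \<longlongrightarrow> 0) F" "F \<noteq> bot"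
  shows "l = l'"
proof -
  have "p (l - l') = 0" if p: "p \<in> P" for p
  proof -
    have "((\<lambda>z. p (f z - l) + p (f z - l')) \<longlongrightarrow> 0 + 0) F" by (intro tendsto_add assms p)
    hence "p (l - l') \<le> 0"
      using p_diff[OF p, of l l'] by (intro tendsto_lowerbound[OF _ _ assms(3)]) (auto simp: p_commute[OF p, of l])
    thus ?thesis using p_nonneg[OF p, of "l - l'"] by simp
  qed
  thus ?thesis using sep[of "l - l'"] by auto
qed

lemma tends_add:
  assumes "p \<in> P" "((\<lambda>z. p (f z - a)) \<longlongrightarrow> 0) F" "((\<lambda>z. p (g z - b)) \<longlongrightarrow> 0) F"
  shows "((\<lambda>z. p (f z + g z - (a + b))) \<longlongrightarrow> 0) F"
  using p_tri[OF assms(1), of "f _ - a" "g _ - b"] tendsto_add[OF assms(2,3)]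
  by (intro p_tendsto_0I[OF assms(1), where g="\<lambda>z. p (f z - a) + p (g z - b)"]) (auto simp: algebra_simps)

lemma tends_scale:
  assumes "p \<in> P" "((\<lambda>z. p (f z - a)) \<longlongrightarrow> 0) F"
  shows "((\<lambda>z. p (c *\<^sub>R f z - c *\<^sub>R a)) \<longlongrightarrow> 0) F"
  using tendsto_mult_right_zero[OF assms(2)] by (simp add: p_scale[OF assms(1)] flip: scaleR_diff_right)

lemma tends_diff:
  assumes "p \<in> P" "((\<lambda>z. p (f z - a)) \<longlongrightarrow> 0) F" "((\<lambda>z. p (g z - b)) \<longlongrightarrow> 0) F"
  shows "((\<lambda>z. p (f z - g z - (a - b))) \<longlongrightarrow> 0) F"
proof (rule p_tendsto_0I[OF assms(1), where g="\<lambda>z. p (f z - a) + p (g z - b)"])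
  fix z
  have "f z - g z - (a - b) = (f z - a) - (g z - b)" by simp
  thus "p (f z - g z - (a - b)) \<le> p (f z - a) + p (g z - b)"
    by (metis seminorm_diff_le sn assms(1))
qed (use tendsto_add[OF assms(2,3)] in simp)

lemma p_lim_le:
  assumes "p \<in> P" "(\<lambda>n. p (u n - l)) \<longlonglongrightarrow> 0" "\<exists>N. \<forall>n\<ge>N. p (u n) \<le> c n" "c \<longlonglongrightarrow> C"
  shows "p l \<le> C"
proof -
  have "(\<lambda>n. p (u n - l) + c n) \<longlonglongrightarrow> 0 + C" by (intro tendsto_add assms)
  moreover have "p l \<le> p (u n - l) + p (u n)" for n
    using p_tri[OF assms(1), of "l - u n" "u n"] by (simp add: p_commute[OF assms(1), of l])
  hence "\<exists>N. \<forall>n\<ge>N. p l \<le> p (u n - l) + c n" using assms(3) by (meson add_left_mono order_trans)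
  ultimately show ?thesis by (intro LIMSEQ_le_const) auto
qed

lemma bnullD: "bnull P x \<Longrightarrow> p \<in> P \<Longrightarrow> (\<lambda>n. p (x n)) \<longlonglongrightarrow> 0" by (simp add: bnull_def)

lemma bnull_bounded:
  assumes "bnull P x"
  obtains a where "\<And>n. norm (x n) \<le> a"
  using assms unfolding bnull_def Bseq_def by blast

lemma bnullI:
  assumes "\<And>n. norm (x n) \<le> a"
    and "\<And>p e. p \<in> P \<Longrightarrow> 0 < e \<Longrightarrow> \<forall>\<^sub>F n in sequentially. p (x n) < e"
  shows "bnull P x"
  unfolding bnull_def using assms by (auto intro: BseqI' simp: p_tendsto_0_eps)

lemma bnull_add: "bnull P x \<Longrightarrow> bnull P y \<Longrightarrow> bnull P (\<lambda>n. x n + y n)"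
  unfolding bnull_def
proof safe
  fix p assume p: "p \<in> P" and "\<forall>p\<in>P. (\<lambda>n. p (x n)) \<longlonglongrightarrow> 0" "\<forall>p\<in>P. (\<lambda>n. p (y n)) \<longlonglongrightarrow> 0"
  thus "(\<lambda>n. p (x n + y n)) \<longlonglongrightarrow> 0" using tends_add[OF p, of x 0 _ y 0] by simp
next
  assume "Bseq x" "Bseq y"
  then obtain a b where "\<And>n. norm (x n) \<le> a" "\<And>n. norm (y n) \<le> b" unfolding Bseq_def by blast
  hence "norm (x n + y n) \<le> a + b" for n by (rule norm_triangle_mono)
  thus "Bseq (\<lambda>n. x n + y n)" by (rule BseqI')
qed

lemma bnull_scaleR: "bnull P x \<Longrightarrow> bnull P (\<lambda>n. c *\<^sub>R x n)"
proof -
  assume x: "bnull P x"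
  then obtain a where a: "\<And>n. norm (x n) \<le> a" unfolding bnull_def Bseq_def by blast
  have "Bseq (\<lambda>n. c *\<^sub>R x n)" by (rule BseqI'[of _ "\<bar>c\<bar> * a"]) (simp add: a mult_left_mono)
  thus ?thesis using x tendsto_mult_right_zero by (auto simp: bnull_def p_scale)
qed

lemma bnull_minus: "bnull P x \<Longrightarrow> bnull P (\<lambda>n. - x n)"
  using bnull_scaleR[of x "-1"] by simp

lemma bnull_diff: "bnull P x \<Longrightarrow> bnull P y \<Longrightarrow> bnull P (\<lambda>n. x n - y n)"
  using bnull_add[of x "\<lambda>n. - y n"] bnull_minus by simp

lemma bnull_norm: "x \<longlonglongrightarrow> 0 \<Longrightarrow> bnull P x"
  unfolding bnull_def using convergentI convergent_imp_Bseq tends_norm[OF _ tendsto_norm_zero] by blast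

lemma Bseq_minus_const: "Bseq u \<Longrightarrow> Bseq (\<lambda>n. u n - (l::'a))"
  using Bseq_add[of u "- l"] by simp

end

section \<open>Dyadic grids\<close>

definition grid :: "nat \<Rightarrow> real \<Rightarrow> nat" where
  "grid n t = nat \<lfloor>t * 2 ^ n\<rfloor>"

lemma grid_le: "0 \<le> t \<Longrightarrow> real (grid n t) * (1/2) ^ n \<le> t"
proof -
  assume "0 \<le> t"
  hence "real (grid n t) \<le> t * 2 ^ n" unfolding grid_def by simp
  thus ?thesis by (simp add: field_simps)
qed

lemma less_grid: "0 \<le> t \<Longrightarrow> t < (real (grid n t) + 1) * (1/2) ^ n"
proof -
  assume "0 \<le> t"
  have "t * 2 ^ n < real (grid n t) + 1" unfolding grid_def by linarith
  thus ?thesis by (simp add: field_simps)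
qed

lemma grid_gap: "0 \<le> t \<Longrightarrow> \<bar>real (grid n t) * (1/2) ^ n - t\<bar> \<le> (1/2) ^ n"
  using grid_le[of t n] less_grid[of t n] by (simp add: algebra_simps)

lemma less_of_le_half: "0 < e \<Longrightarrow> a \<le> e / 2 \<Longrightarrow> a < (e::real)"
  by simp

lemma half_power_tendsto: "(\<lambda>n. (1/2::real) ^ n) \<longlonglongrightarrow> 0"
  by (rule LIMSEQ_realpow_zero) auto

lemma grid_tendsto: "0 \<le> t \<Longrightarrow> (\<lambda>n. real (grid n t) * (1/2) ^ n) \<longlonglongrightarrow> t"
  by (rule LIM_zero_cancel, rule Lim_null_comparison[OF _ half_power_tendsto]) (simp add: grid_gap)

lemma grid_zero [simp]: "grid n 0 = 0" by (simp add: grid_def)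

section \<open>Bi-continuous semigroups\<close>

context bi_seq
begin

lemma limitin_P: "limitin (lc_topology UNIV P) f l F \<longleftrightarrow> (\<forall>p\<in>P. ((\<lambda>z. p (f z - l)) \<longlongrightarrow> 0) F)"
  by (rule limitin_seminorms) (rule sn)

lemma continuous_map_P:
  "continuous_map (top_of_set S) (lc_topology UNIV P) f \<longleftrightarrow>
    (\<forall>t\<in>S. \<forall>p\<in>P. ((\<lambda>s. p (f s - f t)) \<longlongrightarrow> 0) (at t within S))"
  by (rule continuous_map_seminorms) (rule sn)

lemma bnull_cong: "(\<And>n. x n = y n) \<Longrightarrow> bnull P x \<Longrightarrow> bnull P y"
  by (simp add: ext[of x y])

lemma norm_lim_le:
  assumes "\<And>p. p \<in> P \<Longrightarrow> (\<lambda>n. p (u n - l)) \<longlonglongrightarrow> 0" "\<And>n. norm (u n) \<le> c n" "c \<longlonglongrightarrow> C"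
  shows "norm l \<le> C"
proof (rule field_le_epsilon)
  fix e :: real assume "0 < e"
  then obtain N where N: "\<And>n. n \<ge> N \<Longrightarrow> \<bar>c n - C\<bar> < e"
    using assms(3) unfolding LIMSEQ_def dist_real_def by blast
  show "norm l \<le> C + e"
  proof (rule norm_lsc)
    show "(\<lambda>n. p (u (n + N) - l)) \<longlonglongrightarrow> 0" if "p \<in> P" for p
      using LIMSEQ_ignore_initial_segment[OF assms(1)[OF that], of N] .
    show "norm (u (n + N)) \<le> C + e" for n using N[of "n + N"] assms(2)[of "n + N"] by linarith
  qed
qed

lemma bnull_lim_unique: "bnull P (\<lambda>n. u n - l) \<Longrightarrow> bnull P (\<lambda>n. u n - l') \<Longrightarrow> l = l'"
  by (rule tends_unique[of u l sequentially l']) (auto simp: bnull_def)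

lemma bnull_add_add:
  "bnull P (\<lambda>n. u n - a) \<Longrightarrow> bnull P (\<lambda>n. v n - b) \<Longrightarrow> bnull P (\<lambda>n. u n + v n - (a + b))"
  by (rule bnull_cong[OF _ bnull_add[of "\<lambda>n. u n - a" "\<lambda>n. v n - b"]]) simp_all

lemma bnull_trans:
  "bnull P (\<lambda>n. u n - v n) \<Longrightarrow> bnull P (\<lambda>n. v n - b) \<Longrightarrow> bnull P (\<lambda>n. u n - b)"
  by (rule bnull_cong[OF _ bnull_add[of "\<lambda>n. u n - v n" "\<lambda>n. v n - b"]]) simp_all

end

text \<open>
  Continuity at \<open>0\<close> and equicontinuity along bounded null sequences give back continuity at all times.
  A nonnegative growth rate \<open>w\<close> makes \<open>M * exp (w * t0)\<close> a bound on all of \<open>[0, t0]\<close>.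
\<close>

locale bi_semigroup = bi_seq P for P :: "('a::banach \<Rightarrow> real) set" +
  fixes T :: "real \<Rightarrow> 'a \<Rightarrow> 'a" and M w :: real
  assumes T_lin: "0 \<le> t \<Longrightarrow> linear (T t)"
    and T_add: "0 \<le> t \<Longrightarrow> 0 \<le> s \<Longrightarrow> T (t + s) x = T t (T s x)"
    and T_0 [simp]: "T 0 x = x"
    and M_pos: "0 < M" and w_nonneg: "0 \<le> w"
    and T_bound: "0 \<le> t \<Longrightarrow> norm (T t x) \<le> M * exp (w * t) * norm x"
    and T_cont0: "p \<in> P \<Longrightarrow> ((\<lambda>t. p (T t x - x)) \<longlongrightarrow> 0) (at_right 0)"
    and T_equi: "bnull P u \<Longrightarrow> p \<in> P \<Longrightarrow> 0 < e \<Longrightarrow> \<exists>n0. \<forall>n\<ge>n0. \<forall>s\<in>{0..t0}. p (T s (u n)) < e"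
begin

lemma T_bound_le: "0 \<le> t \<Longrightarrow> t \<le> t0 \<Longrightarrow> norm (T t x) \<le> M * exp (w * t0) * norm x"
proof -
  assume "0 \<le> t" "t \<le> t0"
  hence "M * exp (w * t) \<le> M * exp (w * t0)" using M_pos w_nonneg by (simp add: mult_left_mono)
  thus ?thesis using T_bound[OF \<open>0 \<le> t\<close>, of x] mult_right_mono[of _ _ "norm x"] by (meson norm_ge_zero order_trans)
qed

lemma T_blin: "0 \<le> t \<Longrightarrow> bounded_linear (T t)"
  using T_bound[of t] T_lin[of t]
  by (intro bounded_linear.intro) (auto simp: bounded_linear_axioms_def mult.commute[of "norm _"])

lemma T_simps:
  assumes "0 \<le> t"
  shows T_plus: "T t (x + y) = T t x + T t y" and T_minus: "T t (x - y) = T t x - T t y"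
    and T_scaleR: "T t (c *\<^sub>R x) = c *\<^sub>R T t x" and T_zero: "T t 0 = 0" and T_neg: "T t (- x) = - T t x"
  using T_lin[OF assms] by (auto simp: linear_add linear_diff linear_scale linear_0 linear_neg)

lemma T_bnull:
  assumes "bnull P u" "\<And>n. s n \<in> {0..t0}"
  shows "bnull P (\<lambda>n. T (s n) (u n))"
proof -
  obtain a where a: "\<And>n. norm (u n) \<le> a" using bnull_bounded[OF assms(1)] by blast
  have "norm (T (s n) (u n)) \<le> M * exp (w * t0) * a" for n
    using T_bound_le[of "s n" t0 "u n"] assms(2)[of n] a[of n] M_pos
    by (smt (verit) atLeastAtMost_iff mult_left_mono exp_gt_zero mult_pos_pos)
  moreover have "(\<lambda>n. p (T (s n) (u n))) \<longlonglongrightarrow> 0" if p: "p \<in> P" for p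
    unfolding p_tendsto_0_eps[OF p] eventually_sequentially
    using T_equi[OF assms(1) p] assms(2) by meson
  ultimately show ?thesis unfolding bnull_def by (auto intro: BseqI')
qed

lemma T_bnull1: "bnull P u \<Longrightarrow> 0 \<le> t \<Longrightarrow> bnull P (\<lambda>n. T t (u n))"
  using T_bnull[of u "\<lambda>_. t" t] by simp

lemma T_cont0_seq:
  assumes "\<And>n. 0 \<le> h n" "h \<longlonglongrightarrow> 0"
  shows "bnull P (\<lambda>n. T (h n) x - x)"
proof -
  obtain H where H: "\<And>n. norm (h n) \<le> H" using convergent_imp_Bseq[OF convergentI[OF assms(2)]] unfolding Bseq_def by blast
  hence H: "h n \<le> H" for n using assms(1)[of n] by (metis abs_of_nonneg real_norm_def)
  have "norm (T (h n) x - x) \<le> M * exp (w * H) * norm x + norm x" for n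
    using T_bound_le[OF assms(1) H, of n x] norm_triangle_ineq4[of "T (h n) x" x] by linarith
  moreover have "\<forall>\<^sub>F n in sequentially. p (T (h n) x - x) < e" if p: "p \<in> P" and e: "0 < e" for p and e :: real
  proof -
    have "\<forall>\<^sub>F t in at_right 0. p (T t x - x) < e"
      using e T_cont0[OF p, of x, unfolded p_tendsto_0_eps[OF p]] by blast
    then obtain b where b: "0 < b" "\<And>t. 0 < t \<Longrightarrow> t < b \<Longrightarrow> p (T t x - x) < e"
      unfolding eventually_at_right_field by auto
    have "\<forall>\<^sub>F n in sequentially. h n < b" using order_tendstoD(2)[OF assms(2) b(1)] .
    thus "\<forall>\<^sub>F n in sequentially. p (T (h n) x - x) < e"
    proof eventually_elim
      case (elim n)
      show ?case using b(2)[of "h n"] elim assms(1)[of n] p e by (cases "h n = 0") auto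
    qed
  qed
  ultimately show ?thesis by (rule bnullI)
qed

text \<open>
  A failure at times \<open>r\<close> and increments \<open>h\<close> tending to \<open>0\<close> would contradict equicontinuity along the
  bounded null sequence \<open>T h x - x\<close>.
\<close>

lemma T_small:
  assumes p: "p \<in> P" and "0 < e"
  shows "\<exists>d>0. \<forall>r\<in>{0..t0}. \<forall>h\<in>{0..d}. p (T r (T h x - x)) < e"
proof (rule ccontr)
  assume *: "\<not> ?thesis"
  have "\<exists>r h. r \<in> {0..t0} \<and> h \<in> {0..1 / Suc n} \<and> \<not> p (T r (T h x - x)) < e" for n :: nat
  proof -
    have "\<not> (\<forall>r\<in>{0..t0}. \<forall>h\<in>{0..1 / Suc n}. p (T r (T h x - x)) < e)"
      using * by (metis of_nat_0_less_iff zero_less_Suc zero_less_divide_1_iff)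
    thus ?thesis by blast
  qed
  then obtain r h where rh: "\<And>n. r n \<in> {0..t0}" "\<And>n. h n \<in> {0..1 / Suc n}" "\<And>n. \<not> p (T (r n) (T (h n) x - x)) < e"
    by metis
  have "h \<longlonglongrightarrow> 0"
    by (rule tendsto_sandwich[OF _ _ tendsto_const LIMSEQ_inverse_real_of_nat])
       (use rh(2) in \<open>auto simp: inverse_eq_divide\<close>)
  hence "bnull P (\<lambda>n. T (h n) x - x)" using rh(2) by (intro T_cont0_seq) auto
  from T_equi[OF this p \<open>0 < e\<close>, of t0] rh show False by blast
qed

lemma T_unif_cont:
  assumes p: "p \<in> P" and "0 < e"
  shows "\<exists>d>0. \<forall>s\<in>{0..t0}. \<forall>t\<in>{0..t0}. \<bar>s - t\<bar> \<le> d \<longrightarrow> p (T s x - T t x) < e"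
proof -
  obtain d where d: "0 < d" "\<And>r h. r \<in> {0..t0} \<Longrightarrow> h \<in> {0..d} \<Longrightarrow> p (T r (T h x - x)) < e"
    using T_small[OF assms, of t0 x] by meson
  have *: "p (T s x - T t x) < e" if "0 \<le> t" "t \<le> s" "s \<le> t0" "s - t \<le> d" for s t
  proof -
    have "T s x - T t x = T t (T (s - t) x - x)"
      using that T_add[of t "s - t" x] by (simp add: T_minus)
    thus ?thesis using d(2)[of t "s - t"] that by simp
  qed
  show ?thesis
  proof (intro exI[of _ d] conjI ballI impI d(1))
    fix s t assume "s \<in> {0..t0}" "t \<in> {0..t0}" "\<bar>s - t\<bar> \<le> d"
    thus "p (T s x - T t x) < e"
      using *[of t s] *[of s t] p_commute[OF p, of "T s x" "T t x"] by (cases "t \<le> s") auto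
  qed
qed

lemma T_tendsto_seq:
  assumes "\<And>n. 0 \<le> s n" "s \<longlonglongrightarrow> t" "0 \<le> t"
  shows "bnull P (\<lambda>n. T (s n) x - T t x)"
proof -
  obtain H where H: "\<And>n. norm (s n) \<le> H" using convergent_imp_Bseq[OF convergentI[OF assms(2)]] unfolding Bseq_def by blast
  hence H: "s n \<le> max H t" for n using assms(1)[of n] by (metis abs_of_nonneg real_norm_def max.coboundedI1)
  have "norm (T (s n) x - T t x) \<le> M * exp (w * max H t) * norm x + M * exp (w * max H t) * norm x" for n
    using T_bound_le[OF assms(1) H, of n x] T_bound_le[OF assms(3), of "max H t" x]
      norm_triangle_ineq4[of "T (s n) x" "T t x"] by linarith
  moreover have "\<forall>\<^sub>F n in sequentially. p (T (s n) x - T t x) < e" if p: "p \<in> P" and e: "0 < e" for p and e :: real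
  proof -
    obtain d where d: "0 < d" "\<And>s'. s' \<in> {0..max H t} \<Longrightarrow> \<bar>s' - t\<bar> \<le> d \<Longrightarrow> p (T s' x - T t x) < e"
      using T_unif_cont[OF p e, of "max H t" x] assms(3) by auto
    have "\<forall>\<^sub>F n in sequentially. dist (s n) t < d" using assms(2) d(1) by (rule tendstoD)
    thus "\<forall>\<^sub>F n in sequentially. p (T (s n) x - T t x) < e"
    proof eventually_elim
      case (elim n)
      show ?case using d(2)[of "s n"] H[of n] assms(1)[of n] elim by (auto simp: dist_real_def)
    qed
  qed
  ultimately show ?thesis by (rule bnullI)
qed

lemma bi_continuous: "bi_continuous_semigroup UNIV norm P T"
  unfolding bi_continuous_semigroup_def
proof (intro conjI allI impI ballI)
  fix t :: real assume t: "0 \<le> t"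
  show "linear_on_subspace UNIV (T t)" using t by (auto simp: linear_on_subspace_def T_plus T_scaleR)
  show "\<exists>C. \<forall>x\<in>UNIV. norm (T t x) \<le> C * norm x" using T_bound[OF t] by blast
  show "T (t + s) x = T t (T s x)" if "0 \<le> s" for s x using t that by (rule T_add)
next
  fix x :: 'a
  show "continuous_map (top_of_set {0..}) (lc_topology UNIV P) (\<lambda>t. T t x)"
    unfolding continuous_map_P
  proof (intro ballI)
    fix t :: real and p assume t: "t \<in> {0..}" and p: "p \<in> P"
    show "((\<lambda>s. p (T s x - T t x)) \<longlongrightarrow> 0) (at t within {0..})"
      unfolding tendsto_at_iff_sequentially
    proof (intro allI impI)
      fix X :: "nat \<Rightarrow> real" assume "\<forall>i. X i \<in> {0..} - {t}" "X \<longlonglongrightarrow> t"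
      hence "bnull P (\<lambda>n. T (X n) x - T t x)" using t by (intro T_tendsto_seq) auto
      thus "((\<lambda>s. p (T s x - T t x)) \<circ> X) \<longlonglongrightarrow> 0" using p by (auto simp: bnull_def o_def)
    qed
  qed
next
  show "\<exists>M\<ge>1. \<exists>\<omega>. \<forall>t\<ge>0. \<forall>x\<in>UNIV. norm (T t x) \<le> M * exp (\<omega> * t) * norm x"
  proof (rule exI[of _ "max M 1"], rule conjI[OF _ exI[of _ w]], simp, intro allI impI ballI)
    fix t :: real and x :: 'a assume "0 \<le> t"
    have "M * exp (w * t) * norm x \<le> max M 1 * exp (w * t) * norm x"
      by (intro mult_right_mono) auto
    thus "norm (T t x) \<le> max M 1 * exp (w * t) * norm x" using T_bound[OF \<open>0 \<le> t\<close>, of x] by linarith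
  qed
next
  fix x :: "nat \<Rightarrow> 'a" and t0 q
  assume *: "range x \<subseteq> UNIV \<and> (\<exists>C. \<forall>n. norm (x n) \<le> C) \<and> limitin (lc_topology UNIV P) x 0 sequentially"
    and q: "q \<in> P"
  have "\<forall>p\<in>P. (\<lambda>n. p (x n - 0)) \<longlonglongrightarrow> 0" using * limitin_P by blast
  hence "bnull P x" using * unfolding bnull_def by (auto intro: BseqI')
  from T_equi[OF this q, of _ t0]
  show "uniform_limit {0..t0} (\<lambda>n s. q (T s (x n))) (\<lambda>s. 0) sequentially"
    unfolding uniform_limit_iff eventually_sequentially by (simp add: abs_of_nonneg[OF p_nonneg[OF q]])
qed auto

end

lemma (in bi_seq) bi_semigroupI:
  assumes "bi_continuous_semigroup UNIV norm P T"
  shows "\<exists>M w. bi_semigroup P T M w"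
proof -
  have *: "\<forall>t\<ge>0. linear_on_subspace UNIV (T t)" "\<forall>t\<ge>0. \<forall>s\<ge>0. \<forall>x. T (t + s) x = T t (T s x)" "\<forall>x. T 0 x = x"
     "\<And>x. continuous_map (top_of_set {0..}) (lc_topology UNIV P) (\<lambda>t. T t x)"
     "\<exists>M\<ge>1. \<exists>\<omega>. \<forall>t\<ge>0. \<forall>x. norm (T t x) \<le> M * exp (\<omega> * t) * norm x"
     "\<And>x. (\<exists>C. \<forall>n. norm (x n) \<le> C) \<and> limitin (lc_topology UNIV P) x 0 sequentially \<Longrightarrow>
        (\<forall>t0\<ge>0. \<forall>q\<in>P. uniform_limit {0..t0} (\<lambda>n s. q (T s (x n))) (\<lambda>s. 0) sequentially)"
    using assms unfolding bi_continuous_semigroup_def by auto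
  obtain M \<omega> where M: "1 \<le> M" "\<And>t x. 0 \<le> t \<Longrightarrow> norm (T t x) \<le> M * exp (\<omega> * t) * norm x" using *(5) by blast
  have "bi_semigroup P T M (max \<omega> 0)"
  proof (rule bi_semigroup.intro[OF bi_seq_axioms bi_semigroup_axioms.intro])
    show "linear (T t)" if "0 \<le> t" for t
      using *(1) that by (auto simp: linear_on_subspace_def intro!: linearI)
    show "norm (T t x) \<le> M * exp (max \<omega> 0 * t) * norm x" if "0 \<le> t" for t x
    proof -
      have "M * exp (\<omega> * t) * norm x \<le> M * exp (max \<omega> 0 * t) * norm x"
        using that M by (intro mult_right_mono mult_left_mono) (auto intro!: mult_right_mono)
      thus ?thesis using M(2)[OF that, of x] by linarith
    qed
    show "((\<lambda>t. p (T t x - x)) \<longlongrightarrow> 0) (at_right 0)" if p: "p \<in> P" for p x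
    proof -
      have "((\<lambda>s. p (T s x - T 0 x)) \<longlongrightarrow> 0) (at 0 within {0..})"
        using *(4)[of x] p unfolding continuous_map_P by simp
      thus ?thesis using *(3) by (auto elim: tendsto_within_subset)
    qed
    show "\<exists>n0. \<forall>n\<ge>n0. \<forall>s\<in>{0..t0}. p (T s (u n)) < e" if u: "bnull P u" and p: "p \<in> P" and e: "0 < e" for u p e t0
    proof -
      have "limitin (lc_topology UNIV P) u 0 sequentially"
        using u by (simp add: bnull_def limitin_P)
      moreover have "\<exists>C. \<forall>n. norm (u n) \<le> C" using u unfolding bnull_def Bseq_def by blast
      ultimately have "uniform_limit {0..max t0 0} (\<lambda>n s. p (T s (u n))) (\<lambda>s. 0) sequentially"
        using *(6)[of u] p by simp
      hence "\<forall>\<^sub>F n in sequentially. \<forall>s\<in>{0..max t0 0}. dist (p (T s (u n))) 0 < e"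
        using e unfolding uniform_limit_iff by blast
      then obtain N where N: "\<And>n s. n \<ge> N \<Longrightarrow> s \<in> {0..max t0 0} \<Longrightarrow> dist (p (T s (u n))) 0 < e"
        unfolding eventually_sequentially by blast
      have "p (T s (u n)) < e" if "n \<ge> N" "s \<in> {0..t0}" for n s using N[OF that(1), of s] that(2) by auto
      thus ?thesis by blast
    qed
  qed (use * M in auto)
  thus ?thesis by blast
qed

section \<open>The generator\<close>

lemma (in bi_seq) gen_iff:
  "(x, y) \<in> gen P T \<longleftrightarrow> (\<exists>C. \<forall>t\<in>{0<..1}. norm (T t x - x) \<le> C * t) \<and>
     (\<forall>p\<in>P. ((\<lambda>t. p ((T t x - x) /\<^sub>R t - y)) \<longlongrightarrow> 0) (at_right 0))"
proof -
  have "(\<exists>C. \<forall>t\<in>{0<..1}. norm (T t x - x) / t \<le> C) \<longleftrightarrow> (\<exists>C. \<forall>t\<in>{0<..1}. norm (T t x - x) \<le> C * t)"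
    by (intro ex_cong1 ball_cong) (auto simp: divide_simps)
  thus ?thesis
    unfolding bi_generator_def by (simp add: limitin_P conj_commute)
qed

context bi_semigroup
begin

lemma gen_unique: "(x, y) \<in> gen P T \<Longrightarrow> (x, y') \<in> gen P T \<Longrightarrow> y = y'"
  by (rule tends_unique[of "\<lambda>t. (T t x - x) /\<^sub>R t" y "at_right 0" y']) (auto simp: gen_iff)

lemma gen_comb:
  assumes "(x, y) \<in> gen P T" "(x', y') \<in> gen P T"
  shows "(x + c *\<^sub>R x', y + c *\<^sub>R y') \<in> gen P T"
proof -
  obtain C C' where C: "\<And>t. t \<in> {0<..1} \<Longrightarrow> norm (T t x - x) \<le> C * t" "\<And>t. t \<in> {0<..1} \<Longrightarrow> norm (T t x' - x') \<le> C' * t"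
    using assms unfolding gen_iff by blast
  have eq: "T t (x + c *\<^sub>R x') - (x + c *\<^sub>R x') = (T t x - x) + c *\<^sub>R (T t x' - x')" if "0 < t" for t
    using that by (simp add: T_plus T_scaleR scaleR_diff_right)
  have "norm (T t (x + c *\<^sub>R x') - (x + c *\<^sub>R x')) \<le> (C + \<bar>c\<bar> * C') * t" if t: "t \<in> {0<..1}" for t
  proof -
    have "norm (T t (x + c *\<^sub>R x') - (x + c *\<^sub>R x')) \<le> norm (T t x - x) + \<bar>c\<bar> * norm (T t x' - x')"
      using norm_triangle_ineq[of "T t x - x" "c *\<^sub>R (T t x' - x')"] t
      by (simp only: eq greaterThanAtMost_iff norm_scaleR)
    also have "\<dots> \<le> C * t + \<bar>c\<bar> * (C' * t)" using C t by (intro add_mono mult_left_mono) auto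
    finally show ?thesis by (simp add: algebra_simps)
  qed
  moreover have "((\<lambda>t. p ((T t (x + c *\<^sub>R x') - (x + c *\<^sub>R x')) /\<^sub>R t - (y + c *\<^sub>R y'))) \<longlongrightarrow> 0) (at_right 0)" if p: "p \<in> P" for p
  proof -
    have "((\<lambda>t. p ((T t x - x) /\<^sub>R t + c *\<^sub>R ((T t x' - x') /\<^sub>R t) - (y + c *\<^sub>R y'))) \<longlongrightarrow> 0) (at_right 0)"
      using assms p unfolding gen_iff by (intro tends_add tends_scale) auto
    thus ?thesis
      by (rule Lim_transform_eventually) (auto simp: eventually_at_right_field eq scaleR_add_right mult.commute intro!: exI[of _ 1])
  qed
  ultimately show ?thesis unfolding gen_iff by blast
qed

lemma gen_zero: "(0, 0) \<in> gen P T"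
  unfolding gen_iff
proof safe
  show "\<exists>C. \<forall>t\<in>{0<..1}. norm (T t 0 - 0) \<le> C * t" by (auto simp: T_zero intro!: exI[of _ 0])
  fix p assume "p \<in> P"
  show "((\<lambda>t. p ((T t 0 - 0) /\<^sub>R t - 0)) \<longlongrightarrow> 0) (at_right 0)"
    by (rule Lim_transform_eventually[OF tendsto_const])
      (auto simp: eventually_at_right_field T_zero \<open>p \<in> P\<close> intro!: exI[of _ 1])
qed

lemma gen_scale: "(x, y) \<in> gen P T \<Longrightarrow> (c *\<^sub>R x, c *\<^sub>R y) \<in> gen P T"
  using gen_comb[OF gen_zero, of x y c] by simp

lemma gen_diff: "(x, y) \<in> gen P T \<Longrightarrow> (x', y') \<in> gen P T \<Longrightarrow> (x - x', y - y') \<in> gen P T"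
  using gen_comb[of x y x' y' "-1"] by simp

lemma gen_quotient_seq:
  assumes "(x, y) \<in> gen P T" "\<And>n. 0 < h n" "\<And>n. h n \<le> 1" "h \<longlonglongrightarrow> 0"
  shows "bnull P (\<lambda>n. (T (h n) x - x) /\<^sub>R h n - y)"
proof -
  obtain C where C: "\<And>t. t \<in> {0<..1} \<Longrightarrow> norm (T t x - x) \<le> C * t"
    using assms unfolding gen_iff by blast
  have "norm ((T (h n) x - x) /\<^sub>R h n) \<le> C" for n
    using C[of "h n"] assms(2,3)[of n] by (auto simp: divide_simps mult.commute)
  hence "Bseq (\<lambda>n. (T (h n) x - x) /\<^sub>R h n)" by (rule BseqI')
  moreover have "(\<lambda>n. p ((T (h n) x - x) /\<^sub>R h n - y)) \<longlonglongrightarrow> 0" if p: "p \<in> P" for p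
  proof (rule filterlim_compose[of "\<lambda>t. p ((T t x - x) /\<^sub>R t - y)" _ "at_right 0" h])
    show "((\<lambda>t. p ((T t x - x) /\<^sub>R t - y)) \<longlongrightarrow> 0) (at_right 0)" using assms p unfolding gen_iff by blast
    show "filterlim h (at_right 0) sequentially"
      unfolding filterlim_at using assms(2,4) by (auto intro: always_eventually simp: less_imp_neq[symmetric])
  qed
  ultimately show ?thesis using Bseq_minus_const[of _ y] unfolding bnull_def by blast
qed

lemma genI_seq:
  assumes "\<And>t. t \<in> {0<..1} \<Longrightarrow> norm (T t x - x) \<le> C * t"
    and "\<And>h p. (\<And>n. 0 < h n) \<Longrightarrow> (\<And>n. h n \<le> 1) \<Longrightarrow> h \<longlonglongrightarrow> 0 \<Longrightarrow> p \<in> P \<Longrightarrow> (\<lambda>n. p ((T (h n) x - x) /\<^sub>R h n - y)) \<longlonglongrightarrow> 0"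
  shows "(x, y) \<in> gen P T"
  unfolding gen_iff
proof (intro conjI ballI)
  fix p assume p: "p \<in> P"
  show "((\<lambda>t. p ((T t x - x) /\<^sub>R t - y)) \<longlongrightarrow> 0) (at_right 0)"
    unfolding tendsto_at_iff_sequentially
  proof (intro allI impI)
    fix X :: "nat \<Rightarrow> real" assume X: "\<forall>i. X i \<in> {0<..} - {0}" "X \<longlonglongrightarrow> 0"
    obtain N where N: "\<And>n. n \<ge> N \<Longrightarrow> X n < 1" using order_tendstoD(2)[OF X(2), of 1] unfolding eventually_sequentially by auto
    have "(\<lambda>n. p ((T (X (n + N)) x - x) /\<^sub>R X (n + N) - y)) \<longlonglongrightarrow> 0"
      by (rule assms(2)) (use X N LIMSEQ_ignore_initial_segment[OF X(2), of N] p in \<open>auto intro: less_imp_le\<close>)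
    hence "(\<lambda>n. p ((T (X n) x - x) /\<^sub>R X n - y)) \<longlonglongrightarrow> 0" by (rule LIMSEQ_offset)
    thus "((\<lambda>t. p ((T t x - x) /\<^sub>R t - y)) \<circ> X) \<longlonglongrightarrow> 0" by (simp add: o_def)
  qed
qed (use assms in blast)

lemma gen_T:
  assumes "(x, y) \<in> gen P T" "0 \<le> s"
  shows "(T s x, T s y) \<in> gen P T"
proof -
  obtain C where C: "\<And>t. t \<in> {0<..1} \<Longrightarrow> norm (T t x - x) \<le> C * t"
    using assms unfolding gen_iff by blast
  have eq: "T t (T s x) - T s x = T s (T t x - x)" if "0 < t" for t
    using that assms(2) T_add[of s t x] T_add[of t s x] by (simp add: T_minus add.commute)
  have "norm (T t (T s x) - T s x) \<le> (M * exp (w * s) * C) * t" if t: "t \<in> {0<..1}" for t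
  proof -
    have "norm (T s (T t x - x)) \<le> M * exp (w * s) * norm (T t x - x)" using assms(2) by (rule T_bound)
    also have "\<dots> \<le> M * exp (w * s) * (C * t)" using C[OF t] M_pos by (intro mult_left_mono) auto
    finally show ?thesis using eq t by (simp add: mult.assoc)
  qed
  moreover have "(\<lambda>n. p ((T (h n) (T s x) - T s x) /\<^sub>R h n - T s y)) \<longlonglongrightarrow> 0"
    if h: "\<And>n. 0 < h n" "\<And>n. h n \<le> 1" "h \<longlonglongrightarrow> 0" and p: "p \<in> P" for h p
  proof -
    have "bnull P (\<lambda>n. T s ((T (h n) x - x) /\<^sub>R h n - y))"
      by (rule T_bnull1[OF gen_quotient_seq[OF assms(1) h] assms(2)])
    thus ?thesis using h assms(2) p by (simp add: eq T_minus T_scaleR bnull_def)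
  qed
  ultimately show ?thesis by (rule genI_seq)
qed

end

section \<open>Resolvents at real points\<close>

text \<open>
  One equivalence says both that \<open>R\<close> maps into the domain of \<open>A\<close> and that it inverts \<open>lam - A\<close> from
  both sides.
\<close>

definition is_resolvent :: "real \<Rightarrow> ('v::real_normed_vector \<times> 'v) set \<Rightarrow> ('v \<Rightarrow> 'v) \<Rightarrow> bool" where
  "is_resolvent lam A R \<longleftrightarrow> bounded_linear R \<and> (\<forall>x y. (x, y) \<in> A \<longleftrightarrow> x = R (lam *\<^sub>R x - y))"

lemma is_resolvent_lin: "is_resolvent lam A R \<Longrightarrow> linear R"
  by (simp add: is_resolvent_def bounded_linear.linear)

lemma resolvent_eq: "is_resolvent lam A R \<Longrightarrow> resolvent lam A = R"
  unfolding is_resolvent_def resolvent_def by auto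

lemma is_resolvent_graph: "is_resolvent lam A R \<Longrightarrow> (R x, lam *\<^sub>R R x - x) \<in> A"
  unfolding is_resolvent_def by simp

lemma is_resolvent_range: "is_resolvent lam A R \<Longrightarrow> Domain A = range R"
proof (intro equalityI subsetI)
  fix x assume R: "is_resolvent lam A R"
  show "x \<in> range R" if "x \<in> Domain A" using that R unfolding is_resolvent_def by blast
  show "x \<in> Domain A" if "x \<in> range R" using that is_resolvent_graph[OF R] by blast
qed

lemma resolvent_identity:
  assumes "is_resolvent a A R" "is_resolvent b A Q"
  shows "R x = Q x + (b - a) *\<^sub>R Q (R x)"
proof -
  have lin: "linear Q" by (rule is_resolvent_lin[OF assms(2)])
  have "R x = Q (b *\<^sub>R R x - (a *\<^sub>R R x - x))"
    using is_resolvent_graph[OF assms(1)] assms(2) unfolding is_resolvent_def by blast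
  also have "b *\<^sub>R R x - (a *\<^sub>R R x - x) = x + (b - a) *\<^sub>R R x" by (simp add: algebra_simps)
  finally show ?thesis by (simp add: linear_add[OF lin] linear_scale[OF lin])
qed

text \<open>
  At a real point the complexified operator acts on both components separately, so the first component
  of the complex resolvent, restricted to pairs \<open>(x, 0)\<close>, is the real resolvent.
\<close>

lemma real_resolvent_exists:
  fixes A :: "('v::real_normed_vector \<times> 'v) set"
  assumes "complex_of_real lam \<in> resolvent_set A" and zero: "(0, 0) \<in> A"
  shows "\<exists>R. is_resolvent lam A R"
proof -
  let ?Z = "cplx_scale (complex_of_real lam)"
  obtain Rc where Rc: "bounded_linear Rc"
      "{(?Z x - y, x) | x y. (x, y) \<in> op_complexification A} = {(w, Rc w) | w. True}"
    using assms(1) unfolding resolvent_set_def by blast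
  define R where "R x = fst (Rc (x, 0))" for x
  have Z: "?Z (x, y) = (lam *\<^sub>R x, lam *\<^sub>R y)" for x y by (simp add: cplx_scale_def)
  have 1: "R (lam *\<^sub>R x - y) = x" if "(x, y) \<in> A" for x y
  proof -
    have "((x, 0), (y, 0)) \<in> op_complexification A" using that zero by (auto simp: op_complexification_def)
    hence "(?Z (x, 0) - (y, 0), (x, 0)) \<in> {(w, Rc w) | w. True}" unfolding Rc(2)[symmetric] by blast
    thus ?thesis unfolding R_def by (auto simp: Z dest: arg_cong[where f=fst])
  qed
  have 2: "(x, y) \<in> A" if "x = R (lam *\<^sub>R x - y)" for x y
  proof -
    let ?w = "(lam *\<^sub>R x - y, 0::'v)"
    have "(?w, Rc ?w) \<in> {(w, Rc w) | w. True}" by blast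
    then obtain a b where ab: "?w = ?Z a - b" "Rc ?w = a" "(a, b) \<in> op_complexification A"
      unfolding Rc(2)[symmetric] by blast
    have "(fst a, fst b) \<in> A" using ab(3) by (auto simp: op_complexification_def)
    moreover have "fst a = x" using that ab(2) unfolding R_def by simp
    moreover have "lam *\<^sub>R x - y = lam *\<^sub>R fst a - fst b"
      using ab(1) by (cases a) (auto simp: Z prod_eq_iff)
    ultimately show ?thesis by simp
  qed
  have "bounded_linear R"
    unfolding R_def[abs_def]
    by (rule bounded_linear_fst_comp[OF bounded_linear_compose[OF Rc(1)]])
       (intro bounded_linear_Pair bounded_linear_ident bounded_linear_zero)
  thus ?thesis using 1 2 unfolding is_resolvent_def by metis
qed

section \<open>Increments of orbits\<close>

context bi_semigroup
begin

definition riemann_sum :: "nat \<Rightarrow> real \<Rightarrow> 'a \<Rightarrow> 'a" where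
  "riemann_sum n t y = (1/2) ^ n *\<^sub>R (\<Sum>j<grid n t. T (real j * (1/2) ^ n) y)"

lemma node_in: "0 \<le> t \<Longrightarrow> j \<le> grid n t \<Longrightarrow> real j * (1/2) ^ n \<in> {0..t}"
proof -
  assume "0 \<le> t" "j \<le> grid n t"
  hence "real j * (1/2) ^ n \<le> real (grid n t) * (1/2) ^ n" by (intro mult_right_mono) auto
  from order_trans[OF this grid_le[OF \<open>0 \<le> t\<close>]] show ?thesis by simp
qed

lemma seminorm_grid_sum_le:
  assumes q: "seminorm q" and t: "0 \<le> t" and c: "\<And>j. j < grid n t \<Longrightarrow> q (f j) \<le> c"  "0 \<le> c"
  shows "q ((1/2) ^ n *\<^sub>R (\<Sum>j<grid n t. f j)) \<le> t * c"
proof -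
  have "q (\<Sum>j<grid n t. f j) \<le> (\<Sum>j<grid n t. q (f j))" by (rule seminorm_sum_le[OF q])
  also have "\<dots> \<le> (\<Sum>j<grid n t. c)" by (rule sum_mono) (use c in auto)
  finally have "(1/2) ^ n * q (\<Sum>j<grid n t. f j) \<le> (1/2) ^ n * (real (grid n t) * c)"
    by (intro mult_left_mono) auto
  also have "\<dots> = (real (grid n t) * (1/2) ^ n) * c" by simp
  also have "\<dots> \<le> t * c" using grid_le[OF t] c by (intro mult_right_mono) auto
  finally show ?thesis by (simp add: seminorm_scaleR[OF q])
qed

lemma seminorm_norm: "seminorm (norm :: 'a \<Rightarrow> real)"
  unfolding seminorm_def by (simp add: norm_triangle_ineq)

lemma riemann_sum_minus: "riemann_sum n t y - (real (grid n t) * (1/2) ^ n) *\<^sub>R z =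
    (1/2) ^ n *\<^sub>R (\<Sum>j<grid n t. T (real j * (1/2) ^ n) y - z)"
  unfolding riemann_sum_def by (simp add: sum_subtractf scaleR_diff_right sum_constant_scaleR mult.commute)

text \<open>
  The sum has \<open>grid n t\<close> terms, which cover \<open>[0, t]\<close> up to a piece shorter than \<open>(1/2) ^ n\<close>; that piece
  accounts for the last term.
\<close>

lemma riemann_sum_approx:
  assumes q: "seminorm q" and t: "0 \<le> t" and c: "\<And>s. s \<in> {0..t} \<Longrightarrow> q (T s y - z) \<le> c"
  shows "q (riemann_sum n t y - t *\<^sub>R z) \<le> t * c + (1/2) ^ n * q z"
proof -
  have "0 \<le> c" using c[of 0] seminorm_nonneg[OF q, of "T 0 y - z"] t by simp
  have "q (riemann_sum n t y - (real (grid n t) * (1/2) ^ n) *\<^sub>R z) \<le> t * c"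
    unfolding riemann_sum_minus
    by (rule seminorm_grid_sum_le[OF q t c \<open>0 \<le> c\<close>]) (use node_in t in \<open>simp add: less_imp_le\<close>)
  moreover have "q ((real (grid n t) * (1/2) ^ n) *\<^sub>R z - t *\<^sub>R z) \<le> (1/2) ^ n * q z"
    using grid_gap[OF t, of n] seminorm_nonneg[OF q, of z]
    by (simp add: seminorm_scaleR[OF q] mult_right_mono flip: scaleR_diff_left)
  ultimately show ?thesis
    using seminorm_diff_triangle[OF q, of "riemann_sum n t y" "t *\<^sub>R z" "(real (grid n t) * (1/2) ^ n) *\<^sub>R z"] by linarith
qed

lemma remainder_tendsto: "(\<lambda>n. t * c + (1/2) ^ n * b) \<longlonglongrightarrow> t * (c::real)"
  using tendsto_add[OF tendsto_const tendsto_mult[OF half_power_tendsto tendsto_const]] by fastforce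

text \<open>
  In place of an integral of the orbit of \<open>v\<close>: the increment \<open>T t z - z\<close> is the sum of the vectors
  \<open>T (j h) (T h z - z)\<close>, and \<open>T h z - z = h (v + r)\<close> with a null sequence \<open>r\<close> along \<open>h = (1/2) ^ n\<close>.
\<close>

lemma increment_lim:
  assumes "(z, v) \<in> gen P T" "0 \<le> t"
  shows "bnull P (\<lambda>n. riemann_sum n t v - (T t z - z))"
proof -
  define h where "h n = (1/2::real) ^ n" for n
  have h: "\<And>n. 0 < h n" "\<And>n. h n \<le> 1" "h \<longlonglongrightarrow> 0"
    using half_power_tendsto unfolding h_def by (auto intro: power_le_one)
  define r where "r n = (T (h n) z - z) /\<^sub>R h n - v" for n
  have r: "bnull P r" unfolding r_def by (rule gen_quotient_seq[OF assms(1) h])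
  define e where "e n = h n *\<^sub>R (\<Sum>j<grid n t. T (real j * h n) (r n))" for n
  have tele: "T (real k * h n) z - z = h n *\<^sub>R (\<Sum>j<k. T (real j * h n) (v + r n))" for k n
  proof (induction k)
    case (Suc k)
    have "T (real (Suc k) * h n) z = T (real k * h n) (T (h n) z)"
      using h(1)[of n] T_add[of "real k * h n" "h n" z] by (simp add: algebra_simps)
    moreover have "T (h n) z = z + h n *\<^sub>R (v + r n)" using h(1)[of n] unfolding r_def by simp
    ultimately show ?case using Suc h(1)[of n] by (simp add: T_plus T_scaleR algebra_simps)
  qed simp
  have eq: "T (real (grid n t) * h n) z - z = riemann_sum n t v + e n" for n
    unfolding tele riemann_sum_def e_def h_def[symmetric] using h(1)
    by (simp add: T_plus less_imp_le sum.distrib scaleR_add_right)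
  have e: "bnull P e"
  proof -
    obtain a where a: "\<And>n. norm (r n) \<le> a" using bnull_bounded[OF r] by blast
    have "norm (e n) \<le> t * (M * exp (w * t) * a)" for n
    proof -
      have "norm (e n) \<le> t * (M * exp (w * t) * norm (r n))"
        unfolding e_def h_def using assms(2) node_in[OF assms(2), of _ n] M_pos
        by (intro seminorm_grid_sum_le[OF seminorm_norm] T_bound_le) (auto simp: less_imp_le)
      also have "\<dots> \<le> t * (M * exp (w * t) * a)" using a M_pos assms(2) by (intro mult_left_mono) auto
      finally show ?thesis .
    qed
    moreover have "\<forall>\<^sub>F n in sequentially. p (e n) < \<epsilon>" if p: "p \<in> P" and \<epsilon>: "0 < \<epsilon>" for p and \<epsilon> :: real
    proof -
      define \<eta> where "\<eta> = \<epsilon> / (2 * (t + 1))"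
      have \<eta>: "0 < \<eta>" "t * \<eta> < \<epsilon>" using \<epsilon> assms(2) unfolding \<eta>_def by (auto simp: field_simps intro!: add_nonneg_pos)
      obtain N where N: "\<And>n s. n \<ge> N \<Longrightarrow> s \<in> {0..t} \<Longrightarrow> p (T s (r n)) < \<eta>" using T_equi[OF r p \<eta>(1), of t] by blast
      have "p (e n) \<le> t * \<eta>" if "n \<ge> N" for n
        unfolding e_def h_def using N[OF that] node_in[OF assms(2), of _ n] \<eta>
        by (intro seminorm_grid_sum_le[OF sn[OF p]] assms(2)) (auto simp: less_imp_le)
      thus "\<forall>\<^sub>F n in sequentially. p (e n) < \<epsilon>"
        unfolding eventually_sequentially using \<eta> by (meson order.strict_trans1)
    qed
    ultimately show ?thesis by (rule bnullI)
  qed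
  have "bnull P (\<lambda>n. T (real (grid n t) * h n) z - z - (T t z - z))"
    using T_tendsto_seq[OF _ grid_tendsto[OF assms(2)] assms(2), of z] unfolding h_def by simp
  hence "bnull P (\<lambda>n. riemann_sum n t v + e n - (T t z - z))" unfolding eq .
  from bnull_diff[OF this e] show ?thesis by simp
qed

lemma increment_approx:
  assumes "(z, v) \<in> gen P T" "0 \<le> t" "p \<in> P" "\<And>s. s \<in> {0..t} \<Longrightarrow> p (T s v) \<le> c"
  shows "p (T t z - z) \<le> t * c"
proof (rule p_lim_le[OF assms(3) bnullD[OF increment_lim[OF assms(1,2)] assms(3)] _ tendsto_const])
  have "p (riemann_sum n t v) \<le> t * c" for n
    using riemann_sum_approx[OF sn[OF assms(3)] assms(2), of v 0 c n] assms(3,4) by simp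
  thus "\<exists>N. \<forall>n\<ge>N. p (riemann_sum n t v) \<le> t * c" by blast
qed

lemma increment_approx_norm:
  assumes "(z, v) \<in> gen P T" "0 \<le> t" "\<And>s. s \<in> {0..t} \<Longrightarrow> norm (T s v - v) \<le> c"
  shows "norm (T t z - z - t *\<^sub>R v) \<le> t * c"
  by (rule norm_lim_le[OF _ riemann_sum_approx[OF seminorm_norm assms(2,3)] remainder_tendsto])
     (use bnullD[OF increment_lim[OF assms(1,2)]] in simp)

lemma gen_zero_fixed: "(z, 0) \<in> gen P T \<Longrightarrow> 0 \<le> t \<Longrightarrow> T t z = z"
  using increment_approx_norm[of z 0 t 0] by (simp add: T_zero)

lemma T_fixed_gen: "(\<And>t. 0 \<le> t \<Longrightarrow> T t z = z) \<Longrightarrow> (z, 0) \<in> gen P T"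
  by (rule genI_seq[of z 0]) (auto simp: less_imp_le)

lemma is_resolvent_T:
  assumes R: "is_resolvent lam (gen P T) R" and t: "0 \<le> t"
  shows "R (T t x) = T t (R x)"
proof -
  have "(T t (R x), T t (lam *\<^sub>R R x - x)) \<in> gen P T" by (rule gen_T[OF is_resolvent_graph[OF R] t])
  thus ?thesis using R t unfolding is_resolvent_def by (simp add: T_minus T_scaleR)
qed

text \<open>
  The difference quotients of the orbit of \<open>R x\<close> lie in the domain and converge to \<open>lam R x - x\<close>.
\<close>

lemma gen_bidense:
  assumes R: "is_resolvent lam (gen P T) R"
  shows "\<exists>u. (\<forall>n. u n \<in> Domain (gen P T)) \<and> bnull P (\<lambda>n. u n - x)"
proof (intro exI conjI allI)
  let ?h = "\<lambda>n. inverse (real (Suc n))"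
  let ?u = "\<lambda>n. lam *\<^sub>R R x - (T (?h n) (R x) - R x) /\<^sub>R ?h n"
  have g: "(R x, lam *\<^sub>R R x - x) \<in> gen P T" by (rule is_resolvent_graph[OF R])
  show "?u n \<in> Domain (gen P T)" for n
    by (rule DomainI[OF gen_diff[OF gen_scale[OF g] gen_scale[OF gen_diff[OF gen_T[OF g] g]]]]) simp
  have "bnull P (\<lambda>n. (T (?h n) (R x) - R x) /\<^sub>R ?h n - (lam *\<^sub>R R x - x))"
    by (rule gen_quotient_seq[OF g _ _ LIMSEQ_inverse_real_of_nat]) (auto simp: inverse_le_1_iff)
  from bnull_minus[OF this] show "bnull P (\<lambda>n. ?u n - x)" by (simp add: algebra_simps)
qed

end

section \<open>Finite suprema\<close>

fun msup :: "(nat \<Rightarrow> 'a::banach_lattice) \<Rightarrow> nat \<Rightarrow> 'a" where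
  "msup f 0 = \<bar>f 0\<bar>"
| "msup f (Suc k) = sup (msup f k) \<bar>f (Suc k)\<bar>"

lemma msup_nonneg [simp]: "0 \<le> msup f k"
  by (induction k) (auto intro: le_supI1)

lemma msup_ge: "j \<le> k \<Longrightarrow> \<bar>f j\<bar> \<le> msup f k"
  by (induction k) (auto simp: le_Suc_eq intro: le_supI1)

lemma msup_le: "(\<And>j. j \<le> k \<Longrightarrow> \<bar>f j\<bar> \<le> b) \<Longrightarrow> msup f k \<le> b"
  by (induction k) auto

text \<open>
  The AM property, in a form that covers the norm and the seminorms at once.
\<close>

lemma msup_M_le:
  assumes "\<And>x y. 0 \<le> x \<Longrightarrow> 0 \<le> y \<Longrightarrow> q (sup x y) = max (q x) (q y)" "\<And>x. q \<bar>x\<bar> = q x"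
    and "\<And>j. j \<le> k \<Longrightarrow> q (f j) \<le> (c::real)"
  shows "q (msup f k) \<le> c"
  using assms(3) by (induction k) (auto simp: assms(1,2))

section \<open>Positive perturbations given by their composition with the resolvent\<close>

locale positive_bi_semigroup = bi_semigroup P U M w
  for P :: "('a::banach_lattice \<Rightarrow> real) set" and U :: "real \<Rightarrow> 'a \<Rightarrow> 'a" and M w :: real +
  assumes solid: "p \<in> P \<Longrightarrow> \<bar>x\<bar> \<le> \<bar>y\<bar> \<Longrightarrow> p x \<le> p y"
    and U_pos: "0 \<le> t \<Longrightarrow> 0 \<le> x \<Longrightarrow> 0 \<le> U t x"
begin

lemma nonneg_of_p_approx:
  assumes "\<And>p e. p \<in> P \<Longrightarrow> 0 < e \<Longrightarrow> \<exists>y\<ge>0. p (y - x) < e"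
  shows "0 \<le> x"
proof (rule nprt_eq_0_imp_nonneg, rule sep)
  fix p assume p: "p \<in> P"
  have "p (nprt x) \<le> 0 + e" if e: "0 < e" for e
  proof -
    obtain y where y: "0 \<le> y" "p (y - x) < e" using assms[OF p e] by blast
    have "p (nprt x) \<le> p (y - x)"
      by (rule solid[OF p]) (use abs_nprt_le_abs_diff[OF y(1), of x] in \<open>simp add: abs_minus_commute\<close>)
    thus ?thesis using y(2) by simp
  qed
  hence "p (nprt x) \<le> 0" by (rule field_le_epsilon)
  thus "p (nprt x) = 0" using p_nonneg[OF p] by (intro antisym)
qed

lemma nonneg_lim:
  assumes "bnull P (\<lambda>n. u n - x)" "\<And>n. 0 \<le> u n"
  shows "0 \<le> x"
proof (rule nonneg_of_p_approx)
  fix p and e :: real assume p: "p \<in> P" and "0 < e"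
  hence "\<forall>\<^sub>F n in sequentially. p (u n - x) < e" using bnullD[OF assms(1) p] p_tendsto_0_eps[OF p, of "\<lambda>n. u n - x"] by blast
  then obtain n where "p (u n - x) < e" unfolding eventually_sequentially by blast
  thus "\<exists>y\<ge>0. p (y - x) < e" using assms(2) by blast
qed

end

text \<open>
  \<open>N\<close> stands for the perturbation composed with the resolvent at \<open>0\<close>. For \<open>x \<ge> 0\<close> the vector
  \<open>N x - U t (N x)\<close> is the integral of the perturbation applied to \<open>x\<close>, transported by \<open>U\<close>, over
  \<open>[0, t]\<close>; assumption \<open>N_excess\<close> is therefore the positivity of the perturbation. \<open>N_bnull\<close> is what
  remains of locality for sequences.
\<close>

locale positive_perturbation = positive_bi_semigroup P U M w
  for P :: "('a::banach_lattice \<Rightarrow> real) set" and U :: "real \<Rightarrow> 'a \<Rightarrow> 'a" and M w :: real +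
  fixes N R :: "'a \<Rightarrow> 'a" and K :: real
  assumes p_sup: "p \<in> P \<Longrightarrow> 0 \<le> x \<Longrightarrow> 0 \<le> y \<Longrightarrow> p (sup x y) = max (p x) (p y)"
    and norm_max: "0 \<le> x \<Longrightarrow> 0 \<le> y \<Longrightarrow> norm (sup x y) = max (norm x) (norm y)"
    and R: "is_resolvent 0 (gen P U) R"
    and N_lin: "linear N"
    and N_bnull: "bnull P u \<Longrightarrow> bnull P (\<lambda>n. N (u n))"
    and N_pos: "0 \<le> x \<Longrightarrow> 0 \<le> N x"
    and N_excess: "0 \<le> t \<Longrightarrow> 0 \<le> x \<Longrightarrow> U t (N x) \<le> N x"
    and K_nonneg: "0 \<le> K" and K_less: "K < 1"
    and N_norm: "norm (N x) \<le> K * norm x"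
begin

lemma p_abs [simp]: "p \<in> P \<Longrightarrow> p \<bar>x\<bar> = p x"
  by (intro antisym solid) auto

lemma N_simps: "N (x + y) = N x + N y" "N (x - y) = N x - N y" "N (c *\<^sub>R x) = c *\<^sub>R N x" "N (- x) = - N x" "N 0 = 0"
  using N_lin by (auto simp: linear_add linear_diff linear_scale linear_0 linear_neg)

lemma N_blin: "bounded_linear N"
  by (intro bounded_linear.intro bounded_linear_axioms.intro N_lin exI[of _ K])
     (use N_norm in \<open>simp add: mult.commute\<close>)

lemma p_bnull_dom:
  assumes "bnull P v" "\<And>n. \<bar>u n\<bar> \<le> v n" "p \<in> P"
  shows "(\<lambda>n. p (u n)) \<longlonglongrightarrow> 0"
proof (rule p_tendsto_0I[OF assms(3) _ bnullD[OF assms(1,3)]])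
  show "p (u n) \<le> p (v n)" for n
    by (rule solid[OF assms(3)]) (metis abs_ge_self assms(2) order_trans)
qed

subsection \<open>The inverse of the identity minus \<open>N\<close>\<close>

definition Ninv :: "'a \<Rightarrow> 'a" where
  "Ninv x = (\<Sum>i. (N ^^ i) x)"

lemma N_pow_norm: "norm ((N ^^ i) x) \<le> K ^ i * norm x"
proof (induction i)
  case (Suc i)
  have "norm (N ((N ^^ i) x)) \<le> K * norm ((N ^^ i) x)" by (rule N_norm)
  also have "\<dots> \<le> K * (K ^ i * norm x)" using Suc K_nonneg by (rule mult_left_mono)
  finally show ?case by (simp add: mult.assoc)
qed simp

lemma N_pow_lin: "linear (N ^^ i)"
proof (induction i)
  case 0 show ?case by (simp add: linear_iff)
next
  case (Suc i) thus ?case using linear_compose[OF Suc N_lin] by (simp add: o_def)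
qed

lemma N_pow_summable: "summable (\<lambda>i. (N ^^ i) x)"
proof (rule summable_comparison_test'[where N=0])
  show "summable (\<lambda>i. K ^ i * norm x)" using K_nonneg K_less by (intro summable_mult2 summable_geometric) simp
  show "norm ((N ^^ i) x) \<le> K ^ i * norm x" for i by (rule N_pow_norm)
qed

lemma Ninv_norm: "norm (Ninv x) \<le> norm x / (1 - K)"
proof -
  have s: "(\<lambda>i. K ^ i * norm x) sums (1 / (1 - K) * norm x)"
    using K_nonneg K_less by (intro sums_mult2 geometric_sums) simp
  have "norm (Ninv x) \<le> (\<Sum>i. K ^ i * norm x)"
    unfolding Ninv_def by (rule norm_suminf_le[OF N_pow_norm]) (use s in \<open>simp add: sums_iff\<close>)
  thus ?thesis using s by (simp add: sums_iff)
qed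

lemma Ninv_lin: "linear Ninv"
  unfolding Ninv_def
  by (rule linearI)
     (simp_all add: linear_add[OF N_pow_lin] linear_scale[OF N_pow_lin] suminf_add[symmetric] N_pow_summable suminf_scaleR_right)

lemma Ninv_eq: "Ninv x - N (Ninv x) = x"
proof -
  have "N (Ninv x) = (\<Sum>i. (N ^^ Suc i) x)"
    unfolding Ninv_def by (simp add: bounded_linear.suminf[OF N_blin N_pow_summable])
  thus ?thesis using suminf_split_head[OF N_pow_summable, of x] by (simp add: Ninv_def)
qed

lemma Ninv_inverse: "Ninv (x - N x) = x"
proof -
  have "Ninv (N x) = (\<Sum>i. (N ^^ Suc i) x)"
    unfolding Ninv_def by (simp add: funpow_swap1)
  hence "Ninv x - Ninv (N x) = x" using suminf_split_head[OF N_pow_summable, of x] by (simp add: Ninv_def)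
  thus ?thesis by (simp add: linear_diff[OF Ninv_lin])
qed

lemma Ninv_split: "Ninv x = (\<Sum>i<m. (N ^^ i) x) + Ninv ((N ^^ m) x)"
proof (induction m)
  case (Suc m)
  have "Ninv y = y + Ninv (N y)" for y using Ninv_inverse[of y] by (simp add: linear_diff[OF Ninv_lin] algebra_simps)
  from this[of "(N ^^ m) x"] Suc show ?case by (simp add: add.assoc)
qed simp

lemma Ninv_pos:
  assumes "0 \<le> x"
  shows "0 \<le> Ninv x"
proof (rule nonneg_of_norm_approx)
  fix e :: real assume e: "0 < e"
  have N: "0 \<le> (N ^^ i) x" for i using assms by (induction i) (auto intro: N_pos)
  have "(\<lambda>m. \<Sum>i<m. (N ^^ i) x) \<longlonglongrightarrow> Ninv x" unfolding Ninv_def by (rule summable_LIMSEQ[OF N_pow_summable])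
  hence "\<forall>\<^sub>F m in sequentially. dist (\<Sum>i<m. (N ^^ i) x) (Ninv x) < e" using e by (rule tendstoD)
  then obtain m where "dist (\<Sum>i<m. (N ^^ i) x) (Ninv x) < e" unfolding eventually_sequentially by blast
  thus "\<exists>y\<ge>0. norm (Ninv x - y) < e"
    by (intro exI[of _ "\<Sum>i<m. (N ^^ i) x"]) (auto simp: dist_norm norm_minus_commute intro!: sum_nonneg N)
qed

text \<open>
  The tail of the Neumann series is small in norm, uniformly on bounded sets, and each of the finitely
  many remaining terms preserves bounded null sequences.
\<close>

lemma Ninv_bnull:
  assumes u: "bnull P u"
  shows "bnull P (\<lambda>n. Ninv (u n))"
proof -
  obtain a where a: "\<And>n. norm (u n) \<le> a" using bnull_bounded[OF u] by blast
  have a0: "0 \<le> a" using a[of 0] norm_ge_zero order_trans by blast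
  have bd: "norm (Ninv ((N ^^ m) (u n))) \<le> K ^ m * (a / (1 - K))" for m n
  proof -
    have "norm (Ninv ((N ^^ m) (u n))) \<le> norm ((N ^^ m) (u n)) / (1 - K)" by (rule Ninv_norm)
    also have "\<dots> \<le> (K ^ m * a) / (1 - K)"
      using N_pow_norm[of m "u n"] mult_left_mono[OF a, of "K ^ m" n] K_nonneg K_less
      by (intro divide_right_mono) auto
    finally show ?thesis by simp
  qed
  have "(\<lambda>n. p (Ninv (u n))) \<longlonglongrightarrow> 0" if p: "p \<in> P" for p
    unfolding p_tendsto_0_eps[OF p]
  proof safe
    fix e :: real assume e: "0 < e"
    obtain b where b: "0 < b" "\<And>x. p x \<le> b * norm x" using seminorm_le_norm[OF p] by blast
    have "(\<lambda>m. b * (K ^ m * (a / (1 - K)))) \<longlonglongrightarrow> b * (0 * (a / (1 - K)))"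
      using K_nonneg K_less by (intro tendsto_mult tendsto_const LIMSEQ_realpow_zero) auto
    hence "\<forall>\<^sub>F m in sequentially. b * (K ^ m * (a / (1 - K))) < e / 2"
      using e by (intro order_tendstoD(2)) auto
    then obtain m where m: "b * (K ^ m * (a / (1 - K))) < e / 2" unfolding eventually_sequentially by blast
    have "bnull P (\<lambda>n. (N ^^ i) (u n))" for i by (induction i) (auto simp: u intro: N_bnull)
    hence "(\<lambda>n. \<Sum>i<m. p ((N ^^ i) (u n))) \<longlonglongrightarrow> (\<Sum>i<m. 0)"
      using p by (intro tendsto_sum) (simp add: bnull_def)
    hence "\<forall>\<^sub>F n in sequentially. (\<Sum>i<m. p ((N ^^ i) (u n))) < e / 2"
      using e by (intro order_tendstoD(2)) auto
    thus "\<forall>\<^sub>F n in sequentially. p (Ninv (u n)) < e"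
    proof eventually_elim
      case (elim n)
      have "p (Ninv (u n)) \<le> p (\<Sum>i<m. (N ^^ i) (u n)) + p (Ninv ((N ^^ m) (u n)))"
        by (subst Ninv_split[of "u n" m]) (rule p_tri[OF p])
      also have "\<dots> \<le> (\<Sum>i<m. p ((N ^^ i) (u n))) + b * (K ^ m * (a / (1 - K)))"
        using b(2)[of "Ninv ((N ^^ m) (u n))"] mult_left_mono[OF bd[of m n], of b] b(1)
          seminorm_sum_le[OF sn[OF p], of "\<lambda>i. (N ^^ i) (u n)" "{..<m}"] by linarith
      finally show ?case using elim m by linarith
    qed
  qed
  moreover have "Bseq (\<lambda>n. Ninv (u n))" using bd[of 0] by (intro BseqI') simp
  ultimately show ?thesis unfolding bnull_def by blast
qed

text \<open>The inverse of \<open>I - N\<close> is positive, hence monotone.\<close>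

lemma Ninv_dominates:
  assumes "W \<le> V + N W"
  shows "W \<le> Ninv V"
proof -
  have "0 \<le> Ninv (V - (W - N W))" using assms by (intro Ninv_pos) (simp add: algebra_simps)
  thus ?thesis by (simp only: linear_diff[OF Ninv_lin, of V] Ninv_inverse) simp
qed

subsection \<open>The discrete scheme\<close>

definition D :: "real \<Rightarrow> 'a \<Rightarrow> 'a" where
  "D h x = N x - U h (N x)"

text \<open>
  \<open>D h x\<close> is what the perturbation, with its argument frozen at \<open>x\<close>, contributes in time \<open>h\<close>, and \<open>F h x\<close>
  is the value at time \<open>h\<close> of the solution with this frozen argument.
\<close>

definition F :: "real \<Rightarrow> 'a \<Rightarrow> 'a" where
  "F h x = U h x + D h x"

lemma D_lin: "0 \<le> h \<Longrightarrow> linear (D h)"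
  unfolding D_def by (intro linearI) (simp_all add: N_simps T_plus T_scaleR algebra_simps)

lemma D_pos: "0 \<le> h \<Longrightarrow> 0 \<le> x \<Longrightarrow> 0 \<le> D h x"
  unfolding D_def using N_excess by simp

lemma D_abs: "0 \<le> h \<Longrightarrow> \<bar>x\<bar> \<le> y \<Longrightarrow> \<bar>D h x\<bar> \<le> D h y"
  by (rule abs_positive_linear_le[OF D_lin D_pos])

lemma U_abs: "0 \<le> h \<Longrightarrow> \<bar>x\<bar> \<le> y \<Longrightarrow> \<bar>U h x\<bar> \<le> U h y"
  by (rule abs_positive_linear_le[OF T_lin U_pos])

lemma D_le_D_double:
  assumes "0 \<le> h" "0 \<le> x"
  shows "D h x \<le> D (2 * h) x"
proof -
  have "0 \<le> U h (N x - U h (N x))" using assms N_excess by (intro U_pos) auto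
  thus ?thesis unfolding D_def using assms T_add[of h h "N x"] by (simp add: T_minus)
qed

lemma D_le_N: "0 \<le> h \<Longrightarrow> 0 \<le> x \<Longrightarrow> D h x \<le> N x"
  unfolding D_def using U_pos N_pos by simp

lemma F_lin: "0 \<le> h \<Longrightarrow> linear (F h)"
  unfolding F_def[abs_def] by (intro linear_compose_add T_lin D_lin)

lemma F_pos: "0 \<le> h \<Longrightarrow> 0 \<le> x \<Longrightarrow> 0 \<le> F h x"
  unfolding F_def using U_pos D_pos by (intro add_nonneg_nonneg) auto

lemma F_pow_lin: "0 \<le> h \<Longrightarrow> linear (F h ^^ k)"
proof (induction k)
  case 0 show ?case by (simp add: linear_iff)
next
  case (Suc k) thus ?case using linear_compose[OF Suc.IH F_lin] by (simp add: o_def)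
qed

lemmas F_pow_simps = linear_add[OF F_pow_lin] linear_diff[OF F_pow_lin] linear_scale[OF F_pow_lin] linear_0[OF F_pow_lin]

lemma F_pow_pos: "0 \<le> h \<Longrightarrow> 0 \<le> x \<Longrightarrow> 0 \<le> (F h ^^ k) x"
  by (induction k) (auto intro: F_pos)

text \<open>
  The contributions \<open>D h W\<close> of the single steps, transported by \<open>U\<close>, telescope to \<open>D (k h) W\<close>. So the
  bound does not depend on the number of steps.
\<close>

lemma discrete_volterra:
  assumes h: "0 \<le> h" and W: "0 \<le> W"
    and step: "\<And>j. j < k \<Longrightarrow> \<bar>e (Suc j) - U h (e j)\<bar> \<le> D h W"
  shows "\<bar>e k - U (real k * h) (e 0)\<bar> \<le> N W"
proof -
  have "\<bar>e k - U (real k * h) (e 0)\<bar> \<le> D (real k * h) W" using step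
  proof (induction k)
    case (Suc k)
    have U: "U (real (Suc k) * h) z = U h (U (real k * h) z)" for z
      using h T_add[of h "real k * h" z] by (simp add: distrib_right)
    have "e (Suc k) - U (real (Suc k) * h) (e 0) =
        (e (Suc k) - U h (e k)) + U h (e k - U (real k * h) (e 0))"
      using h by (simp only: U T_minus) simp
    also have "\<bar>\<dots>\<bar> \<le> \<bar>e (Suc k) - U h (e k)\<bar> + \<bar>U h (e k - U (real k * h) (e 0))\<bar>"
      by (rule abs_triangle_ineq)
    also have "\<dots> \<le> D h W + U h (D (real k * h) W)"
      using Suc by (intro add_mono U_abs[OF h]) auto
    also have "\<dots> = D (real (Suc k) * h) W" unfolding D_def using h by (simp only: U T_minus) simp
    finally show ?case .
  qed (simp add: D_def)
  also have "\<dots> \<le> N W" using h W by (intro D_le_N) auto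
  finally show ?thesis .
qed

text \<open>
  Let \<open>W\<close> be the supremum along the scheme, and \<open>V\<close> along the unperturbed orbit. The previous lemma gives
  \<open>W \<le> V + N W\<close>.
\<close>

lemma scheme_dominates:
  assumes h: "0 \<le> h"
  shows "msup (\<lambda>j. (F h ^^ j) x) k \<le> Ninv (msup (\<lambda>j. U (real j * h) x) k)" (is "?W \<le> Ninv ?V")
proof (rule Ninv_dominates, rule msup_le)
  fix j assume j: "j \<le> k"
  have "\<bar>(F h ^^ j) x - U (real j * h) ((F h ^^ 0) x)\<bar> \<le> N ?W"
  proof (rule discrete_volterra[OF h msup_nonneg])
    fix i assume "i < j"
    hence "\<bar>(F h ^^ i) x\<bar> \<le> ?W" using j by (intro msup_ge[of i k "\<lambda>j. (F h ^^ j) x"]) simp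
    thus "\<bar>(F h ^^ Suc i) x - U h ((F h ^^ i) x)\<bar> \<le> D h ?W" using D_abs[OF h] by (simp add: F_def)
  qed
  hence le: "\<bar>(F h ^^ j) x - U (real j * h) x\<bar> \<le> N ?W" by simp
  have "\<bar>(F h ^^ j) x\<bar> \<le> \<bar>U (real j * h) x\<bar> + \<bar>(F h ^^ j) x - U (real j * h) x\<bar>"
    using abs_triangle_ineq[of "U (real j * h) x" "(F h ^^ j) x - U (real j * h) x"] by simp
  also have "\<dots> \<le> ?V + N ?W" by (rule add_mono[OF msup_ge[OF j, of "\<lambda>j. U (real j * h) x"] le])
  finally show "\<bar>(F h ^^ j) x\<bar> \<le> ?V + N ?W" .
qed

lemma msup_norm_le: "(\<And>j. j \<le> k \<Longrightarrow> norm (f j :: 'a) \<le> c) \<Longrightarrow> norm (msup f k) \<le> c"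
  by (rule msup_M_le) (simp_all add: norm_max)

lemma msup_p_le: "p \<in> P \<Longrightarrow> (\<And>j. j \<le> k \<Longrightarrow> p (f j) \<le> c) \<Longrightarrow> p (msup f k) \<le> c"
  by (rule msup_M_le) (auto simp: p_sup)

lemma node_mono: "0 \<le> h \<Longrightarrow> j \<le> k \<Longrightarrow> real k * h \<le> t \<Longrightarrow> real j * h \<in> {0..t}"
  using order_trans[OF mult_right_mono[of "real j" "real k" h]] by simp

lemma F_pow_bound:
  assumes "0 \<le> h" "real k * h \<le> t"
  shows "norm ((F h ^^ k) x) \<le> M / (1 - K) * exp (w * t) * norm x"
proof -
  have "norm ((F h ^^ k) x) \<le> norm (msup (\<lambda>j. (F h ^^ j) x) k)"
    using msup_ge[of k k "\<lambda>j. (F h ^^ j) x"] by (intro norm_le_of_abs_le) simp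
  also have "\<dots> \<le> norm (Ninv (msup (\<lambda>j. U (real j * h) x) k))"
    by (rule norm_mono_banach_lattice[OF msup_nonneg scheme_dominates[OF assms(1)]])
  also have "\<dots> \<le> norm (msup (\<lambda>j. U (real j * h) x) k) / (1 - K)" by (rule Ninv_norm)
  also have "\<dots> \<le> (M * exp (w * t) * norm x) / (1 - K)"
    using K_less node_mono[OF assms(1) _ assms(2)] by (intro divide_right_mono msup_norm_le T_bound_le) auto
  finally show ?thesis by simp
qed

text \<open>
  The supremum along the unperturbed orbits of a bounded null sequence is again a bounded null sequence,
  because \<open>U\<close> is equicontinuous and a supremum is as small as its largest member. Applying the inverse
  of \<open>I - N\<close> dominates the scheme.
\<close>

lemma F_equi:
  assumes u: "bnull P u" and p: "p \<in> P" and e: "0 < e" and t: "0 \<le> t"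
  shows "\<exists>n0. \<forall>n\<ge>n0. \<forall>h k. 0 \<le> h \<longrightarrow> real k * h \<le> t \<longrightarrow> p ((F h ^^ k) (u n)) < e"
proof -
  \<comment> \<open>For each \<open>n\<close> choose a step size and a number of steps that violate the bound, if there are any.\<close>
  have "\<exists>h k. 0 \<le> h \<and> real k * h \<le> t \<and>
      ((\<exists>h' k'. 0 \<le> h' \<and> real k' * h' \<le> t \<and> \<not> p ((F h' ^^ k') (u n)) < e) \<longrightarrow> \<not> p ((F h ^^ k) (u n)) < e)" for n
    using t by (cases "\<exists>h' k'. 0 \<le> h' \<and> real k' * h' \<le> t \<and> \<not> p ((F h' ^^ k') (u n)) < e") (blast, auto intro!: exI[of _ 0])
  then obtain h k where hk: "\<And>n. 0 \<le> h n" "\<And>n. real (k n) * h n \<le> t"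
      "\<And>n h' k'. 0 \<le> h' \<Longrightarrow> real k' * h' \<le> t \<Longrightarrow> \<not> p ((F h' ^^ k') (u n)) < e \<Longrightarrow> \<not> p ((F (h n) ^^ k n) (u n)) < e"
    by metis
  define V where "V n = msup (\<lambda>j. U (real j * h n) (u n)) (k n)" for n
  have "bnull P V"
  proof -
    obtain a where a: "\<And>n. norm (u n) \<le> a" using bnull_bounded[OF u] by blast
    have "norm (V n) \<le> M * exp (w * t) * a" for n
      unfolding V_def
    proof (rule msup_norm_le)
      fix j assume "j \<le> k n"
      hence "real j * h n \<in> {0..t}" using node_mono[OF hk(1) _ hk(2)] by blast
      hence "norm (U (real j * h n) (u n)) \<le> M * exp (w * t) * norm (u n)" by (intro T_bound_le) auto
      also have "\<dots> \<le> M * exp (w * t) * a" using a[of n] M_pos by (intro mult_left_mono) auto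
      finally show "norm (U (real j * h n) (u n)) \<le> M * exp (w * t) * a" .
    qed
    moreover have "\<forall>\<^sub>F n in sequentially. q (V n) < \<epsilon>" if q: "q \<in> P" and \<epsilon>: "0 < \<epsilon>" for q and \<epsilon> :: real
    proof -
      obtain n0 where n0: "\<And>n s. n \<ge> n0 \<Longrightarrow> s \<in> {0..t} \<Longrightarrow> q (U s (u n)) < \<epsilon> / 2"
        using T_equi[OF u q half_gt_zero[OF \<epsilon>], of t] by blast
      have "q (V n) \<le> \<epsilon> / 2" if "n \<ge> n0" for n
        unfolding V_def
        using n0[OF that node_mono[OF hk(1) _ hk(2)]] by (intro msup_p_le[OF q]) (auto intro: less_imp_le)
      thus "\<forall>\<^sub>F n in sequentially. q (V n) < \<epsilon>"
        unfolding eventually_sequentially by (blast intro: less_of_le_half[OF \<epsilon>])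
    qed
    ultimately show ?thesis by (rule bnullI)
  qed
  hence "bnull P (\<lambda>n. Ninv (V n))" by (rule Ninv_bnull)
  hence "(\<lambda>n. p ((F (h n) ^^ k n) (u n))) \<longlonglongrightarrow> 0"
  proof (rule p_bnull_dom[OF _ _ p])
    show "\<bar>(F (h n) ^^ k n) (u n)\<bar> \<le> Ninv (V n)" for n
      unfolding V_def
      using msup_ge[of "k n" "k n" "\<lambda>j. (F (h n) ^^ j) (u n)"] scheme_dominates[OF hk(1), of n "u n" "k n"] by simp
  qed
  then obtain n0 where "\<And>n. n \<ge> n0 \<Longrightarrow> p ((F (h n) ^^ k n) (u n)) < e"
    unfolding p_tendsto_0_eps[OF p] eventually_sequentially using e by blast
  thus ?thesis using hk(3) by blast
qed

subsection \<open>The scheme on the domain of the perturbed generator\<close>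

text \<open>The perturbed operator, expressed without the extrapolation space.\<close>

definition G :: "('a \<times> 'a) set" where
  "G = {(x, y). (x - N x, y) \<in> gen P U}"

lemma G_bidense: "\<exists>u. (\<forall>n. u n \<in> Domain G) \<and> bnull P (\<lambda>n. u n - x)"
proof -
  obtain a where a: "\<And>n. a n \<in> Domain (gen P U)" "bnull P (\<lambda>n. a n - (x - N x))"
    using gen_bidense[OF R, of "x - N x"] by blast
  have "Ninv (a n) \<in> Domain G" for n using a(1)[of n] unfolding G_def by (auto simp: Ninv_eq)
  moreover have "bnull P (\<lambda>n. Ninv (a n) - x)"
    using Ninv_bnull[OF a(2)] by (simp only: linear_diff[OF Ninv_lin, of "a _"] Ninv_inverse)
  ultimately show ?thesis by (intro exI[of _ "\<lambda>n. Ninv (a n)"]) simp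
qed

lemma F_minus_id: "0 \<le> h \<Longrightarrow> F h x - x = U h (x - N x) - (x - N x)"
  by (simp add: F_def D_def T_minus)

lemma F_lip:
  assumes "x \<in> Domain G"
  shows "\<exists>C\<ge>0. \<forall>h\<in>{0..1}. norm (F h x - x) \<le> C * h"
proof -
  obtain y where "(x - N x, y) \<in> gen P U" using assms unfolding G_def by blast
  then obtain C where C: "\<And>t. t \<in> {0<..1} \<Longrightarrow> norm (U t (x - N x) - (x - N x)) \<le> C * t"
    unfolding gen_iff by blast
  have "norm (F h x - x) \<le> max C 0 * h" if "h \<in> {0..1}" for h
  proof (cases "h = 0")
    case False
    hence "norm (F h x - x) \<le> C * h" using C[of h] that by (simp add: F_minus_id)
    also have "\<dots> \<le> max C 0 * h" using that by (intro mult_right_mono) auto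
    finally show ?thesis .
  qed (simp add: F_def D_def)
  thus ?thesis by (intro exI[of _ "max C 0"]) auto
qed

text \<open>
  \<open>F h x - x\<close> is an increment of the unperturbed orbit of \<open>x - N x\<close>, hence \<open>O(h)\<close>, and the powers of \<open>F h\<close>
  commute with \<open>F h\<close> and are bounded.
\<close>

lemma F_pow_lip:
  assumes "x \<in> Domain G" "0 \<le> t"
  shows "\<exists>C\<ge>0. \<forall>h\<in>{0..1}. \<forall>k. real k * h \<le> t \<longrightarrow>
    norm ((F h ^^ Suc k) x - (F h ^^ k) x) \<le> C * h \<and> norm ((F h ^^ k) x - x) \<le> C * (real k * h)"
proof -
  obtain C where C: "0 \<le> C" "\<And>h. h \<in> {0..1} \<Longrightarrow> norm (F h x - x) \<le> C * h" using F_lip[OF assms(1)] by blast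
  define L where "L = M / (1 - K) * exp (w * t)"
  have L: "0 \<le> L" using M_pos K_less unfolding L_def by simp
  have 1: "norm ((F h ^^ Suc k) x - (F h ^^ k) x) \<le> L * C * h" if h: "h \<in> {0..1}" and k: "real k * h \<le> t" for h k
  proof -
    have "(F h ^^ Suc k) x - (F h ^^ k) x = (F h ^^ k) (F h x - x)"
      using h by (simp add: F_pow_simps funpow_swap1)
    hence "norm ((F h ^^ Suc k) x - (F h ^^ k) x) \<le> L * norm (F h x - x)"
      using F_pow_bound[OF _ k, of "F h x - x"] h unfolding L_def by simp
    also have "\<dots> \<le> L * (C * h)" using C(2)[OF h] L by (rule mult_left_mono)
    finally show ?thesis by (simp add: mult.assoc)
  qed
  have 2: "real k * h \<le> t \<Longrightarrow> norm ((F h ^^ k) x - x) \<le> L * C * (real k * h)" if h: "h \<in> {0..1}" for h k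
  proof (induction k)
    case (Suc k)
    have k: "real k * h \<le> t" using Suc.prems h by (simp add: algebra_simps)
    have "norm ((F h ^^ Suc k) x - x) \<le> norm ((F h ^^ Suc k) x - (F h ^^ k) x) + norm ((F h ^^ k) x - x)"
      using norm_triangle_ineq[of "(F h ^^ Suc k) x - (F h ^^ k) x" "(F h ^^ k) x - x"] by simp
    also have "\<dots> \<le> L * C * h + L * C * (real k * h)" using 1[OF h k] Suc.IH[OF k] by linarith
    finally show ?case by (simp add: algebra_simps)
  qed simp
  show ?thesis using 1 2 L C(1) by (intro exI[of _ "L * C"]) auto
qed

text \<open>
  Two steps of length \<open>h\<close> differ from one step of length \<open>2 h\<close> only because the second half uses the
  argument \<open>F h u\<close> instead of \<open>u\<close>; the defect \<open>D h (F h u - u)\<close> feeds a Volterra inequality for the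
  difference \<open>e\<close> of the two schemes.
\<close>

lemma F_refine:
  assumes "x \<in> Domain G" "0 \<le> t"
  shows "\<exists>C\<ge>0. \<forall>h\<in>{0..1}. \<forall>k. real k * (2 * h) \<le> t \<longrightarrow>
    norm ((F h ^^ (2 * k)) x - (F (2 * h) ^^ k) x) \<le> C * h"
proof -
  obtain C where C: "0 \<le> C" "\<And>h k. h \<in> {0..1} \<Longrightarrow> real k * h \<le> t \<Longrightarrow> norm ((F h ^^ Suc k) x - (F h ^^ k) x) \<le> C * h"
    using F_pow_lip[OF assms(1), of t] assms(2) by blast
  have "norm ((F h ^^ (2 * k)) x - (F (2 * h) ^^ k) x) \<le> C / (1 - K) * h"
    if h: "h \<in> {0..1}" and k: "real k * (2 * h) \<le> t" for h k
  proof -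
    have h0: "0 \<le> h" "0 \<le> 2 * h" using h by auto
    define e where "e j = (F h ^^ (2 * j)) x - (F (2 * h) ^^ j) x" for j
    define d where "d j = (F h ^^ Suc (2 * j)) x - (F h ^^ (2 * j)) x" for j
    let ?We = "msup e k" and ?Wd = "msup d k"
    have two: "F h (F h u) = F (2 * h) u + D h (F h u - u)" for u
      using h0 T_add[of h h] unfolding F_def D_def by (simp add: T_plus T_minus N_simps)
    have step: "e (Suc j) - U (2 * h) (e j) = D (2 * h) (e j) + D h (d j)" for j
    proof -
      have "e (Suc j) = F (2 * h) ((F h ^^ (2 * j)) x) + D h (d j) - F (2 * h) ((F (2 * h) ^^ j) x)"
        unfolding e_def d_def using two[of "(F h ^^ (2 * j)) x"] by simp
      also have "\<dots> = F (2 * h) (e j) + D h (d j)" unfolding e_def by (simp add: linear_diff[OF F_lin[OF h0(2)]])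
      finally show ?thesis by (simp add: F_def)
    qed
    have "\<bar>e j\<bar> \<le> N ?Wd + N ?We" if j: "j \<le> k" for j
    proof -
      have "\<bar>e j - U (real j * (2 * h)) (e 0)\<bar> \<le> N (?We + ?Wd)"
      proof (rule discrete_volterra[OF h0(2)])
        fix i assume "i < j"
        hence i: "i \<le> k" using j by simp
        have "\<bar>e (Suc i) - U (2 * h) (e i)\<bar> \<le> \<bar>D (2 * h) (e i)\<bar> + \<bar>D h (d i)\<bar>"
          unfolding step by (rule abs_triangle_ineq)
        also have "\<dots> \<le> D (2 * h) ?We + D (2 * h) ?Wd"
          by (rule add_mono[OF D_abs[OF h0(2) msup_ge[OF i]]
                order_trans[OF D_abs[OF h0(1) msup_ge[OF i]] D_le_D_double[OF h0(1) msup_nonneg]]])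
        also have "\<dots> = D (2 * h) (?We + ?Wd)" by (rule linear_add[OF D_lin[OF h0(2)], symmetric])
        finally show "\<bar>e (Suc i) - U (2 * h) (e i)\<bar> \<le> D (2 * h) (?We + ?Wd)" .
      qed simp
      moreover have "e 0 = 0" by (simp add: e_def)
      ultimately show ?thesis using h0 by (simp add: T_zero N_simps add.commute)
    qed
    hence "?We \<le> Ninv (N ?Wd)" by (intro Ninv_dominates msup_le)
    hence "norm ?We \<le> norm (Ninv (N ?Wd))" by (rule norm_mono_banach_lattice[OF msup_nonneg])
    also have "\<dots> \<le> norm (N ?Wd) / (1 - K)" by (rule Ninv_norm)
    also have "\<dots> \<le> (C * h) / (1 - K)"
    proof (rule divide_right_mono)
      have "norm ?Wd \<le> C * h"
      proof (rule msup_norm_le)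
        fix j assume j: "j \<le> k"
        have "real (2 * j) * h = real j * (2 * h)" by simp
        also have "\<dots> \<le> real k * (2 * h)" using j h0 by (intro mult_right_mono) auto
        finally show "norm (d j) \<le> C * h" unfolding d_def using k by (intro C(2)[OF h]) linarith
      qed
      thus "norm (N ?Wd) \<le> C * h" using N_norm[of ?Wd] K_less K_nonneg
        by (smt (verit) mult_left_le_one_le norm_ge_zero)
    qed (use K_less in simp)
    finally have "norm ?We \<le> C / (1 - K) * h" by simp
    moreover have "norm (e k) \<le> norm ?We" using msup_ge[of k k e] by (intro norm_le_of_abs_le) simp
    ultimately show ?thesis unfolding e_def by linarith
  qed
  thus ?thesis using C(1) K_less by (intro exI[of _ "C / (1 - K)"]) auto
qed

end

section \<open>The perturbed semigroup\<close>

lemma grid_Suc: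
  assumes "0 \<le> t"
  shows "grid (Suc n) t = 2 * grid n t \<or> grid (Suc n) t = Suc (2 * grid n t)"
proof -
  define a where "a = t * 2 ^ n"
  have "0 \<le> a" using assms unfolding a_def by simp
  moreover have "grid n t = nat \<lfloor>a\<rfloor>" "grid (Suc n) t = nat \<lfloor>2 * a\<rfloor>"
    unfolding grid_def a_def by (simp_all add: mult.left_commute)
  moreover have "\<lfloor>2 * a\<rfloor> = 2 * \<lfloor>a\<rfloor> \<or> \<lfloor>2 * a\<rfloor> = 2 * \<lfloor>a\<rfloor> + 1" by linarith
  moreover have "0 \<le> \<lfloor>a\<rfloor>" using \<open>0 \<le> a\<close> by simp
  ultimately show ?thesis by (auto simp: nat_mult_distrib nat_add_distrib)
qed

lemma grid_add:
  assumes "0 \<le> t" "0 \<le> s"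
  shows "grid n (t + s) = grid n t + grid n s \<or> grid n (t + s) = Suc (grid n t + grid n s)"
proof -
  define a b where "a = t * 2 ^ n" and "b = s * 2 ^ n"
  have ab: "0 \<le> a" "0 \<le> b" using assms unfolding a_def b_def by auto
  have eq: "grid n t = nat \<lfloor>a\<rfloor>" "grid n s = nat \<lfloor>b\<rfloor>" "grid n (t + s) = nat \<lfloor>a + b\<rfloor>"
    unfolding grid_def a_def b_def by (simp_all add: distrib_right)
  have "\<lfloor>a + b\<rfloor> = \<lfloor>a\<rfloor> + \<lfloor>b\<rfloor> \<or> \<lfloor>a + b\<rfloor> = \<lfloor>a\<rfloor> + \<lfloor>b\<rfloor> + 1" by linarith
  moreover have "0 \<le> \<lfloor>a\<rfloor>" "0 \<le> \<lfloor>b\<rfloor>" using ab by auto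
  ultimately show ?thesis unfolding eq by (auto simp: nat_add_distrib)
qed

context positive_perturbation
begin

definition Sn :: "nat \<Rightarrow> real \<Rightarrow> 'a \<Rightarrow> 'a" where
  "Sn n t x = (F ((1/2) ^ n) ^^ grid n t) x"

definition S :: "real \<Rightarrow> 'a \<Rightarrow> 'a" where
  "S t x = (SOME l. bnull P (\<lambda>n. Sn n t x - l))"

lemma grid_node_le: "t \<in> {0..t0} \<Longrightarrow> real (grid n t) * (1/2) ^ n \<le> t0"
  using grid_le[of t n] by simp

lemma Sn_lin: "linear (Sn n t)"
  unfolding Sn_def[abs_def] by (intro F_pow_lin) simp

lemma Sn_pos: "0 \<le> x \<Longrightarrow> 0 \<le> Sn n t x"
  unfolding Sn_def by (intro F_pow_pos) auto

lemma Sn_bound: "0 \<le> t \<Longrightarrow> norm (Sn n t x) \<le> M / (1 - K) * exp (w * t) * norm x"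
  unfolding Sn_def by (intro F_pow_bound grid_le) auto

lemma Sn_equi:
  assumes "bnull P u" "p \<in> P" "0 < e"
  shows "\<exists>n0. \<forall>n\<ge>n0. \<forall>m. \<forall>t\<in>{0..t0}. p (Sn m t (u n)) < e"
proof (cases "0 \<le> t0")
  case True
  then obtain n0 where "\<And>n h k. n \<ge> n0 \<Longrightarrow> 0 \<le> h \<Longrightarrow> real k * h \<le> t0 \<Longrightarrow> p ((F h ^^ k) (u n)) < e"
    using F_equi[OF assms] by meson
  thus ?thesis unfolding Sn_def using grid_node_le by (intro exI[of _ n0]) simp
qed auto

lemma Sn_Cauchy_G:
  assumes "x \<in> Domain G" "0 \<le> t0"
  shows "\<exists>C\<ge>0. \<forall>n m. n \<le> m \<longrightarrow> (\<forall>t\<in>{0..t0}. norm (Sn m t x - Sn n t x) \<le> C * (1/2) ^ n)"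
proof -
  obtain C where C: "0 \<le> C" "\<And>h k. h \<in> {0..1} \<Longrightarrow> real k * h \<le> t0 \<Longrightarrow> norm ((F h ^^ Suc k) x - (F h ^^ k) x) \<le> C * h"
    using F_pow_lip[OF assms] by blast
  obtain C' where C': "0 \<le> C'" "\<And>h k. h \<in> {0..1} \<Longrightarrow> real k * (2 * h) \<le> t0 \<Longrightarrow> norm ((F h ^^ (2 * k)) x - (F (2 * h) ^^ k) x) \<le> C' * h"
    using F_refine[OF assms] by blast
  define L where "L = (C + C') / 2"
  have step: "norm (Sn (Suc n) t x - Sn n t x) \<le> L * (1/2) ^ n" if t: "t \<in> {0..t0}" for n t
  proof -
    let ?h = "(1/2::real) ^ Suc n" and ?k = "grid n t"
    have h: "?h \<in> {0..1}" "2 * ?h = (1/2) ^ n" using power_le_one[of "1/2::real" "Suc n"] by auto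
    have k: "real ?k * (2 * ?h) \<le> t0" unfolding h(2) by (rule grid_node_le[OF t])
    hence k2: "real (2 * ?k) * ?h \<le> t0" by simp
    have a: "norm ((F ?h ^^ (2 * ?k)) x - Sn n t x) \<le> C' * ?h"
      using C'(2)[OF h(1) k] unfolding Sn_def h(2) .
    have b: "norm ((F ?h ^^ Suc (2 * ?k)) x - (F ?h ^^ (2 * ?k)) x) \<le> C * ?h" by (rule C(2)[OF h(1) k2])
    have L: "L * (1/2) ^ n = C' * ?h + C * ?h" unfolding L_def by (simp add: field_simps)
    consider "Sn (Suc n) t x = (F ?h ^^ (2 * ?k)) x" | "Sn (Suc n) t x = (F ?h ^^ Suc (2 * ?k)) x"
      using grid_Suc[of t n] t unfolding Sn_def by auto
    thus ?thesis
    proof cases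
      case 1
      have "0 \<le> C * ?h" using C(1) by simp
      thus ?thesis unfolding 1 L using a by linarith
    next
      case 2
      show ?thesis unfolding 2 L
        using norm_diff_triangle_le[OF b a] by linarith
    qed
  qed
  have "norm (Sn (n + i) t x - Sn n t x) \<le> 2 * L * ((1/2) ^ n - (1/2) ^ (n + i))" if t: "t \<in> {0..t0}" for n i t
  proof (induction i)
    case (Suc i)
    have "norm (Sn (n + Suc i) t x - Sn n t x) \<le> norm (Sn (Suc (n + i)) t x - Sn (n + i) t x) + norm (Sn (n + i) t x - Sn n t x)"
      using norm_triangle_ineq[of "Sn (Suc (n + i)) t x - Sn (n + i) t x" "Sn (n + i) t x - Sn n t x"] by simp
    also have "\<dots> \<le> L * (1/2) ^ (n + i) + 2 * L * ((1/2) ^ n - (1/2) ^ (n + i))"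
      using Suc step[OF t] by (rule add_mono[rotated])
    also have "\<dots> = 2 * L * ((1/2) ^ n - (1/2) ^ (n + Suc i))" by (simp add: algebra_simps)
    finally show ?case .
  qed simp
  moreover have "2 * L * ((1/2) ^ n - (1/2) ^ (n + i)) \<le> 2 * L * (1/2) ^ n" for n i
    using C(1) C'(1) unfolding L_def by (intro mult_left_mono) auto
  ultimately have "norm (Sn m t x - Sn n t x) \<le> 2 * L * (1/2) ^ n" if nm: "n \<le> m" and t: "t \<in> {0..t0}" for n m t
  proof -
    obtain i where "m = n + i" using le_Suc_ex[OF nm] by blast
    thus ?thesis
      using order_trans[OF \<open>\<And>t n i. t \<in> {0..t0} \<Longrightarrow> norm (Sn (n + i) t x - Sn n t x) \<le> 2 * L * ((1/2) ^ n - (1/2) ^ (n + i))\<close>[OF t]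
          \<open>\<And>n i. 2 * L * ((1/2) ^ n - (1/2) ^ (n + i)) \<le> 2 * L * (1/2) ^ n\<close>] by simp
  qed
  moreover have "0 \<le> 2 * L" using C(1) C'(1) unfolding L_def by simp
  ultimately show ?thesis by blast
qed

text \<open>
  Norm convergence on the domain of \<open>G\<close> carries over, because \<open>x\<close> can be replaced by an element of the
  domain at a cost that is uniform in the step and the time.
\<close>

lemma Sn_Cauchy:
  assumes p: "p \<in> P" and e: "0 < e" and t0: "0 \<le> t0"
  shows "\<exists>n0. \<forall>n\<ge>n0. \<forall>m\<ge>n. \<forall>t\<in>{0..t0}. p (Sn m t x - Sn n t x) < e"
proof -
  obtain u where u: "\<And>n. u n \<in> Domain G" "bnull P (\<lambda>n. u n - x)" using G_bidense by blast
  obtain i where i: "\<And>m t. t \<in> {0..t0} \<Longrightarrow> p (Sn m t (u i - x)) < e / 3"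
    using Sn_equi[OF u(2) p, of "e/3" t0] e by (metis divide_pos_pos order_refl zero_less_numeral)
  obtain C where C: "0 \<le> C" "\<And>n m t. n \<le> m \<Longrightarrow> t \<in> {0..t0} \<Longrightarrow> norm (Sn m t (u i) - Sn n t (u i)) \<le> C * (1/2) ^ n"
    using Sn_Cauchy_G[OF u(1) t0] by meson
  obtain b where b: "0 < b" "\<And>x. p x \<le> b * norm x" using seminorm_le_norm[OF p] by blast
  have "(\<lambda>n. b * (C * (1/2) ^ n)) \<longlonglongrightarrow> b * (C * 0)"
    by (intro tendsto_mult tendsto_const half_power_tendsto)
  hence "\<forall>\<^sub>F n in sequentially. b * (C * (1/2) ^ n) < e / 3"
    using e by (intro order_tendstoD(2)) auto
  then obtain n0 where n0: "\<And>n. n \<ge> n0 \<Longrightarrow> b * (C * (1/2) ^ n) < e / 3" unfolding eventually_sequentially by blast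
  have "p (Sn m t x - Sn n t x) < e" if "n \<ge> n0" "m \<ge> n" "t \<in> {0..t0}" for n m t
  proof -
    have "Sn m t x - Sn n t x = (Sn m t (u i) - Sn n t (u i)) + (Sn n t (u i - x) - Sn m t (u i - x))"
      by (simp add: linear_diff[OF Sn_lin])
    hence "p (Sn m t x - Sn n t x) \<le> p (Sn m t (u i) - Sn n t (u i)) + p (Sn n t (u i - x) - Sn m t (u i - x))"
      using p_tri[OF p] by metis
    moreover have "p (Sn n t (u i - x) - Sn m t (u i - x)) \<le> p (Sn n t (u i - x)) + p (Sn m t (u i - x))"
      by (rule seminorm_diff_le[OF sn[OF p]])
    moreover have "p (Sn m t (u i) - Sn n t (u i)) \<le> b * (C * (1/2) ^ n)"
      using order_trans[OF b(2) mult_left_mono[OF C(2)[OF that(2,3)]]] b(1) by simp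
    ultimately show ?thesis using i[OF that(3), of n] i[OF that(3), of m] n0[OF that(1)] by linarith
  qed
  thus ?thesis by blast
qed

lemma S_lim:
  assumes t: "0 \<le> t"
  shows "bnull P (\<lambda>n. Sn n t x - S t x)"
  unfolding S_def
proof (rule someI_ex, rule Cauchy_conv)
  show "Bseq (\<lambda>n. Sn n t x)" using Sn_bound[OF t] by (rule BseqI')
  show "lc_Cauchy_seq P (\<lambda>n. Sn n t x)"
    unfolding lc_Cauchy_seq_def
  proof (intro ballI allI impI)
    fix p and e :: real assume p: "p \<in> P" and e: "0 < e"
    then obtain n0 where n0: "\<And>n m. n \<ge> n0 \<Longrightarrow> m \<ge> n \<Longrightarrow> p (Sn m t x - Sn n t x) < e"
      using Sn_Cauchy[OF p e t, of x] t by (metis atLeastAtMost_iff order_refl)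
    have "p (Sn m t x - Sn n t x) < e" if "m \<ge> n0" "n \<ge> n0" for m n
      using n0[of n m] n0[of m n] that p_commute[OF p, of "Sn m t x" "Sn n t x"] by (cases "n \<le> m") auto
    thus "\<exists>N. \<forall>m\<ge>N. \<forall>n\<ge>N. p (Sn m t x - Sn n t x) < e" by blast
  qed
qed

lemma S_lim_p: "0 \<le> t \<Longrightarrow> p \<in> P \<Longrightarrow> (\<lambda>n. p (Sn n t x - S t x)) \<longlonglongrightarrow> 0"
  by (rule bnullD[OF S_lim])

lemma S_unif:
  assumes p: "p \<in> P" and e: "0 < e" and t0: "0 \<le> t0"
  shows "\<exists>n0. \<forall>n\<ge>n0. \<forall>t\<in>{0..t0}. p (Sn n t x - S t x) \<le> e"
proof -
  obtain n0 where n0: "\<And>n m t. n \<ge> n0 \<Longrightarrow> m \<ge> n \<Longrightarrow> t \<in> {0..t0} \<Longrightarrow> p (Sn m t x - Sn n t x) < e"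
    using Sn_Cauchy[OF p e t0] by blast
  have "p (Sn n t x - S t x) \<le> e" if n: "n \<ge> n0" and t: "t \<in> {0..t0}" for n t
  proof -
    have "p (S t x - Sn n t x) \<le> e"
    proof (rule p_lim_le[OF p, of "\<lambda>m. Sn m t x - Sn n t x" _ "\<lambda>_. e"])
      show "(\<lambda>m. p (Sn m t x - Sn n t x - (S t x - Sn n t x))) \<longlonglongrightarrow> 0" using S_lim_p[OF _ p, of t x] t by simp
      show "\<exists>N. \<forall>m\<ge>N. p (Sn m t x - Sn n t x) \<le> e" using n0[OF n _ t] less_imp_le by blast
    qed simp
    thus ?thesis by (simp add: p_commute[OF p])
  qed
  thus ?thesis by blast
qed

lemma S_lin: "0 \<le> t \<Longrightarrow> linear (S t)"
proof (rule linearI)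
  assume t: "0 \<le> t"
  show "S t (x + y) = S t x + S t y" for x y
    by (rule bnull_lim_unique[OF S_lim[OF t]])
       (use bnull_add_add[OF S_lim[OF t, of x] S_lim[OF t, of y]] in \<open>simp add: linear_add[OF Sn_lin]\<close>)
  show "S t (c *\<^sub>R x) = c *\<^sub>R S t x" for c x
    by (rule bnull_lim_unique[OF S_lim[OF t]])
       (use bnull_scaleR[OF S_lim[OF t, of x], of c] in \<open>simp add: linear_scale[OF Sn_lin] scaleR_diff_right\<close>)
qed

lemma S_pos:
  assumes t: "0 \<le> t" and x: "0 \<le> x"
  shows "0 \<le> S t x"
  by (rule nonneg_lim[OF S_lim[OF t] Sn_pos[OF x]])

lemma S_bound: "0 \<le> t \<Longrightarrow> norm (S t x) \<le> M / (1 - K) * exp (w * t) * norm x"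
  by (rule norm_lsc[where u="\<lambda>n. Sn n t x", OF S_lim_p Sn_bound])

lemma S_equi:
  assumes "bnull P u" "p \<in> P" "0 < e"
  shows "\<exists>n0. \<forall>n\<ge>n0. \<forall>t\<in>{0..t0}. p (S t (u n)) < e"
proof -
  obtain n0 where n0: "\<And>n m t. n \<ge> n0 \<Longrightarrow> t \<in> {0..t0} \<Longrightarrow> p (Sn m t (u n)) < e / 2"
    using Sn_equi[OF assms(1,2) half_gt_zero[OF assms(3)]] by meson
  have "p (S t (u n)) \<le> e / 2" if "n \<ge> n0" "t \<in> {0..t0}" for n t
    by (rule p_lim_le[OF assms(2) S_lim_p[OF _ assms(2)] _ tendsto_const])
       (use n0[OF that] that less_imp_le in auto)
  thus ?thesis by (blast intro: less_of_le_half[OF assms(3)])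
qed

text \<open>
  Uniformity in the step size is what later gives continuity of the limit semigroup at \<open>0\<close>.
\<close>

lemma F_pow_small:
  assumes p: "p \<in> P" and e: "0 < e"
  shows "\<exists>d>0. \<forall>h k. 0 \<le> h \<longrightarrow> h \<le> 1 \<longrightarrow> real k * h \<le> d \<longrightarrow> p ((F h ^^ k) x - x) < e"
proof -
  obtain u where u: "\<And>n. u n \<in> Domain G" "bnull P (\<lambda>n. u n - x)" using G_bidense by blast
  obtain i where i: "\<And>h k. 0 \<le> h \<Longrightarrow> real k * h \<le> 1 \<Longrightarrow> p ((F h ^^ k) (u i - x)) < e / 3"
    using F_equi[OF u(2) p, of "e/3" 1] e by (metis divide_pos_pos order_refl zero_less_numeral zero_le_one)
  obtain C where C: "0 \<le> C" "\<And>h k. h \<in> {0..1} \<Longrightarrow> real k * h \<le> 1 \<Longrightarrow> norm ((F h ^^ k) (u i) - u i) \<le> C * (real k * h)"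
    using F_pow_lip[OF u(1), of 1] by (metis zero_le_one)
  obtain b where b: "0 < b" "\<And>x. p x \<le> b * norm x" using seminorm_le_norm[OF p] by blast
  define d where "d = min 1 (e / (3 * (b * C + 1)))"
  have bC: "0 < b * C + 1" using b(1) C(1) by (simp add: add_nonneg_pos)
  have d: "0 < d" "d \<le> 1" unfolding d_def using e bC by auto
  have "b * C * d \<le> (b * C + 1) * (e / (3 * (b * C + 1)))"
    unfolding d_def using b(1) C(1) e bC by (intro mult_mono) auto
  also have "\<dots> = e / 3" using bC by (simp add: field_simps)
  finally have bCd: "b * C * d \<le> e / 3" .
  have "p ((F h ^^ k) x - x) < e" if h: "0 \<le> h" "h \<le> 1" and k: "real k * h \<le> d" for h k
  proof -
    have k1: "real k * h \<le> 1" using k d by linarith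
    have "(F h ^^ k) x - x = ((F h ^^ k) (u i) - u i) + ((u i - x) - (F h ^^ k) (u i - x))"
      using h by (simp add: F_pow_simps)
    hence "p ((F h ^^ k) x - x) \<le> p ((F h ^^ k) (u i) - u i) + p ((u i - x) - (F h ^^ k) (u i - x))"
      using p_tri[OF p] by metis
    moreover have "p ((u i - x) - (F h ^^ k) (u i - x)) \<le> p (u i - x) + p ((F h ^^ k) (u i - x))"
      by (rule seminorm_diff_le[OF sn[OF p]])
    moreover have "p ((F h ^^ k) (u i) - u i) \<le> b * C * d"
    proof -
      have "p ((F h ^^ k) (u i) - u i) \<le> b * (C * (real k * h))"
        using order_trans[OF b(2) mult_left_mono[OF C(2)[OF _ k1]]] b(1) h by simp
      also have "\<dots> \<le> b * (C * d)" using b(1) C(1) k by (intro mult_left_mono) auto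
      finally show ?thesis by (simp add: mult.assoc)
    qed
    moreover have "p (u i - x) < e / 3" using i[of 0 0] by simp
    ultimately show ?thesis using i[OF h(1) k1] bCd by linarith
  qed
  thus ?thesis using d(1) by blast
qed

lemma S_small:
  assumes p: "p \<in> P" and e: "0 < e"
  shows "\<exists>d>0. \<forall>t\<in>{0..d}. p (S t x - x) < e"
proof -
  obtain d where d: "0 < d" "\<And>h k. 0 \<le> h \<Longrightarrow> h \<le> 1 \<Longrightarrow> real k * h \<le> d \<Longrightarrow> p ((F h ^^ k) x - x) < e / 2"
    using F_pow_small[OF p half_gt_zero[OF e], of x] by blast
  have "p (S t x - x) \<le> e / 2" if t: "t \<in> {0..d}" for t
  proof (rule p_lim_le[OF p, of "\<lambda>n. Sn n t x - x" _ "\<lambda>_. e/2"])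
    show "(\<lambda>n. p (Sn n t x - x - (S t x - x))) \<longlonglongrightarrow> 0" using S_lim_p[OF _ p, of t x] t by simp
    have "p (Sn n t x - x) \<le> e / 2" for n
      unfolding Sn_def using d(2)[OF _ _ grid_node_le[OF t], of n] by (simp add: power_le_one less_imp_le)
    thus "\<exists>N. \<forall>n\<ge>N. p (Sn n t x - x) \<le> e / 2" by blast
  qed simp
  thus ?thesis using d(1) by (blast intro: less_of_le_half[OF e])
qed

lemma F_pow_bnull:
  assumes u: "bnull P u" and hk: "\<And>n. 0 \<le> h n" "\<And>n. real (k n) * h n \<le> t" and t: "0 \<le> t"
  shows "bnull P (\<lambda>n. (F (h n) ^^ k n) (u n))"
proof -
  obtain a where a: "\<And>n. norm (u n) \<le> a" using bnull_bounded[OF u] by blast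
  have "norm ((F (h n) ^^ k n) (u n)) \<le> M / (1 - K) * exp (w * t) * a" for n
    using order_trans[OF F_pow_bound[OF hk] mult_left_mono[OF a[of n]]] M_pos K_less by simp
  moreover have "(\<lambda>n. p ((F (h n) ^^ k n) (u n))) \<longlonglongrightarrow> 0" if p: "p \<in> P" for p
    unfolding p_tendsto_0_eps[OF p] eventually_sequentially
    using F_equi[OF u p _ t] hk by meson
  ultimately show ?thesis unfolding bnull_def by (auto intro: BseqI')
qed

lemma S_add:
  assumes t: "0 \<le> t" and s: "0 \<le> s"
  shows "S (t + s) x = S t (S s x)"
proof (rule bnull_lim_unique[OF S_lim])
  define h where "h n = (1/2::real) ^ n" for n
  \<comment> \<open>Rounding makes \<open>grid n (t + s)\<close> exceed \<open>grid n t + grid n s\<close> by at most one step, counted by \<open>i\<close>.\<close>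
  define i where "i n = grid n (t + s) - (grid n t + grid n s)" for n
  have h: "0 \<le> h n" "h n \<le> 1" for n unfolding h_def by (auto simp: power_le_one)
  have i: "grid n (t + s) = grid n t + grid n s + i n" "i n \<le> 1" for n
    using grid_add[OF t s, of n] unfolding i_def by auto
  have bd: "real (grid n t + i n) * h n \<le> t + 1" for n
  proof -
    have "real (i n) * h n \<le> 1 * 1" using i(2)[of n] h[of n] by (intro mult_mono) auto
    thus ?thesis using grid_le[OF t, of n] unfolding h_def by (simp add: distrib_right)
  qed
  let ?z = "S s x"
  have 1: "bnull P (\<lambda>n. (F (h n) ^^ (grid n t + i n)) (Sn n s x - ?z))"
    by (rule F_pow_bnull[OF S_lim[OF s] h(1) bd]) (use t in simp)
  have "bnull P (\<lambda>n. (F (h n) ^^ i n) ?z - ?z)"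
  proof -
    have bd1: "real (i n) * h n \<le> 1" for n
    proof -
      have "real (i n) * h n \<le> 1 * 1" using i(2)[of n] h[of n] by (intro mult_mono) auto
      thus ?thesis by simp
    qed
    have "norm ((F (h n) ^^ i n) ?z) \<le> M / (1 - K) * exp (w * 1) * norm ?z" for n
      by (rule F_pow_bound[OF h(1) bd1])
    hence "Bseq (\<lambda>n. (F (h n) ^^ i n) ?z - ?z)" by (intro Bseq_minus_const BseqI')
    moreover have "(\<lambda>n. p ((F (h n) ^^ i n) ?z - ?z)) \<longlonglongrightarrow> 0" if p: "p \<in> P" for p
      unfolding p_tendsto_0_eps[OF p]
    proof safe
      fix e :: real assume "0 < e"
      then obtain d where d: "0 < d" "\<And>h k. 0 \<le> h \<Longrightarrow> h \<le> 1 \<Longrightarrow> real k * h \<le> d \<Longrightarrow> p ((F h ^^ k) ?z - ?z) < e"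
        using F_pow_small[OF p, of e ?z] by blast
      have "\<forall>\<^sub>F n in sequentially. h n < d" unfolding h_def by (rule order_tendstoD(2)[OF half_power_tendsto d(1)])
      thus "\<forall>\<^sub>F n in sequentially. p ((F (h n) ^^ i n) ?z - ?z) < e"
      proof eventually_elim
        case (elim n)
        have "real (i n) * h n \<le> 1 * h n" using i(2)[of n] h[of n] by (intro mult_right_mono) auto
        thus ?case using d(2)[OF h] elim by simp
      qed
    qed
    ultimately show ?thesis unfolding bnull_def by blast
  qed
  hence 2: "bnull P (\<lambda>n. (F (h n) ^^ grid n t) ((F (h n) ^^ i n) ?z - ?z))"
    by (rule F_pow_bnull[OF _ h(1) _ t]) (use grid_le[OF t] in \<open>simp add: h_def\<close>)
  have eq: "(F (h n) ^^ (grid n t + i n)) (Sn n s x - ?z) + (F (h n) ^^ grid n t) ((F (h n) ^^ i n) ?z - ?z) =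
      Sn n (t + s) x - Sn n t ?z" for n
  proof -
    have "grid n (t + s) = (grid n t + i n) + grid n s" using i(1)[of n] by simp
    hence "Sn n (t + s) x = (F (h n) ^^ (grid n t + i n)) (Sn n s x)"
      unfolding Sn_def h_def by (simp only: funpow_add o_apply)
    thus ?thesis using h(1)[of n] by (simp add: F_pow_simps funpow_add Sn_def[of n t] h_def)
  qed
  show "bnull P (\<lambda>n. Sn n (t + s) x - S t (S s x))"
    using bnull_trans[OF bnull_add[OF 1 2, unfolded eq] S_lim[OF t]] .
qed (use t s in simp)

sublocale S: bi_semigroup P S "M / (1 - K)" w
proof (rule bi_semigroup.intro[OF bi_seq_axioms bi_semigroup_axioms.intro])
  show "S 0 x = x" for x
    by (rule bnull_lim_unique[OF S_lim]) (simp_all add: Sn_def bnull_norm)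
  show "((\<lambda>t. p (S t x - x)) \<longlongrightarrow> 0) (at_right 0)" if p: "p \<in> P" for p x
    unfolding p_tendsto_0_eps[OF p] eventually_at_right_field
  proof (intro allI impI)
    fix e :: real assume "0 < e"
    then obtain d where "0 < d" "\<And>t. t \<in> {0..d} \<Longrightarrow> p (S t x - x) < e" using S_small[OF p, of e x] by blast
    thus "\<exists>b>0. \<forall>y>0. y < b \<longrightarrow> p (S y x - x) < e" by (intro exI[of _ d]) auto
  qed
qed (use S_lin S_add S_bound S_equi M_pos w_nonneg K_less in auto)

subsection \<open>The generator of the perturbed semigroup\<close>

text \<open>
  \<open>Sn n t x - x\<close> is the sum of the vectors \<open>h F\<^sup>j (y + z)\<close>, where \<open>y\<close> is the value of the generator at
  \<open>x\<close> and \<open>z\<close> is a bounded null sequence; for small \<open>t\<close> the vectors \<open>F\<^sup>j y\<close> stay close to \<open>y\<close>.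
\<close>

lemma G_subset_gen_S:
  assumes xy: "(x, y) \<in> G"
  shows "(x, y) \<in> gen P S"
proof -
  have x: "x \<in> Domain G" using xy by blast
  obtain C where C: "0 \<le> C" "\<And>h k. h \<in> {0..1} \<Longrightarrow> real k * h \<le> 1 \<Longrightarrow> norm ((F h ^^ k) x - x) \<le> C * (real k * h)"
    using F_pow_lip[OF x, of 1] by (metis zero_le_one)
  show ?thesis
    unfolding gen_iff
  proof (intro conjI ballI exI)
    fix t :: real assume t: "t \<in> {0<..1}"
    show "norm (S t x - x) \<le> C * t"
    proof (rule norm_lsc[of "\<lambda>n. Sn n t x - x"])
      show "(\<lambda>n. p (Sn n t x - x - (S t x - x))) \<longlonglongrightarrow> 0" if "p \<in> P" for p using S_lim_p[OF _ that, of t x] t by simp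
      show "norm (Sn n t x - x) \<le> C * t" for n
      proof -
        have "norm (Sn n t x - x) \<le> C * (real (grid n t) * (1/2) ^ n)"
          unfolding Sn_def using t by (intro C(2) grid_node_le) (auto simp: power_le_one)
        also have "\<dots> \<le> C * t" using C(1) t by (intro mult_left_mono grid_le) auto
        finally show ?thesis .
      qed
    qed
  next
    fix p assume p: "p \<in> P"
    define h where "h n = (1/2::real) ^ n" for n
    have h: "0 < h n" "0 \<le> h n" "h n \<le> 1" "h \<longlonglongrightarrow> 0" for n
      unfolding h_def using half_power_tendsto by (auto simp: power_le_one)
    define z where "z n = (F (h n) x - x) /\<^sub>R h n - y" for n
    have z: "bnull P z"
      unfolding z_def using gen_quotient_seq[OF _ h(1,3,4), of "x - N x" y] xy h(2)
      by (simp add: F_minus_id G_def)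
    have tele: "(F (h n) ^^ k) x - x = h n *\<^sub>R (\<Sum>j<k. (F (h n) ^^ j) (y + z n))" for k n
    proof (induction k)
      case (Suc k)
      have "F (h n) x = x + h n *\<^sub>R (y + z n)" using h(1)[of n] unfolding z_def by simp
      hence "(F (h n) ^^ Suc k) x = (F (h n) ^^ k) x + h n *\<^sub>R (F (h n) ^^ k) (y + z n)"
        using h(2)[of n] by (simp only: funpow_Suc_right o_apply F_pow_simps)
      thus ?case using Suc by (simp add: algebra_simps)
    qed simp
    have main: "\<exists>d>0. \<forall>t\<in>{0<..d}. p (S t x - x - t *\<^sub>R y) \<le> t * e" if e: "0 < e" for e
    proof -
      obtain d where d: "0 < d" "\<And>h k. 0 \<le> h \<Longrightarrow> h \<le> 1 \<Longrightarrow> real k * h \<le> d \<Longrightarrow> p ((F h ^^ k) y - y) < e / 2"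
        using F_pow_small[OF p half_gt_zero[OF e], of y] by blast
      have "p (S t x - x - t *\<^sub>R y) \<le> t * e" if t: "t \<in> {0<..d}" for t
      proof -
        have t0: "0 \<le> t" using t by simp
        obtain n0 where n0: "\<And>n h k. n \<ge> n0 \<Longrightarrow> 0 \<le> h \<Longrightarrow> real k * h \<le> t \<Longrightarrow> p ((F h ^^ k) (z n)) < e / 2"
          using F_equi[OF z p half_gt_zero[OF e] t0] by meson
        have "p (Sn n t x - x - t *\<^sub>R y) \<le> t * e + (1/2) ^ n * p y" if n: "n \<ge> n0" for n
        proof -
          let ?k = "grid n t"
          have nd: "real j * h n \<le> t" if "j < ?k" for j
            using node_in[OF t0, of j n] that unfolding h_def by simp
          have eq: "Sn n t x - x - t *\<^sub>R y = (1/2) ^ n *\<^sub>R (\<Sum>j<?k. ((F (h n) ^^ j) y - y) + (F (h n) ^^ j) (z n)) + (real ?k * (1/2) ^ n - t) *\<^sub>R y"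
            unfolding Sn_def h_def[symmetric] tele using h(2)[of n]
            by (simp add: F_pow_simps sum.distrib sum_subtractf sum_constant_scaleR algebra_simps)
          have "p ((1/2) ^ n *\<^sub>R (\<Sum>j<?k. ((F (h n) ^^ j) y - y) + (F (h n) ^^ j) (z n))) \<le> t * e"
          proof (rule seminorm_grid_sum_le[OF sn[OF p] t0])
            fix j assume j: "j < ?k"
            have "p ((F (h n) ^^ j) y - y) < e / 2" using nd[OF j] t h(2,3)[of n] by (intro d(2)) auto
            moreover have "p ((F (h n) ^^ j) (z n)) < e / 2" by (rule n0[OF n h(2) nd[OF j]])
            ultimately show "p (((F (h n) ^^ j) y - y) + (F (h n) ^^ j) (z n)) \<le> e"
              using p_tri[OF p, of "(F (h n) ^^ j) y - y" "(F (h n) ^^ j) (z n)"] by linarith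
          qed (use e in simp)
          moreover have "p ((real ?k * (1/2) ^ n - t) *\<^sub>R y) \<le> (1/2) ^ n * p y"
            using grid_gap[OF t0, of n] p_nonneg[OF p, of y] by (simp add: p_scale[OF p] mult_right_mono)
          ultimately show ?thesis
            unfolding eq using p_tri[OF p, of "(1/2) ^ n *\<^sub>R (\<Sum>j<?k. ((F (h n) ^^ j) y - y) + (F (h n) ^^ j) (z n))" "(real ?k * (1/2) ^ n - t) *\<^sub>R y"]
            by linarith
        qed
        hence ev: "\<exists>N. \<forall>n\<ge>N. p (Sn n t x - x - t *\<^sub>R y) \<le> t * e + (1/2) ^ n * p y" by blast
        show ?thesis
        proof (rule p_lim_le[OF p _ ev remainder_tendsto])
          show "(\<lambda>n. p (Sn n t x - x - t *\<^sub>R y - (S t x - x - t *\<^sub>R y))) \<longlonglongrightarrow> 0" using S_lim_p[OF t0 p, of x] by simp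
        qed
      qed
      thus ?thesis using d(1) by blast
    qed
    show "((\<lambda>t. p ((S t x - x) /\<^sub>R t - y)) \<longlongrightarrow> 0) (at_right 0)"
      unfolding p_tendsto_0_eps[OF p] eventually_at_right_field
    proof (intro allI impI)
      fix e :: real assume e: "0 < e"
      then obtain d where d: "0 < d" "\<And>t. t \<in> {0<..d} \<Longrightarrow> p (S t x - x - t *\<^sub>R y) \<le> t * (e / 2)"
        using main[OF half_gt_zero[OF e]] by blast
      have "p ((S t x - x) /\<^sub>R t - y) < e" if t: "0 < t" "t < d" for t
      proof -
        have "(S t x - x) /\<^sub>R t - y = inverse t *\<^sub>R (S t x - x - t *\<^sub>R y)" using t by (simp add: scaleR_diff_right)
        hence "p ((S t x - x) /\<^sub>R t - y) = inverse t * p (S t x - x - t *\<^sub>R y)" using t by (simp add: p_scale[OF p])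
        also have "\<dots> \<le> inverse t * (t * (e / 2))" using d(2)[of t] t by (intro mult_left_mono) auto
        also have "\<dots> < e" using t e by simp
        finally show ?thesis .
      qed
      thus "\<exists>b>0. \<forall>t>0. t < b \<longrightarrow> p ((S t x - x) /\<^sub>R t - y) < e" using d(1) by blast
    qed
  qed
qed

text \<open>
  Compare the scheme started at \<open>x\<close> with \<open>U t (x - N x) + N x\<close>, the solution whose argument is frozen at
  \<open>x\<close> for all times. The difference \<open>e\<close> is driven by the deviation of the scheme from \<open>x\<close>, which
  vanishes in the limit.
\<close>

lemma S_fixed:
  assumes fixd: "\<And>t. 0 \<le> t \<Longrightarrow> S t x = x" and t: "0 \<le> t"
  shows "U t (x - N x) = x - N x"
proof -
  define h where "h n = (1/2::real) ^ n" for n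
  have h: "0 \<le> h n" for n unfolding h_def by simp
  define e where "e n j = (F (h n) ^^ j) x - (U (real j * h n) (x - N x) + N x)" for n j
  define W where "W n = msup (\<lambda>j. (F (h n) ^^ j) x - x) (grid n t)" for n
  have dom: "\<bar>e n (grid n t)\<bar> \<le> N (W n)" for n
  proof -
    have "\<bar>e n (grid n t) - U (real (grid n t) * h n) (e n 0)\<bar> \<le> N (W n)"
    proof (rule discrete_volterra[OF h])
      show "0 \<le> W n" unfolding W_def by simp
      fix j assume j: "j < grid n t"
      have "U (real (Suc j) * h n) a = U (h n) (U (real j * h n) a)" for a
        using h[of n] T_add[of "h n" "real j * h n" a] by (simp add: distrib_right)
      hence "e n (Suc j) - U (h n) (e n j) = D (h n) ((F (h n) ^^ j) x - x)"
        unfolding e_def using h[of n] by (simp add: F_def[of _ "(F (h n) ^^ j) x"] D_def T_plus T_minus N_simps)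
      moreover have "\<bar>(F (h n) ^^ j) x - x\<bar> \<le> W n" unfolding W_def using msup_ge[of j "grid n t" "\<lambda>j. (F (h n) ^^ j) x - x"] j by simp
      ultimately show "\<bar>e n (Suc j) - U (h n) (e n j)\<bar> \<le> D (h n) (W n)" using D_abs[OF h] by simp
    qed
    moreover have "e n 0 = 0" by (simp add: e_def)
    ultimately show ?thesis using h[of n] by (simp add: T_zero)
  qed
  have node: "Sn n (real j * h n) x = (F (h n) ^^ j) x" for n j
    by (simp add: Sn_def h_def grid_def power_one_over)
  have "bnull P W"
  proof -
    have "norm (W n) \<le> M / (1 - K) * exp (w * t) * norm x + norm x" for n
      unfolding W_def
    proof (rule msup_norm_le)
      fix j assume "j \<le> grid n t"
      hence "real j * h n \<le> t" using node_in[OF t] unfolding h_def by simp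
      thus "norm ((F (h n) ^^ j) x - x) \<le> M / (1 - K) * exp (w * t) * norm x + norm x"
        using F_pow_bound[OF h, of j n t x] norm_triangle_ineq4[of "(F (h n) ^^ j) x" x] by linarith
    qed
    moreover have "\<forall>\<^sub>F n in sequentially. p (W n) < \<epsilon>" if p: "p \<in> P" and \<epsilon>: "0 < \<epsilon>" for p and \<epsilon> :: real
    proof -
      obtain n0 where n0: "\<And>n s. n \<ge> n0 \<Longrightarrow> s \<in> {0..t} \<Longrightarrow> p (Sn n s x - S s x) \<le> \<epsilon> / 2"
        using S_unif[OF p half_gt_zero[OF \<epsilon>] t] by blast
      have "p (W n) \<le> \<epsilon> / 2" if n: "n \<ge> n0" for n
        unfolding W_def
      proof (rule msup_p_le[OF p])
        fix j assume "j \<le> grid n t"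
        hence "real j * h n \<in> {0..t}" using node_in[OF t] unfolding h_def by simp
        thus "p ((F (h n) ^^ j) x - x) \<le> \<epsilon> / 2" using n0[OF n] fixd node by fastforce
      qed
      thus "\<forall>\<^sub>F n in sequentially. p (W n) < \<epsilon>"
        unfolding eventually_sequentially by (blast intro: less_of_le_half[OF \<epsilon>])
    qed
    ultimately show ?thesis by (rule bnullI)
  qed
  hence NW: "bnull P (\<lambda>n. N (W n))" by (rule N_bnull)
  have Ulim: "bnull P (\<lambda>n. U (real (grid n t) * h n) (x - N x) - U t (x - N x))"
    unfolding h_def by (rule T_tendsto_seq[OF _ grid_tendsto[OF t] t]) simp
  have "x - (U t (x - N x) + N x) = 0"
  proof (rule tends_unique[of "\<lambda>n. e n (grid n t)" _ sequentially])
    fix p assume p: "p \<in> P"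
    show "(\<lambda>n. p (e n (grid n t) - 0)) \<longlonglongrightarrow> 0" using p_bnull_dom[OF NW dom p] by simp
    have "(\<lambda>n. p ((Sn n t x - (U (real (grid n t) * h n) (x - N x))) - (S t x - (U t (x - N x))))) \<longlonglongrightarrow> 0"
      by (rule tends_diff[OF p S_lim_p[OF t p] bnullD[OF Ulim p]])
    thus "(\<lambda>n. p (e n (grid n t) - (x - (U t (x - N x) + N x)))) \<longlonglongrightarrow> 0"
      unfolding e_def Sn_def h_def fixd[OF t] by (simp add: algebra_simps)
  qed simp
  thus ?thesis by (simp add: algebra_simps)
qed

text \<open>
  \<open>G\<close> is onto, so it suffices that the generator of \<open>S\<close> is injective.
\<close>

lemma gen_S_eq_G: "gen P S = G"
proof (intro equalityI subrelI)
  fix x y assume xy: "(x, y) \<in> gen P S"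
  define x' where "x' = Ninv (R (- y))"
  have x': "(x', y) \<in> G" unfolding G_def x'_def using R by (simp add: Ninv_eq is_resolvent_def)
  have "(x - x', y - y) \<in> gen P S" by (rule S.gen_diff[OF xy G_subset_gen_S[OF x']])
  hence "S t (x - x') = x - x'" if "0 \<le> t" for t using S.gen_zero_fixed[OF _ that] by simp
  hence "U t ((x - x') - N (x - x')) = (x - x') - N (x - x')" if "0 \<le> t" for t using S_fixed that by blast
  hence "((x - x') - N (x - x'), 0) \<in> gen P U" by (rule T_fixed_gen)
  hence "(x - x') - N (x - x') = 0"
    using R linear_0[OF is_resolvent_lin[OF R]] by (simp add: is_resolvent_def)
  hence "x - x' = 0" using Ninv_inverse[of "x - x'"] linear_0[OF Ninv_lin] by simp
  thus "(x, y) \<in> G" using x' by simp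
qed (rule G_subset_gen_S)

end

section \<open>Rescaling\<close>

definition rescale :: "real \<Rightarrow> (real \<Rightarrow> 'v \<Rightarrow> 'v) \<Rightarrow> real \<Rightarrow> 'v \<Rightarrow> 'v::real_vector" where
  "rescale c T t x = exp (c * t) *\<^sub>R T t x"

lemma rescale_rescale: "rescale (- c) (rescale c T) = T"
  by (intro ext) (simp add: rescale_def flip: exp_add)

lemma abs_exp_minus_one_le: "\<bar>exp u - 1\<bar> \<le> \<bar>u\<bar> * exp \<bar>u::real\<bar>"
proof (cases "0 \<le> u")
  case True
  have "1 - u \<le> exp (- u)" using exp_ge_add_one_self[of "- u"] by simp
  hence "(1 - u) * exp u \<le> exp (- u) * exp u" by (intro mult_right_mono) auto
  hence "exp u - 1 \<le> u * exp u" by (simp add: algebra_simps flip: exp_add)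
  thus ?thesis using True by simp
next
  case False
  have "1 + u \<le> exp u" by (rule exp_ge_add_one_self)
  moreover have "\<bar>u\<bar> * 1 \<le> \<bar>u\<bar> * exp \<bar>u\<bar>" by (intro mult_left_mono) auto
  moreover have "\<bar>exp u - 1\<bar> = 1 - exp u" using False by simp
  ultimately show ?thesis using False by linarith
qed

context bi_semigroup
begin

lemma bi_semigroup_rescale: "bi_semigroup P (rescale c T) M (w + \<bar>c\<bar>)"
proof (rule bi_semigroup.intro[OF bi_seq_axioms bi_semigroup_axioms.intro])
  show "linear (rescale c T t)" if "0 \<le> t" for t
    using that by (intro linearI) (simp_all add: rescale_def T_plus T_scaleR scaleR_add_right mult.commute)
  show "rescale c T (t + s) x = rescale c T t (rescale c T s x)" if "0 \<le> t" "0 \<le> s" for t s x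
    using that by (simp add: rescale_def T_add T_scaleR distrib_left exp_add)
  show "norm (rescale c T t x) \<le> M * exp ((w + \<bar>c\<bar>) * t) * norm x" if t: "0 \<le> t" for t x
  proof -
    have "exp (c * t) * norm (T t x) \<le> exp (\<bar>c\<bar> * t) * (M * exp (w * t) * norm x)"
      using t T_bound[OF t, of x] by (intro mult_mono) (auto intro: mult_right_mono)
    thus ?thesis by (simp add: rescale_def distrib_right exp_add algebra_simps)
  qed
  show "((\<lambda>t. p (rescale c T t x - x)) \<longlongrightarrow> 0) (at_right 0)" if p: "p \<in> P" for p x
  proof (rule p_tendsto_0I[OF p])
    show "p (rescale c T t x - x) \<le> exp (c * t) * p (T t x - x) + \<bar>exp (c * t) - 1\<bar> * p x" for t
    proof -
      have "rescale c T t x - x = exp (c * t) *\<^sub>R (T t x - x) + (exp (c * t) - 1) *\<^sub>R x"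
        by (simp add: rescale_def algebra_simps)
      thus ?thesis using p_tri[OF p, of "exp (c * t) *\<^sub>R (T t x - x)" "(exp (c * t) - 1) *\<^sub>R x"]
        by (simp add: p_scale[OF p])
    qed
    have "((\<lambda>t. exp (c * t) * p (T t x - x) + \<bar>exp (c * t) - 1\<bar> * p x) \<longlongrightarrow> exp (c * 0) * 0 + \<bar>exp (c * 0) - 1\<bar> * p x) (at_right 0)"
      by (intro tendsto_intros T_cont0[OF p])
    thus "((\<lambda>t. exp (c * t) * p (T t x - x) + \<bar>exp (c * t) - 1\<bar> * p x) \<longlongrightarrow> 0) (at_right 0)" by simp
  qed
  show "\<exists>n0. \<forall>n\<ge>n0. \<forall>s\<in>{0..t0}. p (rescale c T s (u n)) < e" if u: "bnull P u" and p: "p \<in> P" and e: "0 < e" for u p e t0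
  proof -
    define b where "b = exp (\<bar>c\<bar> * \<bar>t0\<bar>)"
    have b: "0 < b" unfolding b_def by simp
    obtain n0 where n0: "\<And>n s. n \<ge> n0 \<Longrightarrow> s \<in> {0..t0} \<Longrightarrow> p (T s (u n)) < e / b"
      using T_equi[OF u p divide_pos_pos[OF e b], of t0] by blast
    have "p (rescale c T s (u n)) < e" if "n \<ge> n0" "s \<in> {0..t0}" for n s
    proof -
      have "c * s \<le> \<bar>c\<bar> * \<bar>t0\<bar>" using that(2) by (intro mult_mono) auto
      hence "exp (c * s) * p (T s (u n)) \<le> b * p (T s (u n))" unfolding b_def using p_nonneg[OF p] by (intro mult_right_mono) auto
      also have "\<dots> < e" using n0[OF that] b by (simp add: field_simps)
      finally show ?thesis by (simp add: rescale_def p_scale[OF p])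
    qed
    thus ?thesis by blast
  qed
qed (auto simp: rescale_def M_pos w_nonneg)

lemma gen_rescaleI:
  assumes xy: "(x, y) \<in> gen P T"
  shows "(x, y + c *\<^sub>R x) \<in> gen P (rescale c T)"
proof -
  obtain C where C: "\<And>t. t \<in> {0<..1} \<Longrightarrow> norm (T t x - x) \<le> C * t" using xy unfolding gen_iff by blast
  have split: "rescale c T t x - x = exp (c * t) *\<^sub>R (T t x - x) + (exp (c * t) - 1) *\<^sub>R x" for t
    by (simp add: rescale_def algebra_simps)
  show ?thesis
    unfolding gen_iff
  proof (intro conjI exI ballI)
    fix t :: real assume t: "t \<in> {0<..1}"
    let ?b = "exp \<bar>c\<bar>"
    have ct: "\<bar>c * t\<bar> \<le> \<bar>c\<bar>" using t by (simp add: abs_mult mult_left_le)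
    have "norm (rescale c T t x - x) \<le> exp (c * t) * norm (T t x - x) + \<bar>exp (c * t) - 1\<bar> * norm x"
      unfolding split using norm_triangle_ineq[of "exp (c * t) *\<^sub>R (T t x - x)" "(exp (c * t) - 1) *\<^sub>R x"] by simp
    also have "\<dots> \<le> ?b * (C * t) + (\<bar>c\<bar> * t * ?b) * norm x"
    proof (intro add_mono mult_mono)
      show "exp (c * t) \<le> ?b" using ct by simp
      have "\<bar>exp (c * t) - 1\<bar> \<le> \<bar>c * t\<bar> * exp \<bar>c * t\<bar>" by (rule abs_exp_minus_one_le)
      also have "\<dots> \<le> \<bar>c * t\<bar> * ?b" using ct by (intro mult_left_mono) auto
      finally show "\<bar>exp (c * t) - 1\<bar> \<le> \<bar>c\<bar> * t * ?b" using t by (simp add: abs_mult)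
    qed (use C[OF t] t in auto)
    finally show "norm (rescale c T t x - x) \<le> (?b * C + \<bar>c\<bar> * ?b * norm x) * t" by (simp add: algebra_simps)
  next
    fix p assume p: "p \<in> P"
    have lim1: "((\<lambda>t. p ((T t x - x) /\<^sub>R t - y)) \<longlongrightarrow> 0) (at_right 0)" using xy p unfolding gen_iff by blast
    have "((\<lambda>t. exp (c * t)) has_real_derivative c) (at 0)" by (auto intro!: derivative_eq_intros)
    hence "((\<lambda>t. (exp (c * t) - 1) / t) \<longlongrightarrow> c) (at 0)" by (simp add: has_field_derivative_iff)
    hence lim2: "((\<lambda>t. (exp (c * t) - 1) / t) \<longlongrightarrow> c) (at_right 0)" by (rule tendsto_within_subset) simp
    show "((\<lambda>t. p ((rescale c T t x - x) /\<^sub>R t - (y + c *\<^sub>R x))) \<longlongrightarrow> 0) (at_right 0)"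
    proof (rule p_tendsto_0I[OF p])
      show "p ((rescale c T t x - x) /\<^sub>R t - (y + c *\<^sub>R x)) \<le> exp (c * t) * p ((T t x - x) /\<^sub>R t - y)
          + \<bar>exp (c * t) - 1\<bar> * p y + \<bar>(exp (c * t) - 1) / t - c\<bar> * p x" for t
      proof -
        have "(rescale c T t x - x) /\<^sub>R t - (y + c *\<^sub>R x) =
            exp (c * t) *\<^sub>R ((T t x - x) /\<^sub>R t - y) + (exp (c * t) - 1) *\<^sub>R y + ((exp (c * t) - 1) / t - c) *\<^sub>R x"
          unfolding split by (simp add: algebra_simps divide_inverse)
        moreover have "p (u + v + z) \<le> p u + p v + p z" for u v z
          using p_tri[OF p, of "u + v" z] p_tri[OF p, of u v] by linarith
        ultimately show ?thesis by (metis (no_types, lifting) p_scale[OF p] abs_exp_cancel)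
      qed
      have "((\<lambda>t. exp (c * t) * p ((T t x - x) /\<^sub>R t - y) + \<bar>exp (c * t) - 1\<bar> * p y + \<bar>(exp (c * t) - 1) / t - c\<bar> * p x)
          \<longlongrightarrow> exp (c * 0) * 0 + \<bar>exp (c * 0) - 1\<bar> * p y + \<bar>c - c\<bar> * p x) (at_right 0)"
        by (intro tendsto_intros lim1 lim2)
      thus "((\<lambda>t. exp (c * t) * p ((T t x - x) /\<^sub>R t - y) + \<bar>exp (c * t) - 1\<bar> * p y + \<bar>(exp (c * t) - 1) / t - c\<bar> * p x) \<longlongrightarrow> 0) (at_right 0)" by simp
    qed
  qed
qed

lemma gen_rescale: "(x, y) \<in> gen P (rescale c T) \<longleftrightarrow> (x, y - c *\<^sub>R x) \<in> gen P T"
proof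
  interpret E: bi_semigroup P "rescale c T" M "w + \<bar>c\<bar>" by (rule bi_semigroup_rescale)
  assume "(x, y) \<in> gen P (rescale c T)"
  from E.gen_rescaleI[OF this, of "- c"] show "(x, y - c *\<^sub>R x) \<in> gen P T" by (simp add: rescale_rescale)
next
  assume "(x, y - c *\<^sub>R x) \<in> gen P T"
  from gen_rescaleI[OF this, of c] show "(x, y) \<in> gen P (rescale c T)" by simp
qed

lemma is_resolvent_rescale:
  "is_resolvent lam (gen P T) R \<Longrightarrow> (x, y) \<in> gen P (rescale (- lam) T) \<longleftrightarrow> x = R (- y)"
  unfolding gen_rescale is_resolvent_def by simp

end

section \<open>Positivity of the resolvent\<close>

context positive_bi_semigroup
begin

lemma positive_rescale: "positive_bi_semigroup P (rescale c U) M (w + \<bar>c\<bar>)"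
proof (rule positive_bi_semigroup.intro[OF bi_semigroup_rescale positive_bi_semigroup_axioms.intro])
  show "0 \<le> rescale c U t x" if "0 \<le> t" "0 \<le> x" for t x
    using U_pos[OF that] by (simp add: rescale_def scaleR_nonneg_nonneg)
qed (rule solid)

lemma rescale_gen: "is_resolvent lam (gen P U) R \<Longrightarrow> (- R x, x) \<in> gen P (rescale (- lam) U)"
  by (simp add: is_resolvent_rescale linear_neg[OF is_resolvent_lin])

text \<open>
  The difference of the two sides is the limit of Riemann sums of the positive orbit of \<open>x\<close>.
\<close>

lemma resolvent_excessive:
  assumes R: "is_resolvent lam (gen P U) R" and t: "0 \<le> t" and x: "0 \<le> x"
  shows "rescale (- lam) U t (R x) \<le> R x"
proof -
  interpret E: positive_bi_semigroup P "rescale (- lam) U" M "w + \<bar>- lam\<bar>" by (rule positive_rescale)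
  have "0 \<le> E.riemann_sum n t x" for n
    unfolding E.riemann_sum_def using x by (intro scaleR_nonneg_nonneg sum_nonneg E.U_pos) auto
  hence "0 \<le> rescale (- lam) U t (- R x) - (- R x)" by (rule nonneg_lim[OF E.increment_lim[OF rescale_gen[OF R] t]])
  thus ?thesis using t by (simp add: E.T_neg)
qed

text \<open>
  \<open>R x\<close> is the sum of the positive vector from the previous lemma and of the rescaled semigroup applied
  to \<open>R x\<close>, which tends to \<open>0\<close> as \<open>t\<close> grows.
\<close>

lemma resolvent_pos_large:
  assumes R: "is_resolvent lam (gen P U) R" and lam: "w < lam" and x: "0 \<le> x"
  shows "0 \<le> R x"
proof (rule nonneg_of_norm_approx)
  fix e :: real assume e: "0 < e"
  interpret E: positive_bi_semigroup P "rescale (- lam) U" M "w + \<bar>- lam\<bar>" by (rule positive_rescale)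
  have "((\<lambda>t. M * exp ((w - lam) * t) * norm (R x)) \<longlongrightarrow> M * 0 * norm (R x)) at_top"
  proof (intro tendsto_mult tendsto_const filterlim_compose[OF exp_at_bot])
    show "LIM t at_top. (w - lam) * t :> at_bot"
      using lam by (intro filterlim_tendsto_neg_mult_at_bot[OF tendsto_const _ filterlim_ident]) simp
  qed
  hence "\<forall>\<^sub>F t in at_top. M * exp ((w - lam) * t) * norm (R x) < e" using e by (intro order_tendstoD(2)) auto
  then obtain t0 where "\<And>t. t \<ge> t0 \<Longrightarrow> M * exp ((w - lam) * t) * norm (R x) < e" unfolding eventually_at_top_linorder by blast
  then obtain t where t: "0 \<le> t" "M * exp ((w - lam) * t) * norm (R x) < e" by (metis max.cobounded1 max.cobounded2)
  have "norm (rescale (- lam) U t (R x)) \<le> exp (- lam * t) * (M * exp (w * t) * norm (R x))"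
    unfolding rescale_def using T_bound[OF t(1), of "R x"] by simp
  also have "\<dots> = M * exp ((w - lam) * t) * norm (R x)"
    by (simp add: left_diff_distrib exp_diff exp_minus field_simps)
  finally have "norm (rescale (- lam) U t (R x)) < e" using t(2) by linarith
  moreover have "0 \<le> R x - rescale (- lam) U t (R x)"
    using resolvent_excessive[OF R t(1) x] by simp
  ultimately show "\<exists>y\<ge>0. norm (R x - y) < e"
    by (intro exI[of _ "R x - rescale (- lam) U t (R x)"]) simp
qed

text \<open>
  Iterating the resolvent identity expands \<open>Ra\<close> in powers of \<open>(b - a) Rb\<close>, all of them positive; the
  smallness assumption makes the remainder vanish.
\<close>

lemma resolvent_pos_step:
  assumes Ra: "is_resolvent a (gen P U) Ra" and Rb: "is_resolvent b (gen P U) Rb"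
    and ab: "a \<le> b" and small: "\<And>x. (b - a) * norm (Rb x) \<le> norm x / 2"
    and pos: "\<And>x. 0 \<le> x \<Longrightarrow> 0 \<le> Rb x" and x: "0 \<le> x"
  shows "0 \<le> Ra x"
proof (rule nonneg_of_norm_approx)
  fix e :: real assume e: "0 < e"
  have lin: "linear Rb" by (rule is_resolvent_lin[OF Rb])
  define Q where "Q y = (b - a) *\<^sub>R Rb y" for y
  have Q: "norm (Q y) \<le> norm y / 2" for y unfolding Q_def using small[of y] ab by simp
  have Q_pos: "0 \<le> Q y" if "0 \<le> y" for y
    unfolding Q_def using ab pos[OF that] by (intro scaleR_nonneg_nonneg) auto
  have id: "Ra x = Rb x + Q (Ra x)" unfolding Q_def by (rule resolvent_identity[OF Ra Rb])
  have QN: "norm ((Q ^^ n) y) \<le> (1/2) ^ n * norm y" for n y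
  proof (induction n)
    case (Suc n) thus ?case using Q[of "(Q ^^ n) y"] by simp
  qed simp
  have Q0: "0 \<le> Ra x - (Q ^^ n) (Ra x)" for n
  proof (induction n)
    case (Suc n)
    have "Ra x - (Q ^^ Suc n) (Ra x) = Rb x + Q (Ra x - (Q ^^ n) (Ra x))"
      using id by (simp add: Q_def linear_diff[OF lin] scaleR_diff_right)
    thus ?case using Q_pos[OF Suc] pos[OF x] by (simp only: add_nonneg_nonneg)
  qed simp
  have "(\<lambda>n. (1/2) ^ n * norm (Ra x)) \<longlonglongrightarrow> 0 * norm (Ra x)" by (intro tendsto_mult half_power_tendsto tendsto_const)
  hence "\<forall>\<^sub>F n in sequentially. (1/2) ^ n * norm (Ra x) < e" using e by (intro order_tendstoD(2)) auto
  then obtain n where "(1/2) ^ n * norm (Ra x) < e" unfolding eventually_sequentially by blast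
  hence "norm ((Q ^^ n) (Ra x)) < e" using QN[of n "Ra x"] by linarith
  thus "\<exists>y\<ge>0. norm (Ra x - y) < e" using Q0[of n] by (intro exI[of _ "Ra x - (Q ^^ n) (Ra x)"]) simp
qed

text \<open>
  Positivity holds for large \<open>\<nu>\<close> and descends to \<open>lam\<close> by steps whose admissible length is
  locally bounded below; Bolzano's principle chains them.
\<close>

lemma resolvent_pos:
  assumes ex: "\<And>\<nu>. lam \<le> \<nu> \<Longrightarrow> \<exists>R. is_resolvent \<nu> (gen P U) R"
    and R: "is_resolvent lam (gen P U) R" and x: "0 \<le> x"
  shows "0 \<le> R x"
proof -
  define pos where "pos \<nu> \<longleftrightarrow> (\<forall>Q x. is_resolvent \<nu> (gen P U) Q \<longrightarrow> 0 \<le> x \<longrightarrow> 0 \<le> Q x)" for \<nu>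
  define \<mu> where "\<mu> = max lam (w + 1)"
  have le: "lam \<le> \<mu>" unfolding \<mu>_def by simp
  define descends where "descends a b \<longleftrightarrow> (lam \<le> a \<longrightarrow> pos b \<longrightarrow> pos a)" for a b
  have "descends lam \<mu>"
    using le
  proof (induction rule: Bolzano)
    case (trans a b c)
    thus ?case unfolding descends_def by auto
  next
    case (local \<nu>)
    obtain Q where Q: "is_resolvent \<nu> (gen P U) Q" using ex local by blast
    obtain c where c: "0 < c" "\<And>x. norm (Q x) \<le> norm x * c"
      using bounded_linear.pos_bounded[of Q] Q unfolding is_resolvent_def by blast
    show ?case unfolding descends_def
    proof (intro exI[of _ "1 / (4 * c)"] conjI allI impI)
      fix a b assume ab: "a \<le> \<nu> \<and> \<nu> \<le> b \<and> b - a < 1 / (4 * c)" and a: "lam \<le> a" and pb: "pos b"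
      obtain Ra Rb where Rab: "is_resolvent a (gen P U) Ra" "is_resolvent b (gen P U) Rb"
        using ex[OF a] ex[of b] ab a by (meson order_trans)
      have d: "(b - a) * c \<le> 1 / 4" using ab c(1) by (simp add: field_simps)
      have Rb: "norm (Rb x) \<le> 2 * (norm x * c)" for x
      proof -
        have "Rb x = Q x + (\<nu> - b) *\<^sub>R Q (Rb x)" by (rule resolvent_identity[OF Rab(2) Q])
        hence "norm (Rb x) \<le> norm (Q x) + norm ((\<nu> - b) *\<^sub>R Q (Rb x))" by (metis norm_triangle_ineq)
        moreover have "norm ((\<nu> - b) *\<^sub>R Q (Rb x)) \<le> (b - a) * (norm (Rb x) * c)"
          using ab c(2)[of "Rb x"] by (auto intro!: mult_mono)
        moreover have "(b - a) * (norm (Rb x) * c) = norm (Rb x) * ((b - a) * c)" by simp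
        moreover have "norm (Rb x) * ((b - a) * c) \<le> norm (Rb x) * (1 / 4)" using d by (intro mult_left_mono) auto
        moreover have "0 \<le> norm x * c" using c(1) by simp
        ultimately show ?thesis using c(2)[of x] norm_ge_zero[of "Rb x"] by linarith
      qed
      have "(b - a) * norm (Rb x) \<le> norm x / 2" for x
      proof -
        have "(b - a) * norm (Rb x) \<le> (b - a) * (2 * (norm x * c))" using Rb ab by (intro mult_left_mono) auto
        also have "\<dots> = 2 * norm x * ((b - a) * c)" by simp
        also have "\<dots> \<le> 2 * norm x * (1 / 4)" using d by (intro mult_left_mono) auto
        finally show ?thesis by simp
      qed
      hence small: "\<And>x. (b - a) * norm (Rb x) \<le> norm x / 2" .
      have "0 \<le> Ra x" if x: "0 \<le> x" for x
      proof (rule resolvent_pos_step[OF Rab _ small _ x])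
        show "a \<le> b" using ab by simp
        show "0 \<le> Rb y" if "0 \<le> y" for y using pb Rab(2) that unfolding pos_def by blast
      qed
      thus "pos a" using Rab(1) resolvent_eq unfolding pos_def by metis
    qed (use c in simp)
  qed
  moreover have "pos \<mu>" unfolding pos_def using resolvent_pos_large[of \<mu>] unfolding \<mu>_def by simp
  ultimately show ?thesis using R x unfolding pos_def descends_def by simp
qed

end

section \<open>Completions\<close>

lemma subspace_closure:
  fixes V :: "'v::real_normed_vector set"
  assumes "subspace V"
  shows "subspace (closure V)"
  unfolding subspace_def
proof (intro conjI ballI allI)
  show "0 \<in> closure V" using assms subspace_0 closure_subset by blast
next
  fix x y assume "x \<in> closure V" "y \<in> closure V"
  then obtain u v where "\<And>n. u n \<in> V" "u \<longlonglongrightarrow> x" "\<And>n. v n \<in> V" "v \<longlonglongrightarrow> y"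
    unfolding closure_sequential by blast
  hence "\<And>n. u n + v n \<in> V" "(\<lambda>n. u n + v n) \<longlonglongrightarrow> x + y"
    using assms by (auto intro: subspace_add tendsto_add)
  thus "x + y \<in> closure V" unfolding closure_sequential by (intro exI[of _ "\<lambda>n. u n + v n"]) simp
next
  fix c x assume "x \<in> closure V"
  then obtain u where "\<And>n. u n \<in> V" "u \<longlonglongrightarrow> x" unfolding closure_sequential by blast
  hence "\<And>n. c *\<^sub>R u n \<in> V" "(\<lambda>n. c *\<^sub>R u n) \<longlonglongrightarrow> c *\<^sub>R x"
    using assms by (auto intro: subspace_scale tendsto_intros)
  thus "c *\<^sub>R x \<in> closure V" unfolding closure_sequential by (intro exI[of _ "\<lambda>n. c *\<^sub>R u n"]) simp
qed

lemma dense_image_linear_eq: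
  fixes f g :: "'v::real_normed_vector \<Rightarrow> 'w::real_normed_vector"
  assumes "closure D = UNIV" "bounded_linear f" "bounded_linear g" "\<And>x. x \<in> D \<Longrightarrow> f x = g x"
  shows "f x = g x"
proof -
  have "x \<in> closure D" using assms(1) by simp
  moreover have "closed {x. f x = g x}"
    using assms(2,3) by (intro closed_Collect_eq) (auto intro: linear_continuous_on)
  hence "closure D \<subseteq> {x. f x = g x}" using assms(4) by (intro closure_minimal) auto
  ultimately show ?thesis by blast
qed

text \<open>
  The map is defined on the dense image of \<open>V\<close>, where it is isometric, and extended by uniform
  continuity. Its range is complete, hence closed.
\<close>

lemma completion_isometry:
  fixes V :: "'v::real_vector set" and j :: "'v \<Rightarrow> 'w::banach" and f :: "'v \<Rightarrow> 'u::banach"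
  assumes compl: "is_completion V nrm j" and V: "subspace V"
    and lin: "linear_on_subspace V f" and iso: "\<And>x. x \<in> V \<Longrightarrow> norm (f x) = nrm x"
  obtains L where "bounded_linear L" "\<And>z. norm (L z) = norm z" "\<And>x. x \<in> V \<Longrightarrow> L (j x) = f x"
    "range L = closure (f ` V)"
proof -
  have j: "\<And>x y. x \<in> V \<Longrightarrow> y \<in> V \<Longrightarrow> j (x + y) = j x + j y" "\<And>c x. x \<in> V \<Longrightarrow> j (c *\<^sub>R x) = c *\<^sub>R j x"
      "\<And>x. x \<in> V \<Longrightarrow> norm (j x) = nrm x" "closure (j ` V) = UNIV"
    using compl unfolding is_completion_def linear_on_subspace_def by blast+
  have f: "\<And>x y. x \<in> V \<Longrightarrow> y \<in> V \<Longrightarrow> f (x + y) = f x + f y" "\<And>c x. x \<in> V \<Longrightarrow> f (c *\<^sub>R x) = c *\<^sub>R f x"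
    using lin unfolding linear_on_subspace_def by blast+
  have diff: "x - y \<in> V" "j (x - y) = j x - j y" "f (x - y) = f x - f y" if "x \<in> V" "y \<in> V" for x y
  proof -
    have y: "- 1 *\<^sub>R y \<in> V" using subspace_scale[OF V that(2), of "-1"] by simp
    show "x - y \<in> V" using subspace_diff[OF V that] .
    show "j (x - y) = j x - j y" using j(1)[OF that(1) y] j(2)[OF that(2), of "-1"] by simp
    show "f (x - y) = f x - f y" using f(1)[OF that(1) y] f(2)[OF that(2), of "-1"] by simp
  qed
  have dist: "norm (f x - f y) = norm (j x - j y)" if "x \<in> V" "y \<in> V" for x y
    using iso[OF diff(1)[OF that]] j(3)[OF diff(1)[OF that]] diff(2,3)[OF that] by simp
  define g where "g z = f (SOME x. x \<in> V \<and> j x = z)" for z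
  have g: "g (j x) = f x" if x: "x \<in> V" for x
  proof -
    let ?y = "SOME y. y \<in> V \<and> j y = j x"
    have y: "?y \<in> V \<and> j ?y = j x" by (rule someI[of _ x]) (simp add: x)
    have "norm (f ?y - f x) = 0" using dist[of ?y x] x y by simp
    thus ?thesis unfolding g_def by simp
  qed
  have "uniformly_continuous_on (j ` V) g"
    unfolding uniformly_continuous_on_def
  proof (intro allI impI)
    fix e :: real assume "0 < e"
    thus "\<exists>d>0. \<forall>x\<in>j ` V. \<forall>x'\<in>j ` V. dist x' x < d \<longrightarrow> dist (g x') (g x) < e"
      by (intro exI[of _ e]) (auto simp: g dist dist_norm)
  qed
  then obtain L where L: "uniformly_continuous_on (closure (j ` V)) L" "\<And>z. z \<in> j ` V \<Longrightarrow> g z = L z"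
    using uniformly_continuous_on_extension_on_closure by metis
  have Lj: "L (j x) = f x" if "x \<in> V" for x using L(2)[of "j x"] g that by simp
  have "continuous_on UNIV L" using L(1) j(4) uniformly_continuous_imp_continuous by auto
  hence Llim: "(\<lambda>n. L (u n)) \<longlonglongrightarrow> L z" if "u \<longlonglongrightarrow> z" for u z
    using that by (intro continuous_on_tendsto_compose[of UNIV L]) auto
  have appr: "\<exists>x. (\<forall>n. x n \<in> V) \<and> (\<lambda>n. j (x n)) \<longlonglongrightarrow> z" for z
  proof -
    have "z \<in> closure (j ` V)" using j(4) by simp
    then obtain u where u: "\<And>n. u n \<in> j ` V" "u \<longlonglongrightarrow> z" unfolding closure_sequential by blast
    hence "\<forall>n. \<exists>x. x \<in> V \<and> u n = j x" by blast
    then obtain x where "\<And>n. x n \<in> V" "\<And>n. u n = j (x n)" by metis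
    thus ?thesis using u(2) by (intro exI[of _ x]) (simp add: ext[of u "\<lambda>n. j (x n)"])
  qed
  have lin: "linear L"
  proof (rule linearI)
    fix a b
    obtain x y where xy: "\<And>n. x n \<in> V" "(\<lambda>n. j (x n)) \<longlonglongrightarrow> a" "\<And>n. y n \<in> V" "(\<lambda>n. j (y n)) \<longlonglongrightarrow> b"
      using appr[of a] appr[of b] by blast
    have "(\<lambda>n. L (j (x n + y n))) \<longlonglongrightarrow> L (a + b)"
      using xy j(1) by (intro Llim) (simp add: tendsto_add)
    moreover have "(\<lambda>n. L (j (x n + y n))) \<longlonglongrightarrow> L a + L b"
      using tendsto_add[OF Llim[OF xy(2)] Llim[OF xy(4)]] xy f(1) subspace_add[OF V] by (simp add: Lj)
    ultimately show "L (a + b) = L a + L b" by (rule LIMSEQ_unique)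
  next
    fix c a
    obtain x where x: "\<And>n. x n \<in> V" "(\<lambda>n. j (x n)) \<longlonglongrightarrow> a" using appr[of a] by blast
    have "(\<lambda>n. L (j (c *\<^sub>R x n))) \<longlonglongrightarrow> L (c *\<^sub>R a)"
      using x j(2) by (intro Llim) (simp add: tendsto_scaleR)
    moreover have "(\<lambda>n. L (j (c *\<^sub>R x n))) \<longlonglongrightarrow> c *\<^sub>R L a"
      using tendsto_scaleR[OF tendsto_const Llim[OF x(2)], of c] x f(2) subspace_scale[OF V] by (simp add: Lj)
    ultimately show "L (c *\<^sub>R a) = c *\<^sub>R L a" by (rule LIMSEQ_unique)
  qed
  have norm: "norm (L z) = norm z" for z
  proof -
    obtain x where x: "\<And>n. x n \<in> V" "(\<lambda>n. j (x n)) \<longlonglongrightarrow> z" using appr by blast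
    have "(\<lambda>n. norm (L (j (x n)))) \<longlonglongrightarrow> norm (L z)" by (rule tendsto_norm[OF Llim[OF x(2)]])
    moreover have "norm (L (j (x n))) = norm (j (x n))" for n using x(1) Lj iso j(3) by simp
    ultimately have "(\<lambda>n. norm (j (x n))) \<longlonglongrightarrow> norm (L z)" by simp
    thus ?thesis using tendsto_norm[OF x(2)] LIMSEQ_unique by blast
  qed
  have bl: "bounded_linear L"
    by (intro bounded_linear.intro bounded_linear_axioms.intro lin exI[of _ 1]) (simp add: norm)
  have LV: "L ` (j ` V) = f ` V" using Lj by (auto simp: image_image)
  have range: "range L = closure (f ` V)"
  proof
    show "range L \<subseteq> closure (f ` V)"
      using image_closure_subset[OF linear_continuous_on[OF bl] closed_closure closure_subset, of "j ` V"]
      unfolding LV j(4) .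
    have "complete (range L)"
      by (rule complete_isometric_image[OF zero_less_one subspace_UNIV bl _ complete_UNIV]) (simp add: norm)
    thus "closure (f ` V) \<subseteq> range L" using LV by (intro closure_minimal complete_imp_closed) auto
  qed
  show ?thesis using that[OF bl norm Lj range] .
qed

section \<open>The space of strong continuity\<close>

context bi_semigroup
begin

abbreviation "A \<equiv> gen P T"
abbreviation "X0 \<equiv> space0 P T"

lemma subspace_Domain: "subspace (Domain A)"
  unfolding subspace_def using gen_zero gen_scale gen_comb[of _ _ _ _ 1] by fastforce

lemma subspace_X0: "subspace X0"
  unfolding space0_def by (rule subspace_closure[OF subspace_Domain])

lemma Domain_X0: "x \<in> Domain A \<Longrightarrow> x \<in> X0"
  unfolding space0_def by (rule subsetD[OF closure_subset])

lemma is_resolvent_X0: "is_resolvent lam A R \<Longrightarrow> R x \<in> X0"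
  by (rule Domain_X0[OF DomainI[OF is_resolvent_graph]])

lemma X0_T: "x \<in> X0 \<Longrightarrow> 0 \<le> t \<Longrightarrow> T t x \<in> X0"
proof -
  assume x: "x \<in> X0" and t: "0 \<le> t"
  have "T t ` closure (Domain A) \<subseteq> closure (T t ` Domain A)"
    by (rule image_closure_subset[OF linear_continuous_on[OF T_blin[OF t]] closed_closure closure_subset])
  also have "\<dots> \<subseteq> closure (Domain A)" using gen_T t by (intro closure_mono) blast
  finally show ?thesis using x unfolding space0_def by blast
qed

lemma X0_cont:
  assumes x: "x \<in> X0" and e: "0 < e"
  shows "\<exists>d>0. \<forall>t\<in>{0..d}. norm (T t x - x) \<le> e"
proof -
  define B where "B = M * exp (w * 1) + 1"
  have B: "1 < B" unfolding B_def using M_pos by simp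
  obtain y where y: "y \<in> Domain A" "norm (y - x) < e / (2 * B)"
  proof -
    have "0 < e / (2 * B)" using e B by simp
    thus ?thesis using x that unfolding space0_def closure_approachable dist_norm by blast
  qed
  then obtain C where C: "\<And>t. t \<in> {0<..1} \<Longrightarrow> norm (T t y - y) \<le> C * t" using gen_iff[of y _ T] by blast
  define d where "d = min 1 (e / (2 * (\<bar>C\<bar> + 1)))"
  have d: "0 < d" "d \<le> 1" unfolding d_def using e by auto
  have "norm (T t x - x) \<le> e" if t: "t \<in> {0..d}" for t
  proof -
    have "norm (T t y - y) \<le> \<bar>C\<bar> * d"
    proof (cases "t = 0")
      case False
      hence "norm (T t y - y) \<le> C * t" using C[of t] t d by simp
      also have "\<dots> \<le> \<bar>C\<bar> * d" using t by (intro mult_mono) auto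
      finally show ?thesis .
    qed (use d in simp)
    also have "\<bar>C\<bar> * d \<le> (\<bar>C\<bar> + 1) * (e / (2 * (\<bar>C\<bar> + 1)))" unfolding d_def using e by (intro mult_mono) auto
    also have "\<dots> = e / 2" by (simp add: field_simps)
    finally have 1: "norm (T t y - y) \<le> e / 2" .
    have eq: "T t x - x = (T t y - y) - (T t (y - x) - (y - x))" using t by (simp add: T_minus)
    have "norm (T t (y - x) - (y - x)) \<le> B * norm (y - x)"
      using T_bound_le[of t 1 "y - x"] norm_triangle_ineq4[of "T t (y - x)" "y - x"] t d unfolding B_def by (simp add: distrib_right)
    moreover have "B * norm (y - x) \<le> e / 2" using y(2) B by (simp add: field_simps)
    ultimately show ?thesis unfolding eq using 1 norm_triangle_ineq4[of "T t y - y" "T t (y - x) - (y - x)"] by linarith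
  qed
  thus ?thesis using d(1) by blast
qed

text \<open>
  The increment differs from \<open>t y\<close> by at most \<open>t\<close> times the largest deviation of \<open>T s y\<close> from \<open>y\<close>, which
  tends to \<open>0\<close> because \<open>y\<close> is norm continuous under the semigroup.
\<close>

lemma gen_X0_norm:
  assumes xy: "(x, y) \<in> A" and y: "y \<in> X0"
  shows "((\<lambda>t. (T t x - x) /\<^sub>R t) \<longlongrightarrow> y) (at_right 0)"
  unfolding tendsto_iff dist_norm eventually_at_right_field
proof (intro allI impI)
  fix e :: real assume e: "0 < e"
  obtain d where d: "0 < d" "\<And>t. t \<in> {0..d} \<Longrightarrow> norm (T t y - y) \<le> e / 2" using X0_cont[OF y half_gt_zero[OF e]] by blast
  have "norm ((T t x - x) /\<^sub>R t - y) < e" if t: "0 < t" "t < d" for t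
  proof -
    have "norm (T t x - x - t *\<^sub>R y) \<le> t * (e / 2)" using t d(2) by (intro increment_approx_norm[OF xy]) auto
    hence "inverse t * norm (T t x - x - t *\<^sub>R y) \<le> inverse t * (t * (e / 2))" using t by (intro mult_left_mono) auto
    moreover have "(T t x - x) /\<^sub>R t - y = inverse t *\<^sub>R (T t x - x - t *\<^sub>R y)" using t by (simp add: scaleR_diff_right)
    hence "norm ((T t x - x) /\<^sub>R t - y) = inverse t * norm (T t x - x - t *\<^sub>R y)" using t by simp
    moreover have "inverse t * (t * (e / 2)) = e / 2" using t by simp
    ultimately show ?thesis using e by linarith
  qed
  thus "\<exists>b>0. \<forall>t>0. t < b \<longrightarrow> norm ((T t x - x) /\<^sub>R t - y) < e" using d(1) by blast
qed

text \<open>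
  Norm convergence bounds the quotients near \<open>0\<close>; away from \<open>0\<close> the growth bound does.
\<close>

lemma norm_gen:
  assumes lim: "((\<lambda>t. (T t x - x) /\<^sub>R t) \<longlongrightarrow> y) (at_right 0)"
  shows "(x, y) \<in> A"
  unfolding gen_iff
proof (intro conjI ballI)
  have "\<forall>\<^sub>F t in at_right 0. dist ((T t x - x) /\<^sub>R t) y < 1" using lim by (rule tendstoD) simp
  then obtain d where d: "0 < d" "\<And>t. 0 < t \<Longrightarrow> t < d \<Longrightarrow> norm ((T t x - x) /\<^sub>R t - y) < 1"
    unfolding eventually_at_right_field dist_norm by blast
  let ?L = "M * exp (w * 1) * norm x + norm x"
  have L: "0 \<le> ?L" using M_pos by simp
  have "norm (T t x - x) \<le> (1 + norm y + ?L / d) * t" if t: "t \<in> {0<..1}" for t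
  proof (cases "t < d")
    case True
    have "norm ((T t x - x) /\<^sub>R t) \<le> 1 + norm y"
      using d(2)[OF _ True] t norm_triangle_ineq2[of "(T t x - x) /\<^sub>R t" y] by force
    hence "norm ((T t x - x) /\<^sub>R t) * t \<le> (1 + norm y) * t" using t by (intro mult_right_mono) auto
    moreover have "norm ((T t x - x) /\<^sub>R t) * t = norm (T t x - x)" using t by simp
    ultimately have "norm (T t x - x) \<le> (1 + norm y) * t" by (simp only:)
    also have "\<dots> \<le> (1 + norm y + ?L / d) * t" using t L d(1) by (intro mult_right_mono) auto
    finally show ?thesis .
  next
    case False
    have "norm (T t x - x) \<le> ?L" using T_bound_le[of t 1 x] t norm_triangle_ineq4[of "T t x" x] by simp
    also have "?L = (?L / d) * d" using d(1) by simp
    also have "\<dots> \<le> (?L / d) * t" using False L d(1) by (intro mult_left_mono) auto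
    also have "\<dots> \<le> (1 + norm y + ?L / d) * t" using t by (intro mult_right_mono) auto
    finally show ?thesis .
  qed
  thus "\<exists>C. \<forall>t\<in>{0<..1}. norm (T t x - x) \<le> C * t" by blast
  fix p assume "p \<in> P"
  thus "((\<lambda>t. p ((T t x - x) /\<^sub>R t - y)) \<longlongrightarrow> 0) (at_right 0)"
    by (rule tends_norm) (use lim in \<open>simp add: tendsto_norm_zero_iff LIM_zero_iff\<close>)
qed

text \<open>
  An isometry onto the space of strong continuity that intertwines the semigroups also intertwines the
  generators: it preserves norm limits in both directions.
\<close>

lemma C0_conj:
  fixes L :: "'w::banach \<Rightarrow> 'a"
  assumes L: "bounded_linear L" "\<And>z. norm (L z) = norm z" "range L = X0"
    and sg: "\<And>t z. 0 \<le> t \<Longrightarrow> L (sg t z) = T t (L z)"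
  shows "(z, v) \<in> C0_generator sg \<longleftrightarrow> (L z, L v) \<in> A"
proof -
  have lin: "linear L" using L(1) by (rule bounded_linear.linear)
  have eq: "L ((sg t z - z) /\<^sub>R t) = (T t (L z) - L z) /\<^sub>R t" if "0 < t" for t
    using that by (simp add: sg linear_diff[OF lin] linear_scale[OF lin])
  have "(z, v) \<in> C0_generator sg \<longleftrightarrow> ((\<lambda>t. norm ((sg t z - z) /\<^sub>R t - v)) \<longlongrightarrow> 0) (at_right 0)"
    unfolding C0_generator_def by (simp add: tendsto_norm_zero_iff LIM_zero_iff)
  also have "\<dots> \<longleftrightarrow> ((\<lambda>t. norm ((T t (L z) - L z) /\<^sub>R t - L v)) \<longlongrightarrow> 0) (at_right 0)"
  proof (rule tendsto_cong)
    have "norm ((sg t z - z) /\<^sub>R t - v) = norm ((T t (L z) - L z) /\<^sub>R t - L v)" if "0 < t" for t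
      unfolding eq[OF that, symmetric] linear_diff[OF lin, symmetric] L(2) ..
    thus "\<forall>\<^sub>F t in at_right 0. norm ((sg t z - z) /\<^sub>R t - v) = norm ((T t (L z) - L z) /\<^sub>R t - L v)"
      unfolding eventually_at_right_field by (intro exI[of _ 1]) simp
  qed
  also have "\<dots> \<longleftrightarrow> ((\<lambda>t. (T t (L z) - L z) /\<^sub>R t) \<longlongrightarrow> L v) (at_right 0)"
    by (simp add: tendsto_norm_zero_iff LIM_zero_iff)
  also have "\<dots> \<longleftrightarrow> (L z, L v) \<in> A"
    using gen_X0_norm[of "L z" "L v"] norm_gen L(3) by blast
  finally show ?thesis .
qed

end

section \<open>The first extrapolation space\<close>

context bi_semigroup
begin

text \<open>
  Approximate \<open>x\<close> by \<open>\<mu> R x\<close> minus the difference quotients of the orbit of \<open>R x\<close>; these vectors are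
  values of \<open>R\<close> on the space of strong continuity.
\<close>

lemma resolvent_range_dense:
  assumes R: "is_resolvent \<mu> A R"
  shows "closure (R ` X0) = X0"
proof
  have R_lin: "linear R" by (rule is_resolvent_lin[OF R])
  note RX0 = is_resolvent_X0[OF R]
  have "R ` X0 \<subseteq> X0" using RX0 by blast
  thus "closure (R ` X0) \<subseteq> X0" unfolding space0_def by (metis closed_closure closure_minimal)
  show "X0 \<subseteq> closure (R ` X0)"
  proof
    fix x assume x: "x \<in> X0"
    show "x \<in> closure (R ` X0)"
      unfolding closure_approachable
    proof (intro allI impI)
      fix e :: real assume e: "0 < e"
      let ?v = "\<mu> *\<^sub>R R x - x"
      have "((\<lambda>t. (T t (R x) - R x) /\<^sub>R t) \<longlongrightarrow> ?v) (at_right 0)"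
        using subspace_X0 RX0 x by (intro gen_X0_norm[OF is_resolvent_graph[OF R]] subspace_diff subspace_scale) auto
      hence "\<forall>\<^sub>F t in at_right 0. dist ((T t (R x) - R x) /\<^sub>R t) ?v < e" using e by (rule tendstoD)
      then obtain t where t: "0 < t" "dist ((T t (R x) - R x) /\<^sub>R t) ?v < e"
        unfolding eventually_at_right_field by (meson dense)
      let ?y = "\<mu> *\<^sub>R x - (T t x - x) /\<^sub>R t"
      have eq: "R ?y = \<mu> *\<^sub>R R x - (T t (R x) - R x) /\<^sub>R t"
        using is_resolvent_T[OF R, of t x] t(1) by (simp add: linear_diff[OF R_lin] linear_scale[OF R_lin])
      have "dist (R ?y) x = dist ((T t (R x) - R x) /\<^sub>R t) ?v"
        unfolding dist_norm eq by (subst norm_minus_commute) (simp add: algebra_simps)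
      moreover have "?y \<in> X0" using subspace_X0 X0_T[OF x, of t] x t(1) by (intro subspace_diff subspace_scale) auto
      ultimately show "\<exists>y\<in>R ` X0. dist y x < e"
        using t(2) by (intro bexI[of _ "R ?y"]) simp_all
    qed
  qed
qed

lemma C0_conj_resolvent:
  fixes L :: "'w::banach \<Rightarrow> 'a"
  assumes R: "is_resolvent \<mu> A R"
    and L: "bounded_linear L" "\<And>z. norm (L z) = norm z" "range L = X0"
    and sg: "\<And>t z. 0 \<le> t \<Longrightarrow> L (sg t z) = T t (L z)"
  shows "L (resolvent \<mu> (C0_generator sg) z) = R (L z)"
proof -
  have lin: "linear L" using L(1) by (rule bounded_linear.linear)
  have inj: "a = b" if "L a = L b" for a b
    using L(2)[of "a - b"] that by (simp add: linear_diff[OF lin])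
  have conj: "(z, v) \<in> C0_generator sg \<longleftrightarrow> (L z, L v) \<in> A" for z v by (rule C0_conj[OF L]) (rule sg)
  have *: "(y, \<mu> *\<^sub>R y - z) \<in> C0_generator sg \<longleftrightarrow> L y = R (L z)" for y
    using R unfolding conj is_resolvent_def by (simp add: linear_diff[OF lin] linear_scale[OF lin])
  have "R (L z) \<in> X0" by (rule is_resolvent_X0[OF R])
  then obtain y where y: "L y = R (L z)" using L(3) by (metis imageE)
  have "resolvent \<mu> (C0_generator sg) z = y"
    unfolding resolvent_def * by (rule the_equality) (use y inj in auto)
  thus ?thesis using y by simp
qed

lemma C0_conj_val:
  fixes L :: "'w::banach \<Rightarrow> 'a"
  assumes L: "bounded_linear L" "\<And>z. norm (L z) = norm z" "range L = X0"
    and sg: "\<And>t z. 0 \<le> t \<Longrightarrow> L (sg t z) = T t (L z)"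
    and u: "(L z, u) \<in> A" "u \<in> X0"
  shows "L (op_val (C0_generator sg) z) = u"
proof -
  have lin: "linear L" using L(1) by (rule bounded_linear.linear)
  have inj: "a = b" if "L a = L b" for a b
    using L(2)[of "a - b"] that by (simp add: linear_diff[OF lin])
  obtain v where v: "L v = u" using L(3) u(2) by (metis imageE)
  have conj: "(z, v) \<in> C0_generator sg \<longleftrightarrow> (L z, L v) \<in> A" for z v by (rule C0_conj[OF L]) (rule sg)
  have "op_val (C0_generator sg) z = v"
    unfolding op_val_def conj
  proof (rule the_equality)
    show "(L z, L v) \<in> A" using u v by simp
    show "y = v" if "(L z, L y) \<in> A" for y using gen_unique[OF that u(1)] v inj by simp
  qed
  thus ?thesis using v by simp
qed

text \<open>
  Each completion is taken for the norm of a resolvent, so that resolvent extends to an isometry onto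
  the space of strong continuity. The isometry \<open>L\<close> of the second completion extends \<open>R\<^sup>2\<close>
  along the embeddings.
\<close>

lemma ext_isometries:
  fixes E :: "('a, 'b::banach, 'c::banach) extrapolation"
  assumes E: "is_extrapolation P T E" and R: "is_resolvent (base E) A R"
  obtains L where "bounded_linear L" "\<And>z. norm (L z) = norm z" "range L = X0"
    "\<And>t z. 0 \<le> t \<Longrightarrow> L (sg2 E t z) = T t (L z)" "\<And>x. L (emb P T E x) = R (R x)"
proof -
  let ?\<mu> = "base E"
  have E': "is_completion X0 (\<lambda>x. norm (resolvent ?\<mu> (gen0 P T) x)) (incl1 E)"
     "C0_semigroup (sg1 E)" "\<And>t x. 0 \<le> t \<Longrightarrow> x \<in> X0 \<Longrightarrow> sg1 E t (incl1 E x) = incl1 E (T t x)"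
     "is_completion UNIV (\<lambda>y. norm (resolvent ?\<mu> (C0_generator (sg1 E)) y)) (incl2 E)"
     "C0_semigroup (sg2 E)" "\<And>t y. 0 \<le> t \<Longrightarrow> sg2 E t (incl2 E y) = incl2 E (sg1 E t y)"
    using E unfolding is_extrapolation_def by blast+
  have Rlin: "linear R" by (rule is_resolvent_lin[OF R])
  note RX0 = is_resolvent_X0[OF R]
  have res0: "resolvent ?\<mu> (gen0 P T) x = R x" if "x \<in> X0" for x
  proof -
    have "(y, ?\<mu> *\<^sub>R y - x) \<in> gen0 P T \<longleftrightarrow> y = R x" for y
      using RX0[of x] that subspace_X0 R unfolding gen0_def op_part_def is_resolvent_def
      by (auto intro: subspace_diff subspace_scale)
    thus ?thesis unfolding resolvent_def by simp
  qed
  have lin1: "linear_on_subspace X0 R" using Rlin by (simp add: linear_on_subspace_def linear_add linear_scale)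
  obtain L1 where L1: "bounded_linear L1" "\<And>z. norm (L1 z) = norm z" "\<And>x. x \<in> X0 \<Longrightarrow> L1 (incl1 E x) = R x"
      "range L1 = closure (R ` X0)"
    by (rule completion_isometry[OF E'(1) subspace_X0 lin1]) (auto simp: res0)
  have L1r: "range L1 = X0" using L1(4) resolvent_range_dense[OF R] by simp
  have sg1: "L1 (sg1 E t z) = T t (L1 z)" if t: "0 \<le> t" for t z
  proof (rule dense_image_linear_eq[of "incl1 E ` X0"])
    show "closure (incl1 E ` X0) = UNIV" using E'(1) unfolding is_completion_def by blast
    show "bounded_linear (\<lambda>z. L1 (sg1 E t z))"
      using E'(2) t unfolding C0_semigroup_def by (intro bounded_linear_compose[OF L1(1)]) blast
    show "bounded_linear (\<lambda>z. T t (L1 z))" by (rule bounded_linear_compose[OF T_blin[OF t] L1(1)])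
    show "L1 (sg1 E t y) = T t (L1 y)" if "y \<in> incl1 E ` X0" for y
      using that t E'(3) X0_T by (auto simp: L1(3) is_resolvent_T[OF R])
  qed
  have res1: "L1 (resolvent ?\<mu> (C0_generator (sg1 E)) y) = R (L1 y)" for y
    by (rule C0_conj_resolvent[OF R L1(1,2) L1r sg1])
  have L1lin: "linear L1" using L1(1) by (rule bounded_linear.linear)
  have lin2: "linear_on_subspace UNIV (\<lambda>y. R (L1 y))"
    using Rlin L1lin by (simp add: linear_on_subspace_def linear_add linear_scale)
  obtain L where L: "bounded_linear L" "\<And>z. norm (L z) = norm z" "\<And>y. L (incl2 E y) = R (L1 y)"
      "range L = closure ((\<lambda>y. R (L1 y)) ` UNIV)"
  proof (rule completion_isometry[OF E'(4) subspace_UNIV lin2])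
    show "norm (R (L1 y)) = norm (resolvent ?\<mu> (C0_generator (sg1 E)) y)" for y
      using L1(2)[of "resolvent ?\<mu> (C0_generator (sg1 E)) y"] res1 by simp
  qed auto
  have "(\<lambda>y. R (L1 y)) ` UNIV = R ` X0" using L1r by (simp flip: image_image)
  hence Lr: "range L = X0" using L(4) resolvent_range_dense[OF R] by simp
  have sg2: "L (sg2 E t z) = T t (L z)" if t: "0 \<le> t" for t z
  proof (rule dense_image_linear_eq[of "range (incl2 E)"])
    show "closure (range (incl2 E)) = UNIV" using E'(4) unfolding is_completion_def by blast
    show "bounded_linear (\<lambda>z. L (sg2 E t z))"
      using E'(5) t unfolding C0_semigroup_def by (intro bounded_linear_compose[OF L(1)]) blast
    show "bounded_linear (\<lambda>z. T t (L z))" by (rule bounded_linear_compose[OF T_blin[OF t] L(1)])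
    show "L (sg2 E t y) = T t (L y)" if "y \<in> range (incl2 E)" for y
      using that t E'(6) by (auto simp: L(3) sg1 is_resolvent_T[OF R])
  qed
  have "L1 (emb1 P T E x) = R x" for x
  proof -
    let ?r = "incl1 E (R x)"
    have r: "L1 ?r = R (R x)" by (rule L1(3)[OF RX0])
    have "L1 (op_val (C0_generator (sg1 E)) ?r) = ?\<mu> *\<^sub>R R (R x) - R x"
    proof (rule C0_conj_val[OF L1(1,2) L1r sg1])
      show "(L1 ?r, ?\<mu> *\<^sub>R R (R x) - R x) \<in> A" unfolding r by (rule is_resolvent_graph[OF R])
      show "?\<mu> *\<^sub>R R (R x) - R x \<in> X0" using subspace_X0 RX0 by (intro subspace_diff subspace_scale)
    qed
    thus ?thesis unfolding emb1_def resolvent_eq[OF R] Let_def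
      by (simp add: linear_diff[OF L1lin] linear_scale[OF L1lin] r)
  qed
  hence "L (emb P T E x) = R (R x)" for x unfolding emb_def by (simp add: L(3))
  thus ?thesis using that L(1,2) Lr sg2 by blast
qed

lemma is_resolvent_inj:
  assumes R: "is_resolvent \<mu> A R" and "R x = R y"
  shows "x = y"
proof -
  have "\<mu> *\<^sub>R R x - x = \<mu> *\<^sub>R R y - y"
    using is_resolvent_graph[OF R, of x] is_resolvent_graph[OF R, of y] assms(2) gen_unique by metis
  thus ?thesis using assms(2) by simp
qed

text \<open>
  The extrapolation space is a copy of \<open>'a\<close>: \<open>\<Phi>\<close> is \<open>base E\<close> minus the extrapolated generator, read as
  a map on \<open>'a\<close>, and \<open>ext_pull P T E\<close> inverts it.
\<close>

lemma ext_space_iso: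
  fixes E :: "('a, 'b::banach, 'c::banach) extrapolation"
  assumes E: "is_extrapolation P T E" and R: "is_resolvent (base E) A R"
  obtains \<Phi> where "linear \<Phi>" "range \<Phi> = ext_space P T E" "\<And>x. ext_pull P T E (\<Phi> x) = x"
    "\<And>x. emb P T E x = \<Phi> (R x)"
proof -
  let ?\<mu> = "base E"
  obtain L where L: "bounded_linear L" "\<And>z. norm (L z) = norm z" "range L = X0"
    "\<And>t z. 0 \<le> t \<Longrightarrow> L (sg2 E t z) = T t (L z)" and Lemb: "\<And>x. L (emb P T E x) = R (R x)"
    using ext_isometries[OF E R] by metis
  have lin: "linear L" using L(1) by (rule bounded_linear.linear)
  have Rlin: "linear R" by (rule is_resolvent_lin[OF R])
  note RX0 = is_resolvent_X0[OF R]
  have inj: "a = b" if "L a = L b" for a b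
    using L(2)[of "a - b"] that by (simp add: linear_diff[OF lin])
  define \<Phi> where "\<Phi> x = inv L (R x)" for x
  have L\<Phi>: "L (\<Phi> x) = R x" for x unfolding \<Phi>_def using L(3) RX0 by (intro f_inv_into_f) simp
  have 1: "linear \<Phi>"
    by (intro linearI inj) (simp_all add: L\<Phi> linear_add[OF lin] linear_add[OF Rlin] linear_scale[OF lin] linear_scale[OF Rlin])
  have emb: "emb P T E x = \<Phi> (R x)" for x by (rule inj) (simp add: Lemb L\<Phi>)
  have "base E *\<^sub>R emb P T E x - op_val (C0_generator (sg2 E)) (emb P T E x) = \<Phi> x" for x
  proof (rule inj)
    have "L (op_val (C0_generator (sg2 E)) (emb P T E x)) = ?\<mu> *\<^sub>R R (R x) - R x"
    proof (rule C0_conj_val[OF L])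
      show "(L (emb P T E x), ?\<mu> *\<^sub>R R (R x) - R x) \<in> A" unfolding Lemb by (rule is_resolvent_graph[OF R])
      show "?\<mu> *\<^sub>R R (R x) - R x \<in> X0" using subspace_X0 RX0 by (intro subspace_diff subspace_scale)
    qed
    thus "L (base E *\<^sub>R emb P T E x - op_val (C0_generator (sg2 E)) (emb P T E x)) = L (\<Phi> x)"
      by (simp add: linear_diff[OF lin] linear_scale[OF lin] Lemb L\<Phi>)
  qed
  hence 2: "range \<Phi> = ext_space P T E" unfolding ext_space_def by simp
  have 3: "ext_pull P T E (\<Phi> x) = x" for x
  proof -
    have "resolvent ?\<mu> (C0_generator (sg2 E)) (\<Phi> x) = emb P T E x"
      by (rule inj) (simp add: C0_conj_resolvent[OF R L] L\<Phi> Lemb)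
    moreover have "inj (emb P T E)"
      using is_resolvent_inj[OF R] by (intro injI) (metis Lemb)
    ultimately show ?thesis unfolding ext_pull_def by simp
  qed
  show ?thesis using that[OF 1 2 3 emb] .
qed

end

locale extrapolated = bi_semigroup P T M w
  for P :: "('a::banach \<Rightarrow> real) set" and T :: "real \<Rightarrow> 'a \<Rightarrow> 'a" and M w :: real +
  fixes E :: "('a, 'b::banach, 'c::banach) extrapolation" and R :: "'a \<Rightarrow> 'a" and \<Phi> :: "'a \<Rightarrow> 'c"
  assumes ext: "is_extrapolation P T E"
    and res: "is_resolvent (base E) (gen P T) R"
    and \<Phi>_lin: "linear \<Phi>"
    and \<Phi>_range: "range \<Phi> = ext_space P T E"
    and pull_\<Phi> [simp]: "ext_pull P T E (\<Phi> x) = x"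
    and emb_\<Phi>: "emb P T E x = \<Phi> (R x)"
begin

lemma \<Phi>_simps: "\<Phi> x + \<Phi> y = \<Phi> (x + y)" "\<Phi> x - \<Phi> y = \<Phi> (x - y)" "c *\<^sub>R \<Phi> x = \<Phi> (c *\<^sub>R x)" "\<Phi> 0 = 0"
  using \<Phi>_lin by (simp_all add: linear_add linear_diff linear_scale linear_0)

lemma \<Phi>_inj [simp]: "\<Phi> x = \<Phi> y \<longleftrightarrow> x = y"
  by (metis pull_\<Phi>)

lemma \<Phi>_in [simp]: "\<Phi> x \<in> ext_space P T E"
  using \<Phi>_range by blast

lemma \<Phi>_pull: "z \<in> ext_space P T E \<Longrightarrow> \<Phi> (ext_pull P T E z) = z"
  unfolding \<Phi>_range[symmetric] by auto

lemma R_lin: "linear R" by (rule is_resolvent_lin[OF res])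

lemma inv_emb: "inv (emb P T E) (\<Phi> (R x)) = x"
proof -
  have "inj (emb P T E)" using is_resolvent_inj[OF res] by (intro injI) (simp add: emb_\<Phi>)
  thus ?thesis using emb_\<Phi> by (metis inv_f_f)
qed

lemma limitin_ext:
  "limitin (lc_topology (ext_space P T E) (ext_seminorms P T E)) (\<lambda>t. \<Phi> (f t)) (\<Phi> l) F \<longleftrightarrow>
     (\<forall>p\<in>P. ((\<lambda>t. p (f t - l)) \<longlongrightarrow> 0) F)"
proof (subst limitin_lc_topology)
  fix q assume "q \<in> ext_seminorms P T E"
  then obtain p where p: "p \<in> P" "q = (\<lambda>z. p (ext_pull P T E z))" unfolding ext_seminorms_def by blast
  show "q 0 = 0" using p(1) pull_\<Phi>[of 0] by (simp add: p(2) \<Phi>_simps)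
  fix a b assume ab: "a \<in> ext_space P T E" "b \<in> ext_space P T E"
  then obtain a' b' where ab': "a = \<Phi> a'" "b = \<Phi> b'" unfolding \<Phi>_range[symmetric] by blast
  show "0 \<le> q (a - b)" unfolding ab' p(2) by (simp add: \<Phi>_simps p_nonneg[OF p(1)])
  fix c assume "c \<in> ext_space P T E"
  then obtain c' where c': "c = \<Phi> c'" unfolding \<Phi>_range[symmetric] by blast
  show "q (a - c) \<le> q (a - b) + q (b - c)" unfolding ab' c' p(2) by (simp add: \<Phi>_simps p_diff[OF p(1)])
next
  have eq: "(\<forall>q\<in>ext_seminorms P T E. Q q) \<longleftrightarrow> (\<forall>p\<in>P. Q (\<lambda>z. p (ext_pull P T E z)))" for Q
    unfolding ext_seminorms_def by blast
  show "\<Phi> l \<in> ext_space P T E \<and> (\<forall>\<^sub>F z in F. \<Phi> (f z) \<in> ext_space P T E) \<and>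
      (\<forall>q\<in>ext_seminorms P T E. ((\<lambda>z. q (\<Phi> (f z) - \<Phi> l)) \<longlongrightarrow> 0) F) \<longleftrightarrow>
      (\<forall>p\<in>P. ((\<lambda>t. p (f t - l)) \<longlongrightarrow> 0) F)"
    unfolding eq by (simp add: \<Phi>_simps)
qed

text \<open>
  Both sides agree on the range of \<open>R\<close>, where \<open>\<Phi>\<close> is the embedding, and both are continuous along bounded
  null sequences; the range of \<open>R\<close> is the domain of the generator, which is dense in this sense.
\<close>

lemma sgX_\<Phi>:
  assumes t: "0 \<le> t"
  shows "sgX E t (\<Phi> x) = \<Phi> (T t x)"
proof -
  let ?V = "ext_space P T E"
  have bc: "bi_continuous_semigroup ?V (ext_norm P T E) (ext_seminorms P T E) (sgX E)"
    and sg: "\<And>x. sgX E t (emb P T E x) = emb P T E (T t x)"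
    using ext t unfolding is_extrapolation_def by blast+
  have V: "sgX E t ` ?V \<subseteq> ?V" and lin: "linear_on_subspace ?V (sgX E t)"
    using bc t unfolding bi_continuous_semigroup_def by blast+
  have equi: "range y \<subseteq> ?V \<Longrightarrow> \<exists>C. \<forall>n. ext_norm P T E (y n) \<le> C \<Longrightarrow>
      limitin (lc_topology ?V (ext_seminorms P T E)) y 0 sequentially \<Longrightarrow> 0 \<le> t0 \<Longrightarrow> q \<in> ext_seminorms P T E \<Longrightarrow>
      uniform_limit {0..t0} (\<lambda>n s. q (sgX E s (y n))) (\<lambda>s. 0) sequentially" for y :: "nat \<Rightarrow> 'c" and t0 q
    using bc unfolding bi_continuous_semigroup_def by blast
  define \<psi> where "\<psi> y = ext_pull P T E (sgX E t (\<Phi> y))" for y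
  have \<psi>: "\<Phi> (\<psi> y) = sgX E t (\<Phi> y)" for y unfolding \<psi>_def using V by (intro \<Phi>_pull) auto
  have \<psi>_diff: "\<psi> (a - b) = \<psi> a - \<psi> b" for a b
  proof -
    have "sgX E t (\<Phi> a + (-1) *\<^sub>R \<Phi> b) = sgX E t (\<Phi> a) + (-1) *\<^sub>R sgX E t (\<Phi> b)"
      using lin \<Phi>_in[of a] \<Phi>_in[of b] \<Phi>_in[of "(-1) *\<^sub>R b"] unfolding linear_on_subspace_def
      by (metis \<Phi>_simps(3))
    hence "\<Phi> (\<psi> (a - b)) = \<Phi> (\<psi> a - \<psi> b)" unfolding \<psi> by (simp add: \<psi> flip: \<Phi>_simps(2))
    thus ?thesis by simp
  qed
  have \<psi>_R: "\<psi> (R y) = T t (R y)" for y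
    using sg[of y] is_resolvent_T[OF res t] by (simp add: \<psi>_def emb_\<Phi>)
  obtain u where u: "\<And>n. u n \<in> Domain (gen P T)" "bnull P (\<lambda>n. u n - x)" using gen_bidense[OF res] by blast
  have \<psi>u: "\<psi> (u n) = T t (u n)" for n
    using u(1)[of n] \<psi>_R is_resolvent_range[OF res] by auto
  have "T t x = \<psi> x"
  proof (rule tends_unique[of "\<lambda>n. T t (u n)" _ sequentially])
    fix p assume p: "p \<in> P"
    show "(\<lambda>n. p (T t (u n) - T t x)) \<longlonglongrightarrow> 0"
      using bnullD[OF T_bnull1[OF u(2) t] p] t by (simp add: T_minus)
    obtain C where C: "\<And>n. norm (u n - x) \<le> C" using bnull_bounded[OF u(2)] by blast
    have "limitin (lc_topology ?V (ext_seminorms P T E)) (\<lambda>n. \<Phi> (u n - x)) (\<Phi> 0) sequentially"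
      unfolding limitin_ext using u(2) by (simp add: bnull_def)
    hence lim: "limitin (lc_topology ?V (ext_seminorms P T E)) (\<lambda>n. \<Phi> (u n - x)) 0 sequentially"
      by (simp only: \<Phi>_simps(4))
    have rng: "range (\<lambda>n. \<Phi> (u n - x)) \<subseteq> ?V" by auto
    have bnd: "\<exists>C. \<forall>n. ext_norm P T E (\<Phi> (u n - x)) \<le> C" unfolding ext_norm_def using C by auto
    have q: "(\<lambda>z. p (ext_pull P T E z)) \<in> ext_seminorms P T E" unfolding ext_seminorms_def using p by blast
    have "uniform_limit {0..t} (\<lambda>n s. p (ext_pull P T E (sgX E s (\<Phi> (u n - x))))) (\<lambda>s. 0) sequentially"
      by (rule equi[OF rng bnd lim t q])
    hence "(\<lambda>n. p (\<psi> (u n - x))) \<longlonglongrightarrow> 0"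
      unfolding \<psi>_def using t by (intro tendsto_uniform_limitI) auto
    thus "(\<lambda>n. p (T t (u n) - \<psi> x)) \<longlonglongrightarrow> 0" by (simp add: \<psi>_diff \<psi>u)
  qed simp
  thus ?thesis using \<psi>[of x] by simp
qed

lemma ext_gen_iff: "(z, v) \<in> ext_gen P T E \<longleftrightarrow> (\<exists>x y. z = \<Phi> x \<and> v = \<Phi> y \<and> (x, y) \<in> gen P T)"
proof -
  let ?V = "ext_space P T E"
  have main: "(\<Phi> x, \<Phi> y) \<in> ext_gen P T E \<longleftrightarrow> (x, y) \<in> gen P T" for x y
  proof -
    have q: "(sgX E t (\<Phi> x) - \<Phi> x) /\<^sub>R t = \<Phi> ((T t x - x) /\<^sub>R t)" if "0 < t" for t
      using that by (simp add: sgX_\<Phi> \<Phi>_simps)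
    have ev: "\<forall>\<^sub>F t in at_right 0. (sgX E t (\<Phi> x) - \<Phi> x) /\<^sub>R t = \<Phi> ((T t x - x) /\<^sub>R t)"
      unfolding eventually_at_right_field using q by (intro exI[of _ 1]) simp
    hence ev': "\<forall>\<^sub>F t in at_right 0. \<Phi> ((T t x - x) /\<^sub>R t) = (sgX E t (\<Phi> x) - \<Phi> x) /\<^sub>R t"
      by (simp only: eq_commute)
    have "limitin (lc_topology ?V (ext_seminorms P T E)) (\<lambda>t. (sgX E t (\<Phi> x) - \<Phi> x) /\<^sub>R t) (\<Phi> y) (at_right 0) \<longleftrightarrow>
        limitin (lc_topology ?V (ext_seminorms P T E)) (\<lambda>t. \<Phi> ((T t x - x) /\<^sub>R t)) (\<Phi> y) (at_right 0)"
      using limitin_transform_eventually[OF ev] limitin_transform_eventually[OF ev'] by blast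
    moreover have "ext_norm P T E (sgX E t (\<Phi> x) - \<Phi> x) = norm (T t x - x)" if "t \<in> {0<..1}" for t
      using that by (simp add: sgX_\<Phi> \<Phi>_simps ext_norm_def)
    ultimately show ?thesis
      unfolding ext_gen_def bi_generator_def by (simp add: limitin_ext limitin_P)
  qed
  have "z \<in> ?V \<and> v \<in> ?V" if "(z, v) \<in> ext_gen P T E"
    using that unfolding ext_gen_def bi_generator_def by (auto dest: limitin_topspace)
  thus ?thesis using main \<Phi>_pull by metis
qed

lemma ext_resolvent:
  assumes Q: "is_resolvent lam (gen P T) Q"
  shows "resolvent lam (ext_gen P T E) (\<Phi> x) = \<Phi> (Q x)"
proof -
  have "(y, lam *\<^sub>R y - \<Phi> x) \<in> ext_gen P T E \<longleftrightarrow> y = \<Phi> (Q x)" for y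
  proof
    assume "(y, lam *\<^sub>R y - \<Phi> x) \<in> ext_gen P T E"
    then obtain a b where "y = \<Phi> a" "lam *\<^sub>R y - \<Phi> x = \<Phi> b" "(a, b) \<in> gen P T" unfolding ext_gen_iff by blast
    moreover from this have "b = lam *\<^sub>R a - x" by (simp add: \<Phi>_simps)
    ultimately show "y = \<Phi> (Q x)" using Q unfolding is_resolvent_def by auto
  next
    assume "y = \<Phi> (Q x)"
    thus "(y, lam *\<^sub>R y - \<Phi> x) \<in> ext_gen P T E"
      unfolding ext_gen_iff using is_resolvent_graph[OF Q, of x] by (auto simp: \<Phi>_simps)
  qed
  thus ?thesis unfolding resolvent_def by simp
qed

lemma resolvent_comp_eq:
  assumes Q: "is_resolvent lam (gen P T) Q" and B: "range B \<subseteq> ext_space P T E"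
  shows "resolvent_comp P T E lam B x = ext_pull P T E (B x) + (base E - lam) *\<^sub>R Q (ext_pull P T E (B x))"
proof -
  let ?n = "ext_pull P T E (B x)"
  have "B x = \<Phi> ?n" using B by (intro \<Phi>_pull[symmetric]) auto
  hence "resolvent lam (ext_gen P T E) (B x) = \<Phi> (Q ?n)" using ext_resolvent[OF Q] by metis
  also have "Q ?n = R (?n + (base E - lam) *\<^sub>R Q ?n)"
    using resolvent_identity[OF Q res, of ?n] by (simp add: linear_add[OF R_lin] linear_scale[OF R_lin])
  finally show ?thesis unfolding resolvent_comp_def by (simp add: inv_emb)
qed

text \<open>
  For \<open>a = x - ext_pull P T E (B x)\<close> both sides say that \<open>a\<close> lies in the domain of the generator, with a
  prescribed value there: one expresses it by the resolvent at \<open>base E\<close>, the other by the one at \<open>lam\<close>.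
\<close>

lemma perturbed_part_iff:
  assumes Q: "is_resolvent lam (gen P T) Q" and B: "range B \<subseteq> ext_space P T E"
  shows "(x, y) \<in> perturbed_part P T E B \<longleftrightarrow> x - resolvent_comp P T E lam B x = Q (lam *\<^sub>R x - y)"
proof -
  let ?\<mu> = "base E"
  define n where "n = ext_pull P T E (B x)"
  define a where "a = x - n"
  define v where "v = ?\<mu> *\<^sub>R x - y"
  have Bn: "B x = \<Phi> n" unfolding n_def using B by (intro \<Phi>_pull[symmetric]) auto
  have Q_lin: "linear Q" by (rule is_resolvent_lin[OF Q])
  note Q_simps = linear_add[OF Q_lin] linear_diff[OF Q_lin] linear_scale[OF Q_lin]
  have "(x, y) \<in> perturbed_part P T E B \<longleftrightarrow> (\<exists>z. (R x, z) \<in> gen P T \<and> z + n = R y)"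
    unfolding perturbed_part_def ext_gen_iff by (auto simp: emb_\<Phi> Bn \<Phi>_simps)
  also have "\<dots> \<longleftrightarrow> ?\<mu> *\<^sub>R R x - x + n = R y"
    using is_resolvent_graph[OF res, of x] gen_unique by metis
  also have "\<dots> \<longleftrightarrow> a = R v"
    unfolding a_def v_def by (auto simp: linear_diff[OF R_lin] linear_scale[OF R_lin] algebra_simps)
  also have "\<dots> \<longleftrightarrow> (a, ?\<mu> *\<^sub>R a - v) \<in> gen P T"
    using res unfolding is_resolvent_def by simp
  also have "\<dots> \<longleftrightarrow> a = Q (lam *\<^sub>R a - (?\<mu> *\<^sub>R a - v))"
    using Q unfolding is_resolvent_def by simp
  also have "\<dots> \<longleftrightarrow> x - (n + (?\<mu> - lam) *\<^sub>R Q n) = Q (lam *\<^sub>R x - y)"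
    unfolding a_def v_def by (auto simp: Q_simps algebra_simps)
  finally show ?thesis unfolding resolvent_comp_eq[OF Q B] n_def .
qed

end

section \<open>Positivity of the perturbation\<close>

text \<open>
  Take the sequence of weights that is \<open>1\<close> at index \<open>0\<close> and \<open>0\<close> elsewhere.
\<close>

lemma scaled_mixed_seminorm:
  assumes "seminorm p" "p \<in> P" "c > 0" "\<And>x. p x \<le> c * norm x"
  shows "(\<lambda>x. inverse c * p x) \<in> mixed_seminorms P"
proof -
  define a where "a n = (if n = 0 then 1 else 0 :: real)" for n :: nat
  let ?p = "\<lambda>x. inverse c * p x"
  have "a \<longlonglongrightarrow> 0"
    by (rule Lim_transform_eventually[OF tendsto_const]) (auto simp: a_def eventually_sequentially intro!: exI[of _ 1])
  moreover have "?p \<in> normalized_seminorms P"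
    using assms unfolding normalized_seminorms_def by (auto simp: field_simps intro!: exI[of _ "inverse c"] exI[of _ p])
  moreover have "?p = (\<lambda>x. SUP n. a n * ?p x)"
  proof
    fix x
    have p: "0 \<le> ?p x" using assms(3) seminorm_nonneg[OF assms(1)] by simp
    have bd: "a n * ?p x \<le> ?p x" for n using p by (simp add: a_def)
    have "?p x \<le> (SUP n. a n * ?p x)"
      using cSUP_upper[of 0 UNIV "\<lambda>n. a n * ?p x"] bd unfolding bdd_above_def by (force simp: a_def)
    moreover have "(SUP n. a n * ?p x) \<le> ?p x" by (rule cSUP_least) (use bd in auto)
    ultimately show "?p x = (SUP n. a n * ?p x)" by simp
  qed
  ultimately show ?thesis
    unfolding mixed_seminorms_def by (intro CollectI exI[of _ a] exI[of _ "\<lambda>_. ?p"]) (auto simp: a_def)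
qed

locale positive_extrapolated = extrapolated P T M w E R \<Phi> + positive_bi_semigroup P T M w
  for P :: "('a::banach_lattice \<Rightarrow> real) set" and T :: "real \<Rightarrow> 'a \<Rightarrow> 'a" and M w :: real
    and E :: "('a, 'b::banach, 'c::banach) extrapolation" and R :: "'a \<Rightarrow> 'a" and \<Phi> :: "'a \<Rightarrow> 'c"
begin

lemma cone_approx:
  assumes z: "z \<in> ext_cone P T E" and q: "q \<in> mixed_seminorms P" and e: "0 < e" and q0: "q 0 = 0"
  shows "\<exists>y\<ge>0. q (R y - ext_pull P T E z) < e"
proof -
  let ?V = "ext_space P T E" and ?q = "\<lambda>v. q (ext_pull P T E v)"
  have zV: "z \<in> ?V"
    using z closure_of_subset_topspace[of "lc_topology ?V (ext_mixed_seminorms P T E)"] unfolding ext_cone_def by auto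
  have "?q \<in> ext_mixed_seminorms P T E" unfolding ext_mixed_seminorms_def using q by blast
  from openin_lc_ball[OF this zV e] have op: "openin (lc_topology ?V (ext_mixed_seminorms P T E)) {y \<in> ?V. ?q (y - z) < e}" .
  have mem: "z \<in> {y \<in> ?V. ?q (y - z) < e}" using zV e q0 pull_\<Phi>[of 0] by (simp add: \<Phi>_simps)
  have "\<forall>S. z \<in> S \<and> openin (lc_topology ?V (ext_mixed_seminorms P T E)) S \<longrightarrow> (\<exists>y'. y' \<in> emb P T E ` {0..} \<and> y' \<in> S)"
    using z unfolding ext_cone_def in_closure_of by (rule conjunct2)
  from mp[OF spec[OF this] conjI[OF mem op]]
  have "\<exists>y'. y' \<in> emb P T E ` {0..} \<and> y' \<in> {y \<in> ?V. ?q (y - z) < e}" .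
  then obtain y where y: "0 \<le> y" "?q (emb P T E y - z) < e" by auto
  have "emb P T E y - z = \<Phi> (R y - ext_pull P T E z)"
    using \<Phi>_pull[OF zV] by (simp add: emb_\<Phi> flip: \<Phi>_simps(2))
  thus ?thesis using y by auto
qed

text \<open>
  For \<open>v\<close> the resolvent at \<open>lam\<close> of the extrapolated generator, applied to \<open>z\<close>, the vector
  \<open>v - rescale (- lam) T t v\<close> is a linear function \<open>C\<close> of \<open>ext_pull P T E z\<close>. It is continuous from the
  mixed topology to the given one by local equicontinuity, and it is positive if \<open>z\<close> is the image of a
  positive vector. So it is positive on the closure.
\<close>

lemma excessive_small:
  assumes eq: "locally_equicontinuous (mixed_seminorms P) T" and Q: "is_resolvent lam (gen P T) Q"
  shows "\<exists>t0>0. \<forall>z\<in>ext_cone P T E. \<forall>t\<in>{0..t0}.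
    let v = ext_pull P T E z + (base E - lam) *\<^sub>R Q (ext_pull P T E z) in rescale (- lam) T t v \<le> v"
proof -
  let ?U = "rescale (- lam) T" and ?\<mu> = "base E"
  obtain t0 where t0: "0 < t0" and eq': "\<And>p. p \<in> mixed_seminorms P \<Longrightarrow>
      \<exists>q\<in>mixed_seminorms P. \<exists>M\<ge>0. \<forall>x. \<forall>t\<in>{0..t0}. p (T t x) \<le> M * q x"
    using eq unfolding locally_equicontinuous_def by blast
  interpret U: positive_bi_semigroup P ?U M "w + \<bar>- lam\<bar>" by (rule positive_rescale)
  have Q_lin: "linear Q" by (rule is_resolvent_lin[OF Q])
  have "?U t v \<le> v" if z: "z \<in> ext_cone P T E" and t: "t \<in> {0..t0}"
      and v: "v = ext_pull P T E z + (?\<mu> - lam) *\<^sub>R Q (ext_pull P T E z)" for z t v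
  proof -
    have t': "0 \<le> t" using t by simp
    define H where "H x = x + (?\<mu> - lam) *\<^sub>R Q x" for x
    define C where "C x = H x - ?U t (H x)" for x
    have C_lin: "C (x - y) = C x - C y" for x y
      using t' unfolding C_def H_def by (simp add: U.T_minus U.T_plus U.T_scaleR linear_diff[OF Q_lin] algebra_simps)
    have C_Q: "C x = (x - ?U t x) + (?\<mu> - lam) *\<^sub>R (Q x - ?U t (Q x))" for x
      unfolding C_def H_def U.T_plus[OF t'] U.T_scaleR[OF t'] by (simp add: scaleR_diff_right)
    have C_R: "0 \<le> C (R y)" if "0 \<le> y" for y
    proof -
      have "H (R y) = Q y"
        using resolvent_identity[OF res Q, of y] unfolding H_def by (simp add: algebra_simps)
      thus ?thesis unfolding C_def using resolvent_excessive[OF Q t' that] by simp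
    qed
    have "0 \<le> C (ext_pull P T E z)"
    proof (rule nonneg_of_p_approx)
      fix p and e :: real assume p: "p \<in> P" and e: "0 < e"
      obtain c where c: "0 < c" "\<And>x. p x \<le> c * norm x" using seminorm_le_norm[OF p] by blast
      have "(\<lambda>x. inverse c * p x) \<in> mixed_seminorms P" by (rule scaled_mixed_seminorm[OF sn[OF p] p c])
      then obtain q m where q: "q \<in> mixed_seminorms P" "0 \<le> m"
          "\<And>x s. s \<in> {0..t0} \<Longrightarrow> inverse c * p (T s x) \<le> m * q x"
        using eq' by blast
      have q0: "q 0 = 0"
      proof -
        obtain a p' where ap: "q = (\<lambda>x. SUP n. a n * p' n x)" "\<forall>n::nat. p' n \<in> normalized_seminorms P"
          using q(1) unfolding mixed_seminorms_def by blast
        have "p' n 0 = 0" for n using ap(2)[rule_format, of n] unfolding normalized_seminorms_def by auto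
        thus ?thesis unfolding ap(1) by simp
      qed
      define b where "b = exp (\<bar>lam\<bar> * t0) * (c * m)"
      have b: "0 \<le> b" unfolding b_def using c q by simp
      have pT: "p (T s x) \<le> c * m * q x" if "s \<in> {0..t0}" for s x
        using q(3)[OF that, of x] c(1) by (simp add: field_simps)
      have pU: "p (?U s x) \<le> b * q x" if s: "s \<in> {0..t0}" for s x
      proof -
        have "- lam * s \<le> \<bar>lam\<bar> * t0" using s by (intro mult_mono) auto
        hence "exp (- lam * s) * p (T s x) \<le> exp (\<bar>lam\<bar> * t0) * (c * m * q x)"
          using pT[OF s] p_nonneg[OF p] by (intro mult_mono) auto
        thus ?thesis unfolding b_def rescale_def by (simp add: p_scale[OF p] mult.assoc)
      qed
      have p1: "p x \<le> b * q x" for x using pU[of 0 x] t0 by simp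
      have pQ: "p (Q x - ?U t (Q x)) \<le> t * (b * q x)" for x
      proof -
        have "p (?U t (- Q x) - (- Q x)) \<le> t * (b * q x)"
          by (rule U.increment_approx[OF rescale_gen[OF Q] t' p pU]) (use t in auto)
        thus ?thesis using t' by (simp add: U.T_neg)
      qed
      have pC: "p (C x) \<le> (2 + \<bar>?\<mu> - lam\<bar> * t) * (b * q x)" for x
      proof -
        have "p (C x) \<le> p (x - ?U t x) + p ((?\<mu> - lam) *\<^sub>R (Q x - ?U t (Q x)))" unfolding C_Q by (rule p_tri[OF p])
        also have "\<dots> \<le> (p x + p (?U t x)) + \<bar>?\<mu> - lam\<bar> * p (Q x - ?U t (Q x))"
          using seminorm_diff_le[OF sn[OF p]] by (simp add: p_scale[OF p])
        also have "\<dots> \<le> (b * q x + b * q x) + \<bar>?\<mu> - lam\<bar> * (t * (b * q x))"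
          using p1 pU[OF t] pQ by (intro add_mono mult_left_mono) auto
        finally show ?thesis by (simp add: algebra_simps)
      qed
      define D where "D = (2 + \<bar>?\<mu> - lam\<bar> * t) * b + 1"
      have D: "0 < D" unfolding D_def using b t' by (intro add_nonneg_pos mult_nonneg_nonneg) auto
      obtain y where y: "0 \<le> y" "q (R y - ext_pull P T E z) < e / D"
        using cone_approx[OF z q(1) _ q0, of "e / D"] e D by auto
      have "p (C (R y) - C (ext_pull P T E z)) \<le> (D - 1) * q (R y - ext_pull P T E z)"
        unfolding C_lin[symmetric] using pC[of "R y - ext_pull P T E z"] by (simp add: D_def mult.assoc)
      also have "\<dots> \<le> (D - 1) * (e / D)" using y(2) b t' unfolding D_def by (intro mult_left_mono) auto
      also have "\<dots> < D * (e / D)" using e D by (intro mult_strict_right_mono) auto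
      also have "\<dots> = e" using D by simp
      finally show "\<exists>y\<ge>0. p (y - C (ext_pull P T E z)) < e"
        using C_R[OF y(1)] by blast
    qed
    thus ?thesis unfolding C_def H_def v by simp
  qed
  thus ?thesis using t0 unfolding Let_def by blast
qed

end

context positive_bi_semigroup
begin

text \<open>
  Divide \<open>t\<close> into \<open>n\<close> equal steps of length at most \<open>t0\<close>.
\<close>

lemma excessive_iterate:
  assumes t0: "0 < t0" and v: "\<And>s. s \<in> {0..t0} \<Longrightarrow> U s v \<le> v" and t: "0 \<le> t"
  shows "U t v \<le> v"
proof -
  obtain n :: nat where n: "t / t0 < real n" using reals_Archimedean2 by blast
  have n0: "0 < real n" using n t t0 by (metis divide_nonneg_pos order.strict_trans1)
  define s where "s = t / real n"
  have s: "s \<in> {0..t0}" "real n * s = t" unfolding s_def using n n0 t t0 by (auto simp: field_simps)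
  have "U (real k * s) v \<le> v" for k
  proof (induction k)
    case (Suc k)
    have "U (real (Suc k) * s) v = U s (U (real k * s) v)"
      using s(1) T_add[of s "real k * s" v] by (simp add: distrib_right)
    also have "\<dots> \<le> U s v"
    proof -
      have "0 \<le> U s (v - U (real k * s) v)" using Suc s(1) by (intro U_pos) auto
      thus ?thesis using s(1) by (simp add: T_minus)
    qed
    also have "\<dots> \<le> v" by (rule v[OF s(1)])
    finally show ?case .
  qed simp
  from this[of n] show ?thesis unfolding s(2) .
qed

text \<open>
  By commutation with the semigroup, the positive resolvent maps \<open>v - U t v\<close>, with \<open>U\<close> rescaled, to an
  increment of the orbit of \<open>- Q v\<close>. Divided by \<open>t\<close> these increments tend to \<open>v\<close>.
\<close>

lemma excessive_nonneg:
  assumes Q: "is_resolvent lam (gen P U) Q" and Q_pos: "\<And>x. 0 \<le> x \<Longrightarrow> 0 \<le> Q x"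
    and v: "\<And>t. 0 \<le> t \<Longrightarrow> rescale (- lam) U t v \<le> v"
  shows "0 \<le> v"
proof -
  interpret E: positive_bi_semigroup P "rescale (- lam) U" M "w + \<bar>- lam\<bar>" by (rule positive_rescale)
  have Q_lin: "linear Q" by (rule is_resolvent_lin[OF Q])
  let ?h = "\<lambda>n. inverse (real (Suc n))"
  show ?thesis
  proof (rule nonneg_lim)
    show "bnull P (\<lambda>n. (rescale (- lam) U (?h n) (- Q v) - (- Q v)) /\<^sub>R ?h n - v)"
      by (rule E.gen_quotient_seq[OF rescale_gen[OF Q] _ _ LIMSEQ_inverse_real_of_nat]) (auto simp: inverse_le_1_iff)
    show "0 \<le> (rescale (- lam) U (?h n) (- Q v) - (- Q v)) /\<^sub>R ?h n" for n
    proof -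
      have "0 \<le> Q (v - rescale (- lam) U (?h n) v)" using v[of "?h n"] by (intro Q_pos) simp
      also have "\<dots> = rescale (- lam) U (?h n) (- Q v) - (- Q v)"
        by (simp add: rescale_def T_neg linear_diff[OF Q_lin] linear_scale[OF Q_lin] is_resolvent_T[OF Q])
      finally show ?thesis by (intro scaleR_nonneg_nonneg) auto
    qed
  qed
qed

end

section \<open>The perturbation theorem\<close>

theorem theorem3p3:
  fixes P :: "('a::banach_lattice \<Rightarrow> real) set"
    and T :: "real \<Rightarrow> 'a \<Rightarrow> 'a"
    and E :: "('a, 'b::banach, 'c::banach) extrapolation"
    and B :: "'a \<Rightarrow> 'c"
  assumes "bi_AM_space P" and "compatible P"
    and "bi_continuous_semigroup UNIV norm P T" and "positive_semigroup T"
    and "lc_complete (mixed_seminorms P)"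
    and "locally_equicontinuous (mixed_seminorms P) T"
    and "is_extrapolation P T E"
    and "ext_bounded_linear P T E B"
    and "continuous_map (lc_topology UNIV P)
           (lc_topology (ext_space P T E) (ext_seminorms P T E)) B"
    and "\<forall>x\<ge>0. B x \<in> ext_cone P T E"
    and "\<exists>lam::real. spectral_bound (gen P T) < ereal lam \<and>
           local_op P (resolvent_comp P T E lam B) \<and>
           onorm (resolvent_comp P T E lam B) < 1"
  shows "\<exists>S. bi_continuous_semigroup UNIV norm P S \<and> positive_semigroup S \<and>
           perturbed_part P T E B = gen P S"
proof -
  interpret bi_seq P using assms(1) bi_space_imp_bi_seq unfolding bi_AM_space_def by blast
  obtain M w where "bi_semigroup P T M w" using bi_semigroupI[OF assms(3)] by blast
  then interpret bi_semigroup P T M w .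
  have solid: "p x \<le> p y" if "p \<in> P" "\<bar>x\<bar> \<le> \<bar>y\<bar>" for p x y
    using assms(2) that unfolding compatible_def by blast
  interpret positive_bi_semigroup P T M w
  proof (rule positive_bi_semigroup.intro[OF bi_semigroup_axioms positive_bi_semigroup_axioms.intro])
    show "0 \<le> T t x" if "0 \<le> t" "0 \<le> x" for t x using assms(4) that unfolding positive_semigroup_def by blast
  qed (rule solid)
  have "complex_of_real (base E) \<in> resolvent_set (gen P T)" using assms(7) unfolding is_extrapolation_def by blast
  then obtain R where R: "is_resolvent (base E) (gen P T) R" using real_resolvent_exists[OF _ gen_zero] by blast
  obtain \<Phi> where \<Phi>: "linear \<Phi>" "range \<Phi> = ext_space P T E" "\<And>x. ext_pull P T E (\<Phi> x) = x"
      "\<And>x. emb P T E x = \<Phi> (R x)"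
    using ext_space_iso[OF assms(7) R] by metis
  interpret positive_extrapolated P T M w E R \<Phi>
    by (rule positive_extrapolated.intro[OF extrapolated.intro[OF bi_semigroup_axioms
          extrapolated_axioms.intro[OF assms(7) R \<Phi>]] positive_bi_semigroup_axioms])
  obtain lam where lam: "spectral_bound (gen P T) < ereal lam"
      "local_op P (resolvent_comp P T E lam B)" "onorm (resolvent_comp P T E lam B) < 1"
    using assms(11) by blast
  define N where "N = resolvent_comp P T E lam B"
  \<comment> \<open>The whole half line from \<open>lam\<close> on lies above the spectral bound.\<close>
  have res: "\<exists>Q. is_resolvent \<nu> (gen P T) Q" if "lam \<le> \<nu>" for \<nu>
  proof (rule real_resolvent_exists[OF _ gen_zero], rule ccontr)
    assume "complex_of_real \<nu> \<notin> resolvent_set (gen P T)"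
    hence "ereal (Re (complex_of_real \<nu>)) \<le> spectral_bound (gen P T)"
      unfolding spectral_bound_def by (intro SUP_upper) simp
    also have "\<dots> < ereal lam" by (rule lam(1))
    finally show False using that by simp
  qed
  then obtain Q where Q: "is_resolvent lam (gen P T) Q" by blast
  have Q_pos: "0 \<le> Q x" if "0 \<le> x" for x by (rule resolvent_pos[OF res Q that])
  let ?U = "rescale (- lam) T"
  interpret U: positive_bi_semigroup P ?U M "w + \<bar>- lam\<bar>" by (rule positive_rescale)
  have B: "range B \<subseteq> ext_space P T E" using assms(8) unfolding ext_bounded_linear_def by blast
  have N_blin: "bounded_linear N" using lam(2) unfolding N_def local_op_def by blast
  have excess: "?U t (N x) \<le> N x" if t: "0 \<le> t" and x: "0 \<le> x" for t x
  proof -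
    obtain t0 where t0: "0 < t0" and *: "\<And>z s v. z \<in> ext_cone P T E \<Longrightarrow> s \<in> {0..t0} \<Longrightarrow>
        v = ext_pull P T E z + (base E - lam) *\<^sub>R Q (ext_pull P T E z) \<Longrightarrow> ?U s v \<le> v"
      using excessive_small[OF assms(6) Q] unfolding Let_def by blast
    show ?thesis
      by (rule U.excessive_iterate[OF t0 _ t], rule *[of "B x"])
         (use assms(10) x in \<open>auto simp: N_def resolvent_comp_eq[OF Q B]\<close>)
  qed
  interpret V: positive_perturbation P ?U M "w + \<bar>- lam\<bar>" N Q "onorm N"
  proof (rule positive_perturbation.intro[OF U.positive_bi_semigroup_axioms positive_perturbation_axioms.intro])
    show "p (sup x y) = max (p x) (p y)" if "p \<in> P" "0 \<le> x" "0 \<le> y" for p x y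
      using assms(1) that unfolding bi_AM_space_def by blast
    show "norm (sup x y) = max (norm x) (norm y)" if "0 \<le> x" "0 \<le> y" for x y :: 'a
      using assms(1) that unfolding bi_AM_space_def by blast
    show "is_resolvent 0 (gen P ?U) Q" using is_resolvent_rescale[OF Q] Q by (simp add: is_resolvent_def)
    show "linear N" using N_blin by (rule bounded_linear.linear)
    show "0 \<le> N x" if "0 \<le> x" for x
      by (rule excessive_nonneg[OF Q Q_pos excess[OF _ that]])
    show "0 \<le> onorm N" by (rule onorm_pos_le[OF N_blin])
    show "norm (N x) \<le> onorm N * norm x" for x by (rule onorm[OF N_blin])
    show "bnull P (\<lambda>n. N (u n))" if u: "bnull P u" for u
    proof -
      obtain a where a: "\<And>n. norm (u n) \<le> a" using bnull_bounded[OF u] by blast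
      have "norm (N (u n)) \<le> onorm N * a" for n
        using order_trans[OF onorm[OF N_blin] mult_left_mono[OF a onorm_pos_le[OF N_blin]]] .
      moreover have "\<forall>\<^sub>F n in sequentially. p (N (u n)) < e" if p: "p \<in> P" and e: "0 < e" for p and e :: real
      proof -
        \<comment> \<open>The share of the norm in the locality estimate, so that it costs at most \<open>e / 2\<close> on norms up to \<open>a\<close>.\<close>
        define d where "d = e / (2 * (\<bar>a\<bar> + 1))"
        have d: "0 < d" "d * a \<le> e / 2"
        proof -
          show "0 < d" unfolding d_def using e by simp
          hence "d * a \<le> d * (\<bar>a\<bar> + 1)" by (intro mult_left_mono) auto
          also have "\<dots> = e / 2"
          proof -
            have k: "e / (2 * k) * k = e / 2" if "k \<noteq> 0" for k using that by simp
            have "\<bar>a\<bar> + 1 \<noteq> 0" by linarith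
            thus ?thesis unfolding d_def by (rule k)
          qed
          finally show "d * a \<le> e / 2" .
        qed
        obtain k q where kq: "0 < k" "q \<in> P" "\<And>x. p (N x) \<le> k * q x + d * norm x"
          using lam(2) p d(1) unfolding local_op_def N_def by blast
        have "(\<lambda>n. k * q (u n)) \<longlonglongrightarrow> k * 0" by (intro tendsto_mult tendsto_const bnullD[OF u kq(2)])
        hence "\<forall>\<^sub>F n in sequentially. k * q (u n) < e / 2" using e by (intro order_tendstoD(2)) auto
        thus "\<forall>\<^sub>F n in sequentially. p (N (u n)) < e"
        proof eventually_elim
          case (elim n)
          have "d * norm (u n) \<le> d * a" using a d(1) by (intro mult_left_mono) auto
          thus ?case using kq(3)[of "u n"] elim d(2) by linarith
        qed
      qed
      ultimately show ?thesis by (rule bnullI)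
    qed
  qed (use excess lam(3) in \<open>auto simp: N_def\<close>)
  let ?S = "rescale lam V.S"
  have "bi_continuous_semigroup UNIV norm P ?S"
    by (rule bi_semigroup.bi_continuous[OF V.S.bi_semigroup_rescale])
  moreover have "positive_semigroup ?S"
    unfolding positive_semigroup_def
  proof (intro allI impI)
    fix t :: real and x :: 'a assume "0 \<le> t" "0 \<le> x"
    hence "0 \<le> V.S t x" by (rule V.S_pos)
    thus "0 \<le> ?S t x" unfolding rescale_def[of lam] by (intro scaleR_nonneg_nonneg) auto
  qed
  moreover have "perturbed_part P T E B = gen P ?S"
  proof (intro set_eqI)
    fix xy :: "'a \<times> 'a"
    obtain x y where xy: "xy = (x, y)" by (cases xy)
    show "xy \<in> perturbed_part P T E B \<longleftrightarrow> xy \<in> gen P ?S"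
      unfolding xy perturbed_part_iff[OF Q B] V.S.gen_rescale V.gen_S_eq_G V.G_def N_def[symmetric]
      by (simp add: is_resolvent_rescale[OF Q])
  qed
  ultimately show ?thesis by blast
qed

end
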